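(* Let $R\subset\mathbb R^n$ be a nonempty strongly eutactic root system of norm $2$ spanning $\mathbb R^n$. For $j\ge1$ consider the condition $(C_{2j})$: $\sum_{x\in R}f(x)=0$ for all $f\in\mathrm{Harm}_{2j}(\mathbb R^n)$. Then (equivalence meaning isometry of root systems): (i) $(C_2)$ always holds (i.e. $R$ is a spherical $3$-design); (ii) $(C_4)$ holds iff $R$ is equivalent to one of $A_1,A_2,D_4,E_6,E_7,E_8$; (iii) $(C_6)$ holds iff $R$ is equivalent to one of $A_1,\ 2A_1,\ E_8,\ 2E_8,\ D_{16}$; (iv) $(C_8)$ holds iff $R$ is equivalent to $A_1$ or $A_2$; (v) $(C_{10})$ holds iff $R$ is equivalent to one of $A_1,\ 2A_1,\ A_2,\ D_4,\ E_8$; (vi) $(C_{12})$ holds iff $R$ is equivalent to $A_1$.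
   Context: A root system is a finite subset $R\subset\mathbb R^n$ not containing $0$, closed under the reflections $s_y$ ($y\in R$), with $2\langle x,y\rangle/\langle x,x\rangle\in\mathbb Z$; norm $2$ means $\langle x,x\rangle=2$ for all $x\in R$. Orthogonal unions and irreducible components are as usual; $kR$ denotes the orthogonal union of $k$ copies of $R$. The Coxeter number of an irreducible root system $R\subset\mathbb R^n$ is $h=|R|/n$; $R$ is strongly eutactic if all irreducible components have the same Coxeter number. $A_n,D_n,E_6,E_7,E_8$ are the standard irreducible simply laced root systems normalized to norm 2 (Coxeter numbers $n+1$, $2(n-1)$, $12$, $18$, $30$). $\mathrm{Harm}_{j}(\mathbb R^n)$ denotes the homogeneous harmonic polynomials of degree $j$ on $\mathbb R^n$. *)

theory Defs
  imports "HOL-Analysis.Analysis"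
begin

definition refl_root :: "real^'n \<Rightarrow> real^'n \<Rightarrow> real^'n" where
  "refl_root y x = x - (2 * inner x y / inner y y) *\<^sub>R y"

definition root_system :: "(real^'n) set \<Rightarrow> bool" where
  "root_system R \<longleftrightarrow> finite R \<and> 0 \<notin> R \<and>
     (\<forall>x\<in>R. \<forall>y\<in>R. refl_root y x \<in> R) \<and>
     (\<forall>x\<in>R. \<forall>y\<in>R. 2 * inner x y / inner x x \<in> \<int>)"

definition norm_two :: "(real^'n) set \<Rightarrow> bool" where
  "norm_two R \<longleftrightarrow> (\<forall>x\<in>R. inner x x = 2)"

definition nonorth :: "(real^'n) set \<Rightarrow> ((real^'n) \<times> (real^'n)) set" where
  "nonorth R = {(x, y). x \<in> R \<and> y \<in> R \<and> inner x y \<noteq> 0}"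

definition components :: "(real^'n) set \<Rightarrow> (real^'n) set set" where
  "components R = (\<lambda>x. {y \<in> R. (x, y) \<in> (nonorth R)\<^sup>*}) ` R"

definition coxeter_number :: "(real^'n) set \<Rightarrow> real" where
  "coxeter_number C = real (card C) / real (dim C)"

definition strongly_eutactic :: "(real^'n) set \<Rightarrow> bool" where
  "strongly_eutactic R \<longleftrightarrow>
     (\<forall>C\<in>components R. \<forall>D\<in>components R. coxeter_number C = coxeter_number D)"

definition mono_val :: "('n::finite \<Rightarrow> nat) \<Rightarrow> real^'n \<Rightarrow> real" where
  "mono_val \<alpha> x = (\<Prod>i\<in>UNIV. (x $ i) ^ (\<alpha> i))"

definition mdeg :: "('n::finite \<Rightarrow> nat) \<Rightarrow> nat" where
  "mdeg \<alpha> = (\<Sum>i\<in>UNIV. \<alpha> i)"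

text \<open>Harm_k: functions given by a homogeneous polynomial of degree k (coefficients c)
  whose Laplacian vanishes; the coefficient of x^beta in the Laplacian of
  sum c_alpha x^alpha is sum_i (beta_i+2)(beta_i+1) c_(beta + 2 e_i).\<close>
definition Harm :: "nat \<Rightarrow> (real^'n \<Rightarrow> real) set" where
  "Harm k = {f. \<exists>c :: ('n \<Rightarrow> nat) \<Rightarrow> real.
      (\<forall>x. f x = (\<Sum>\<alpha>\<in>{\<alpha>. mdeg \<alpha> = k}. c \<alpha> * mono_val \<alpha> x)) \<and>
      (\<forall>\<beta>. mdeg \<beta> + 2 = k \<longrightarrow>
          (\<Sum>i\<in>UNIV. real ((\<beta> i + 2) * (\<beta> i + 1)) * c (\<beta>(i := \<beta> i + 2))) = 0)}"

definition cond_C :: "(real^'n) set \<Rightarrow> nat \<Rightarrow> bool" where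
  "cond_C R k \<longleftrightarrow> (\<forall>f\<in>Harm k. (\<Sum>x\<in>R. f x) = 0)"

definition ee :: "nat \<Rightarrow> nat \<Rightarrow> real" where
  "ee a = (\<lambda>k. if k = a then 1 else 0)"

definition std_A :: "nat \<Rightarrow> (nat \<Rightarrow> real) set" where
  "std_A n = {(\<lambda>k. ee i k - ee j k) | i j. i \<le> n \<and> j \<le> n \<and> i \<noteq> j}"

definition std_D :: "nat \<Rightarrow> (nat \<Rightarrow> real) set" where
  "std_D n = {(\<lambda>k. s * ee i k + t * ee j k) | i j s t.
      i < j \<and> j < n \<and> s \<in> {1, -1} \<and> t \<in> {1, -1}}"

definition std_E8 :: "(nat \<Rightarrow> real) set" where
  "std_E8 = std_D 8 \<union>
     {v. (\<forall>k<8. v k = 1/2 \<or> v k = -1/2) \<and> (\<forall>k\<ge>8. v k = 0) \<and>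
         even (card {k. k < 8 \<and> v k < 0})}"

definition ip16 :: "(nat \<Rightarrow> real) \<Rightarrow> (nat \<Rightarrow> real) \<Rightarrow> real" where
  "ip16 v w = (\<Sum>k<16. v k * w k)"

text \<open>Bourbaki: E7 = roots of E8 orthogonal to e7+e8, E6 = those also orthogonal to e6-e7
  (1-indexed coordinates).\<close>
definition std_E7 :: "(nat \<Rightarrow> real) set" where
  "std_E7 = {v \<in> std_E8. ip16 v (\<lambda>k. ee 6 k + ee 7 k) = 0}"

definition std_E6 :: "(nat \<Rightarrow> real) set" where
  "std_E6 = {v \<in> std_E7. ip16 v (\<lambda>k. ee 5 k - ee 6 k) = 0}"

definition shift :: "nat \<Rightarrow> (nat \<Rightarrow> real) \<Rightarrow> (nat \<Rightarrow> real)" where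
  "shift m v = (\<lambda>k. if k < m then 0 else v (k - m))"

definition std_2A1 :: "(nat \<Rightarrow> real) set" where
  "std_2A1 = std_A 1 \<union> shift 2 ` std_A 1"

definition std_2E8 :: "(nat \<Rightarrow> real) set" where
  "std_2E8 = std_E8 \<union> shift 8 ` std_E8"

definition emb16 :: "(nat \<Rightarrow> real) \<Rightarrow> real^16" where
  "emb16 v = (\<chi> i. v (nat (Rep_bit0 i)))"

definition equiv_std :: "(real^'n) set \<Rightarrow> (nat \<Rightarrow> real) set \<Rightarrow> bool" where
  "equiv_std R S \<longleftrightarrow> (\<exists>T :: real^'n \<Rightarrow> real^16.
      linear T \<and> (\<forall>x. norm (T x) = norm x) \<and> T ` R = emb16 ` S)"

end

theory Submission
  imports Defs
begin

text \<open>
  The Fischer inner product on homogeneous polynomials makes the powers of \<open>inner x\<close> reproducing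
  kernels and multiplication by \<open>|x|\<^sup>2\<close> adjoint to the Laplacian. With the explicit harmonic projection
  \<open>Z\<^sub>x\<close> of \<open>(inner x)\<^sup>2\<^sup>j\<close>, condition \<open>C\<^sub>2\<^sub>j\<close> is therefore equivalent to the vanishing of the sum of
  \<open>Z\<^sub>x(y)\<close> over \<open>x, y \<in> R\<close>. As \<open>R\<close> is strongly eutactic, the even moments of \<open>R\<close> at a root depend only
  on the dimension \<open>n\<close> and the Coxeter number \<open>h\<close>, and the condition becomes a polynomial equation in
  \<open>n\<close> and \<open>h\<close>, linear in \<open>h\<close>.

  The pairs \<open>(n, h)\<close> are turned into root systems by classification. The roots are exactly the vectors of
  norm 2 in the lattice spanned by any set of roots. If the roots \<open>b\<^sub>i\<close> are linearly independent and an
  irreducible \<open>R\<close> is not contained in their lattice, then a root that is minimal in its coset meets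
  exactly one \<open>b\<^sub>i\<close>, in \<open>-1\<close>, and this \<open>b\<^sub>i\<close> has coefficient 1 in the highest root. So a diagram
  \<open>E\<^sub>6\<close> in \<open>R\<close> either exhausts \<open>R\<close> or grows to \<open>E\<^sub>7\<close>, then to \<open>E\<^sub>8\<close>; without \<open>E\<^sub>6\<close>, a path
  of maximal length in \<open>R\<close> spans \<open>A\<^sub>k\<close> or can only be completed to \<open>D\<^sub>k\<^sub>+\<^sub>1\<close>.
\<close>

section \<open>Harmonic polynomials and zonal sums\<close>

text \<open>The moments depend on n and h alone because a root other than y and -y meets the root y
  in -1, 0 or 1: on all but two roots every positive even power of \<open>x \<bullet> y\<close>
  equals its square, and the second moment is fixed once \<open>casimir R\<close> is known to be a
  scalar. The resulting equations also have solutions that belong to no root system, such as n = 9,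
  h = 66 in degree 4. They are excluded by bounds on h coming from the possible types of a
  component, so the classification is needed before the arithmetic as well as after it. Conversely n
  and h need not determine R: n = 16, h = 30 fits both D_16 and 2E_8. The classification chooses
  neither positive roots nor a base of R. It works with any family of roots that has the Gram matrix
  of a diagram; independence of the family and the shape of its lattice are read off from a
  coordinate model with the same Gram matrix.\<close>

type_synonym 'n coeffs = "('n \<Rightarrow> nat) \<Rightarrow> real"

definition raise :: "'n \<Rightarrow> ('n \<Rightarrow> nat) \<Rightarrow> ('n \<Rightarrow> nat)" where
  "raise i \<alpha> = \<alpha>(i := Suc (\<alpha> i))"

definition mulX :: "'n \<Rightarrow> 'n coeffs \<Rightarrow> 'n coeffs" where
  "mulX i c \<alpha> = (if \<alpha> i = 0 then 0 else c (\<alpha>(i := \<alpha> i - 1)))"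

definition pdiff :: "'n \<Rightarrow> 'n coeffs \<Rightarrow> 'n coeffs" where
  "pdiff i c \<alpha> = real (Suc (\<alpha> i)) * c (raise i \<alpha>)"

definition mul_lin :: "real^'n \<Rightarrow> 'n::finite coeffs \<Rightarrow> 'n coeffs" where
  "mul_lin x c = (\<lambda>\<alpha>. \<Sum>i\<in>UNIV. x $ i * mulX i c \<alpha>)"

definition mul_sq :: "'n::finite coeffs \<Rightarrow> 'n coeffs" where
  "mul_sq c = (\<lambda>\<alpha>. \<Sum>i\<in>UNIV. mulX i (mulX i c) \<alpha>)"

definition dir_diff :: "real^'n \<Rightarrow> 'n::finite coeffs \<Rightarrow> 'n coeffs" where
  "dir_diff x c = (\<lambda>\<alpha>. \<Sum>i\<in>UNIV. x $ i * pdiff i c \<alpha>)"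

definition lap :: "'n::finite coeffs \<Rightarrow> 'n coeffs" where
  "lap c = (\<lambda>\<alpha>. \<Sum>i\<in>UNIV. pdiff i (pdiff i c) \<alpha>)"

definition one_coeffs :: "'n coeffs" where
  "one_coeffs \<alpha> = (if \<alpha> = (\<lambda>_. 0) then 1 else 0)"

text \<open>Only coefficients of degree k are read, so a coefficient family need not be
  homogeneous.\<close>

definition ev :: "nat \<Rightarrow> 'n::finite coeffs \<Rightarrow> real^'n \<Rightarrow> real" where
  "ev k c y = (\<Sum>\<alpha>\<in>{\<alpha>. mdeg \<alpha> = k}. c \<alpha> * mono_val \<alpha> y)"

definition afact :: "('n::finite \<Rightarrow> nat) \<Rightarrow> real" where
  "afact \<alpha> = (\<Prod>i\<in>UNIV. fact (\<alpha> i))"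

text \<open>The weight \<alpha>! is what makes multiplication by a variable adjoint to the partial
  derivative: raising the i-th exponent multiplies it by the same factor that differentiation
  produces.\<close>

definition fischer :: "nat \<Rightarrow> 'n::finite coeffs \<Rightarrow> 'n coeffs \<Rightarrow> real" where
  "fischer k c d = (\<Sum>\<alpha>\<in>{\<alpha>. mdeg \<alpha> = k}. afact \<alpha> * c \<alpha> * d \<alpha>)"

section \<open>Adjointness for the Fischer product\<close>

lemma finite_mdeg: "finite {\<alpha> :: 'n::finite \<Rightarrow> nat. mdeg \<alpha> = k}"
proof (rule finite_subset)
  show "{\<alpha> :: 'n \<Rightarrow> nat. mdeg \<alpha> = k} \<subseteq> Pi\<^sub>E UNIV (\<lambda>_. {..k})"
    unfolding mdeg_def by (auto intro!: member_le_sum)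
qed (auto intro: finite_PiE)

lemma mdeg_raise: "mdeg (raise i \<alpha>) = Suc (mdeg \<alpha>)" for \<alpha> :: "'n::finite \<Rightarrow> nat"
  unfolding mdeg_def raise_def by (subst (1 2) sum.remove[of _ i]) auto

lemma raise_lower: "\<alpha> i \<noteq> 0 \<Longrightarrow> raise i (\<alpha>(i := \<alpha> i - 1)) = \<alpha>"
  by (auto simp: raise_def)

lemma inj_raise: "inj (raise i)"
  by (rule inj_on_inverseI[where g = "\<lambda>\<alpha>. \<alpha>(i := \<alpha> i - 1)"]) (auto simp: raise_def)

lemma mono_val_raise: "mono_val (raise i \<alpha>) y = y $ i * mono_val \<alpha> y"
  unfolding mono_val_def raise_def by (subst (1 2) prod.remove[of _ i]) auto

lemma afact_raise: "afact (raise i \<alpha>) = real (Suc (\<alpha> i)) * afact \<alpha>"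
  unfolding afact_def raise_def by (subst (1 2) prod.remove[of _ i]) (auto simp: algebra_simps)

lemma mulX_raise [simp]: "mulX i c (raise i \<alpha>) = c \<alpha>"
  by (simp add: mulX_def raise_def)

text \<open>\<open>raise i\<close> maps the exponents of degree k bijectively onto those of degree k
  + 1 with nonzero i-th entry, and the hypothesis kills the other terms. Evaluation and Fischer
  product both use this reindexing.\<close>

lemma sum_mdeg_Suc:
  fixes f :: "('n::finite \<Rightarrow> nat) \<Rightarrow> real"
  assumes "\<And>\<alpha>. \<alpha> i = 0 \<Longrightarrow> f \<alpha> = 0"
  shows "(\<Sum>\<alpha>\<in>{\<alpha>. mdeg \<alpha> = Suc k}. f \<alpha>) = (\<Sum>\<alpha>\<in>{\<alpha>. mdeg \<alpha> = k}. f (raise i \<alpha>))"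
proof -
  have "(\<Sum>\<alpha>\<in>{\<alpha>. mdeg \<alpha> = k}. f (raise i \<alpha>)) = sum f (raise i ` {\<alpha>. mdeg \<alpha> = k})"
    by (subst sum.reindex) (auto intro: inj_on_subset[OF inj_raise])
  also have "raise i ` {\<alpha>. mdeg \<alpha> = k} = {\<alpha>. mdeg \<alpha> = Suc k \<and> \<alpha> i \<noteq> 0}"
  proof (intro equalityI subsetI)
    fix \<alpha> :: "'n \<Rightarrow> nat" assume a: "\<alpha> \<in> {\<alpha>. mdeg \<alpha> = Suc k \<and> \<alpha> i \<noteq> 0}"
    then have "mdeg (\<alpha>(i := \<alpha> i - 1)) = k"
      using mdeg_raise[of i "\<alpha>(i := \<alpha> i - 1)"] raise_lower[of \<alpha> i] by simp
    with a show "\<alpha> \<in> raise i ` {\<alpha>. mdeg \<alpha> = k}"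
      by (intro image_eqI[of _ _ "\<alpha>(i := \<alpha> i - 1)"]) (auto simp: raise_def)
  qed (auto simp: mdeg_raise, simp add: raise_def)
  also have "sum f {\<alpha>. mdeg \<alpha> = Suc k \<and> \<alpha> i \<noteq> 0} = (\<Sum>\<alpha>\<in>{\<alpha>. mdeg \<alpha> = Suc k}. f \<alpha>)"
    using assms by (intro sum.mono_neutral_left) (auto simp: finite_mdeg)
  finally show ?thesis by simp
qed

lemma ev_mulX: "ev (Suc k) (mulX i c) y = y $ i * ev k c y"
proof -
  have "ev (Suc k) (mulX i c) y =
      (\<Sum>\<alpha>\<in>{\<alpha>. mdeg \<alpha> = k}. mulX i c (raise i \<alpha>) * mono_val (raise i \<alpha>) y)"
    unfolding ev_def by (rule sum_mdeg_Suc) (simp add: mulX_def)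
  then show ?thesis
    by (simp add: ev_def mono_val_raise sum_distrib_left mult_ac)
qed

lemma fischer_mulX: "fischer (Suc k) (mulX i c) d = fischer k c (pdiff i d)"
proof -
  have "fischer (Suc k) (mulX i c) d =
      (\<Sum>\<alpha>\<in>{\<alpha>. mdeg \<alpha> = k}. afact (raise i \<alpha>) * mulX i c (raise i \<alpha>) * d (raise i \<alpha>))"
    unfolding fischer_def by (rule sum_mdeg_Suc) (simp add: mulX_def)
  then show ?thesis
    by (simp add: fischer_def afact_raise pdiff_def mult_ac)
qed

lemma ev_sum: "ev k (\<lambda>\<alpha>. \<Sum>i\<in>I. c i * d i \<alpha>) y = (\<Sum>i\<in>I. c i * ev k (d i) y)"
  unfolding ev_def sum_distrib_right sum_distrib_left
  by (subst sum.swap) (simp add: mult_ac)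

lemma fischer_sum_left: "fischer k (\<lambda>\<alpha>. \<Sum>i\<in>I. c i * d i \<alpha>) e = (\<Sum>i\<in>I. c i * fischer k (d i) e)"
  unfolding fischer_def sum_distrib_right sum_distrib_left
  by (subst sum.swap) (simp add: mult_ac)

lemma fischer_commute: "fischer k c d = fischer k d c"
  by (simp add: fischer_def mult_ac)

lemma fischer_sum_right: "fischer k e (\<lambda>\<alpha>. \<Sum>i\<in>I. c i * d i \<alpha>) = (\<Sum>i\<in>I. c i * fischer k e (d i))"
  by (subst (1 2) fischer_commute) (rule fischer_sum_left)

lemma ev_sum1: "ev k (\<lambda>\<alpha>. \<Sum>i\<in>I. d i \<alpha>) y = (\<Sum>i\<in>I. ev k (d i) y)"
  using ev_sum[of k "\<lambda>_. 1" d I y] by simp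

lemma fischer_sum1_left: "fischer k (\<lambda>\<alpha>. \<Sum>i\<in>I. d i \<alpha>) e = (\<Sum>i\<in>I. fischer k (d i) e)"
  using fischer_sum_left[of k "\<lambda>_. 1" d I e] by simp

lemma fischer_sum1_right: "fischer k e (\<lambda>\<alpha>. \<Sum>i\<in>I. d i \<alpha>) = (\<Sum>i\<in>I. fischer k e (d i))"
  using fischer_sum_right[of k e "\<lambda>_. 1" d I] by simp

lemma ev_mul_lin: "ev (Suc k) (mul_lin x c) y = (x \<bullet> y) * ev k c y"
  unfolding mul_lin_def ev_sum by (simp add: ev_mulX inner_vec_def sum_distrib_left mult_ac)

lemma ev_mul_sq: "ev (Suc (Suc k)) (mul_sq c) y = (y \<bullet> y) * ev k c y"
  unfolding mul_sq_def ev_sum1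
  by (simp add: ev_mulX inner_vec_def sum_distrib_left mult_ac)

lemma fischer_mul_lin: "fischer (Suc k) (mul_lin x c) d = fischer k c (dir_diff x d)"
  unfolding mul_lin_def dir_diff_def fischer_sum_left fischer_sum_right by (simp add: fischer_mulX)

lemma fischer_mul_sq: "fischer (Suc (Suc k)) (mul_sq c) d = fischer k c (lap d)"
  unfolding mul_sq_def lap_def fischer_sum1_left fischer_sum1_right by (simp add: fischer_mulX)

lemma mulX_pdiff: "mulX i (pdiff i c) \<alpha> = real (\<alpha> i) * c \<alpha>"
  using raise_lower[of \<alpha> i] by (auto simp: mulX_def pdiff_def)

text \<open>Euler's identity: multiplying the i-th derivative by the i-th variable is diagonal in
  the coefficients with eigenvalue \<open>\<alpha> i\<close>, and these add up to the
  degree.\<close>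

lemma ev_dir_diff_self: "ev k (dir_diff y c) y = real (Suc k) * ev (Suc k) c y"
proof -
  have "ev k (dir_diff y c) y = (\<Sum>i\<in>UNIV. y $ i * ev k (pdiff i c) y)"
    unfolding dir_diff_def ev_sum ..
  also have "\<dots> = (\<Sum>i\<in>UNIV. ev (Suc k) (mulX i (pdiff i c)) y)"
    by (simp add: ev_mulX)
  also have "\<dots> = (\<Sum>\<alpha>\<in>{\<alpha>. mdeg \<alpha> = Suc k}. \<Sum>i\<in>UNIV. real (\<alpha> i) * (c \<alpha> * mono_val \<alpha> y))"
    unfolding ev_def mulX_pdiff by (subst sum.swap) (simp add: mult_ac)
  also have "\<dots> = (\<Sum>\<alpha>\<in>{\<alpha>. mdeg \<alpha> = Suc k}. real (Suc k) * (c \<alpha> * mono_val \<alpha> y))"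
    by (intro sum.cong refl) (simp add: mdeg_def flip: sum_distrib_right of_nat_sum)
  finally show ?thesis by (simp add: ev_def sum_distrib_left)
qed

lemma mdeg_0: "{\<alpha> :: 'n::finite \<Rightarrow> nat. mdeg \<alpha> = 0} = {\<lambda>_. 0}"
  by (auto simp: mdeg_def)

text \<open>The reproducing property. Moving one linear factor across the product gives a derivative
  along y, and Euler's identity contributes one factor of the factorial.\<close>

lemma fischer_lin_power: "fischer k ((mul_lin y ^^ k) one_coeffs) c = fact k * ev k c y"
proof (induction k arbitrary: c)
  case 0
  show ?case by (simp add: fischer_def ev_def mdeg_0 one_coeffs_def afact_def mono_val_def)
next
  case (Suc k)
  show ?case by (simp add: fischer_mul_lin Suc ev_dir_diff_self algebra_simps)
qed

text \<open>All weights are positive, so a vanishing square sum vanishes termwise.\<close>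

lemma fischer_self_eq_0:
  assumes "fischer k c c = 0" "mdeg \<alpha> = k" shows "c \<alpha> = 0"
proof -
  have pos: "afact \<beta> > 0" for \<beta> :: "'a \<Rightarrow> nat" by (auto simp: afact_def intro!: prod_pos)
  then have nn: "afact \<beta> * c \<beta> * c \<beta> \<ge> 0" for \<beta>
    by (metis mult.assoc mult_nonneg_nonneg zero_le_square less_imp_le)
  have "afact \<alpha> * c \<alpha> * c \<alpha> = 0"
    using assms nn unfolding fischer_def by (subst (asm) sum_nonneg_eq_0_iff) (auto simp: finite_mdeg)
  then show ?thesis using pos[of \<alpha>] by simp
qed

section \<open>Commutators of derivatives with multiplications\<close>

lemma pdiff_mulX:
  "pdiff i (mulX j c) \<alpha> = mulX j (pdiff i c) \<alpha> + (if i = j then c \<alpha> else 0)"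
proof (cases "i = j")
  case True
  then show ?thesis by (simp add: mulX_pdiff) (simp add: pdiff_def algebra_simps)
next
  case False
  then show ?thesis by (auto simp: pdiff_def mulX_def raise_def fun_upd_twist)
qed

lemma pdiff_add: "pdiff i (\<lambda>\<alpha>. c \<alpha> + d \<alpha>) = (\<lambda>\<alpha>. pdiff i c \<alpha> + pdiff i d \<alpha>)"
  by (auto simp: pdiff_def algebra_simps)
lemma pdiff_scale: "pdiff i (\<lambda>\<alpha>. r * c \<alpha>) = (\<lambda>\<alpha>. r * pdiff i c \<alpha>)"
  by (auto simp: pdiff_def algebra_simps)
lemma pdiff_sum: "pdiff i (\<lambda>\<alpha>. \<Sum>j\<in>I. d j \<alpha>) = (\<lambda>\<alpha>. \<Sum>j\<in>I. pdiff i (d j) \<alpha>)"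
  by (auto simp: pdiff_def sum_distrib_left)
lemma mulX_sum: "mulX i (\<lambda>\<alpha>. \<Sum>j\<in>I. d j \<alpha>) = (\<lambda>\<alpha>. \<Sum>j\<in>I. mulX i (d j) \<alpha>)"
  by (auto simp: mulX_def)
lemma mulX_add: "mulX i (\<lambda>\<alpha>. c \<alpha> + d \<alpha>) = (\<lambda>\<alpha>. mulX i c \<alpha> + mulX i d \<alpha>)"
  by (auto simp: mulX_def)
lemma mulX_scale: "mulX i (\<lambda>\<alpha>. r * c \<alpha>) = (\<lambda>\<alpha>. r * mulX i c \<alpha>)"
  by (auto simp: mulX_def)
lemma mulX_commute: "mulX i (mulX j c) = mulX j (mulX i c)"
  by (auto simp: mulX_def fun_upd_twist)

lemma dir_diff_mulX: "dir_diff x (mulX j c) \<alpha> = mulX j (dir_diff x c) \<alpha> + x $ j * c \<alpha>"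
  by (simp add: dir_diff_def pdiff_mulX mulX_sum mulX_scale algebra_simps sum.distrib
      if_distrib[of "\<lambda>t. t * _"] if_distrib[of "\<lambda>t. _ * t"] cong: if_cong)

lemma lap_mulX: "lap (mulX j c) \<alpha> = mulX j (lap c) \<alpha> + 2 * pdiff j c \<alpha>"
proof -
  have "pdiff i (mulX j c) = (\<lambda>\<alpha>. mulX j (pdiff i c) \<alpha> + (if i = j then 1 else 0) * c \<alpha>)" for i
    by (auto simp: pdiff_mulX)
  then have "pdiff i (pdiff i (mulX j c)) \<alpha> =
      mulX j (pdiff i (pdiff i c)) \<alpha> + (if i = j then 2 * pdiff i c \<alpha> else 0)" for i
    by (simp add: pdiff_add pdiff_scale pdiff_mulX)
  then show ?thesis by (simp add: lap_def mulX_sum sum.distrib)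
qed

lemma dir_diff_mul_lin:
  "dir_diff x (mul_lin x c) = (\<lambda>\<alpha>. mul_lin x (dir_diff x c) \<alpha> + (x \<bullet> x) * c \<alpha>)"
proof
  fix \<alpha>
  have "dir_diff x (mul_lin x c) \<alpha> = (\<Sum>j\<in>UNIV. x $ j * dir_diff x (mulX j c) \<alpha>)"
    unfolding dir_diff_def mul_lin_def pdiff_sum pdiff_scale sum_distrib_left
    by (subst sum.swap) (simp add: mult_ac)
  then show "dir_diff x (mul_lin x c) \<alpha> = mul_lin x (dir_diff x c) \<alpha> + (x \<bullet> x) * c \<alpha>"
    by (simp add: dir_diff_mulX mul_lin_def inner_vec_def sum_distrib_left sum.distrib algebra_simps)
qed

lemma lap_mul_lin: "lap (mul_lin x c) = (\<lambda>\<alpha>. mul_lin x (lap c) \<alpha> + 2 * dir_diff x c \<alpha>)"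
proof
  fix \<alpha>
  have "lap (mul_lin x c) \<alpha> = (\<Sum>j\<in>UNIV. x $ j * lap (mulX j c) \<alpha>)"
    unfolding lap_def mul_lin_def pdiff_sum pdiff_scale sum_distrib_left by (subst sum.swap) simp
  then show "lap (mul_lin x c) \<alpha> = mul_lin x (lap c) \<alpha> + 2 * dir_diff x c \<alpha>"
    by (simp add: lap_mulX mul_lin_def dir_diff_def sum.distrib sum_distrib_left algebra_simps)
qed

lemma dir_diff_mul_sq: "dir_diff x (mul_sq c) = (\<lambda>\<alpha>. mul_sq (dir_diff x c) \<alpha> + 2 * mul_lin x c \<alpha>)"
proof
  fix \<alpha>
  have "dir_diff x (mul_sq c) \<alpha> = (\<Sum>j\<in>UNIV. dir_diff x (mulX j (mulX j c)) \<alpha>)"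
    unfolding dir_diff_def mul_sq_def pdiff_sum sum_distrib_left by (subst sum.swap) simp
  moreover have "dir_diff x (mulX j (mulX j c)) \<alpha> =
      mulX j (mulX j (dir_diff x c)) \<alpha> + 2 * (x $ j * mulX j c \<alpha>)" for j
  proof -
    have e: "dir_diff x (mulX j c) = (\<lambda>\<alpha>. mulX j (dir_diff x c) \<alpha> + x $ j * c \<alpha>)"
      by (auto simp: dir_diff_mulX)
    show ?thesis by (simp add: dir_diff_mulX e mulX_add mulX_scale)
  qed
  ultimately show "dir_diff x (mul_sq c) \<alpha> = mul_sq (dir_diff x c) \<alpha> + 2 * mul_lin x c \<alpha>"
    by (simp add: mul_sq_def mul_lin_def sum.distrib sum_distrib_left)
qed

text \<open>The Euler operator enters coefficientwise through \<open>mdeg \<alpha>\<close>, so no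
  homogeneity has to be assumed here.\<close>

lemma lap_mul_sq:
  fixes c :: "'n::finite coeffs"
  shows "lap (mul_sq c) =
    (\<lambda>\<alpha>. mul_sq (lap c) \<alpha> + (4 * real (mdeg \<alpha>) + 2 * real CARD('n)) * c \<alpha>)"
proof
  fix \<alpha>
  have "lap (mul_sq c) \<alpha> = (\<Sum>j\<in>UNIV. lap (mulX j (mulX j c)) \<alpha>)"
    unfolding lap_def mul_sq_def pdiff_sum by (subst sum.swap) simp
  moreover have "lap (mulX j (mulX j c)) \<alpha> =
      mulX j (mulX j (lap c)) \<alpha> + (4 * (real (\<alpha> j) * c \<alpha>) + 2 * c \<alpha>)" for j
  proof -
    have e: "lap (mulX j c) = (\<lambda>\<alpha>. mulX j (lap c) \<alpha> + 2 * pdiff j c \<alpha>)"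
      by (auto simp: lap_mulX)
    show ?thesis by (simp add: lap_mulX e mulX_add mulX_scale mulX_pdiff pdiff_mulX)
  qed
  ultimately show "lap (mul_sq c) \<alpha> =
      mul_sq (lap c) \<alpha> + (4 * real (mdeg \<alpha>) + 2 * real CARD('n)) * c \<alpha>"
    by (simp add: mul_sq_def mdeg_def sum.distrib sum_distrib_left sum_distrib_right algebra_simps)
qed

lemma mul_lin_sq_commute: "mul_lin x (mul_sq c) = mul_sq (mul_lin x c)"
proof
  fix \<alpha>
  have "mul_lin x (mul_sq c) \<alpha> = (\<Sum>i\<in>UNIV. \<Sum>j\<in>UNIV. x $ i * mulX i (mulX j (mulX j c)) \<alpha>)"
    by (simp add: mul_lin_def mul_sq_def mulX_sum sum_distrib_left)
  also have "\<dots> = (\<Sum>i\<in>UNIV. \<Sum>j\<in>UNIV. x $ i * mulX j (mulX j (mulX i c)) \<alpha>)"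
    by (simp add: mulX_commute)
  also have "\<dots> = mul_sq (mul_lin x c) \<alpha>"
    unfolding mul_lin_def mul_sq_def mulX_sum mulX_scale by (rule sum.swap)
  finally show "mul_lin x (mul_sq c) \<alpha> = mul_sq (mul_lin x c) \<alpha>" .
qed

section \<open>Zonal harmonics\<close>

definition lin_sq_power :: "real^'n \<Rightarrow> nat \<Rightarrow> nat \<Rightarrow> 'n::finite coeffs" where
  "lin_sq_power x m i = (mul_lin x ^^ m) ((mul_sq ^^ i) one_coeffs)"

lemma mul_lin_add: "mul_lin x (\<lambda>\<alpha>. c \<alpha> + d \<alpha>) = (\<lambda>\<alpha>. mul_lin x c \<alpha> + mul_lin x d \<alpha>)"
  by (simp add: mul_lin_def mulX_add algebra_simps sum.distrib)
lemma mul_lin_scale: "mul_lin x (\<lambda>\<alpha>. r * c \<alpha>) = (\<lambda>\<alpha>. r * mul_lin x c \<alpha>)"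
  by (simp add: mul_lin_def mulX_scale algebra_simps sum_distrib_left)
lemma mul_sq_scale: "mul_sq (\<lambda>\<alpha>. r * c \<alpha>) = (\<lambda>\<alpha>. r * mul_sq c \<alpha>)"
  by (simp add: mul_sq_def mulX_scale sum_distrib_left)

lemma lap_sum: "lap (\<lambda>\<alpha>. \<Sum>j\<in>I. d j \<alpha>) = (\<lambda>\<alpha>. \<Sum>j\<in>I. lap (d j) \<alpha>)"
  unfolding lap_def pdiff_sum by (subst sum.swap) (rule refl)
lemma lap_scale: "lap (\<lambda>\<alpha>. r * c \<alpha>) = (\<lambda>\<alpha>. r * lap c \<alpha>)"
  by (simp add: lap_def pdiff_scale sum_distrib_left)

lemma lin_sq_power_Suc: "lin_sq_power x (Suc m) i = mul_lin x (lin_sq_power x m i)"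
  by (simp add: lin_sq_power_def)

lemma lin_sq_power_Suc_right: "lin_sq_power x m (Suc i) = mul_sq (lin_sq_power x m i)"
  by (induction m) (simp_all add: lin_sq_power_def mul_lin_sq_commute)

lemma mulX_hom:
  fixes \<alpha> :: "'n::finite \<Rightarrow> nat"
  assumes "mulX j c \<alpha> \<noteq> 0" "\<And>\<beta>. c \<beta> \<noteq> 0 \<Longrightarrow> mdeg \<beta> = k"
  shows "mdeg \<alpha> = Suc k"
proof -
  have "\<alpha> j \<noteq> 0" "c (\<alpha>(j := \<alpha> j - 1)) \<noteq> 0" using assms(1) by (auto simp: mulX_def split: if_splits)
  then show ?thesis
    using assms(2) mdeg_raise[of j "\<alpha>(j := \<alpha> j - 1)"] raise_lower[of \<alpha> j] by metis
qed

text \<open>Supplies the number \<open>2 * i\<close> that replaces \<open>mdeg \<alpha>\<close> when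
  \<open>lap_mul_sq\<close> is applied to a power of the squared norm.\<close>

lemma lin_sq_power_hom: "lin_sq_power x m i \<alpha> \<noteq> 0 \<Longrightarrow> mdeg \<alpha> = m + 2 * i"
proof (induction m arbitrary: \<alpha>)
  case 0
  then show ?case
  proof (induction i arbitrary: \<alpha>)
    case 0
    then show ?case by (auto simp: lin_sq_power_def one_coeffs_def mdeg_def split: if_splits)
  next
    case (Suc i)
    from Suc.prems obtain j where "mulX j (mulX j (lin_sq_power x 0 i)) \<alpha> \<noteq> 0"
      unfolding lin_sq_power_Suc_right mul_sq_def by (metis (mono_tags, lifting) sum.neutral)
    then have "mdeg \<alpha> = Suc (Suc (0 + 2 * i))"
      by (rule mulX_hom) (rule mulX_hom, assumption, rule Suc.IH)
    then show ?case by simp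
  qed
next
  case (Suc m)
  from Suc.prems obtain j where "mulX j (lin_sq_power x m i) \<alpha> \<noteq> 0"
    unfolding lin_sq_power_Suc mul_lin_def by (metis (mono_tags, lifting) sum.neutral mult_zero_right)
  then have "mdeg \<alpha> = Suc (m + 2 * i)" by (rule mulX_hom) (rule Suc.IH)
  then show ?case by simp
qed

lemma one_raise: "one_coeffs (raise i \<alpha>) = 0"
  by (metis Zero_not_Suc fun_upd_same one_coeffs_def raise_def)

lemma dir_diff_one: "dir_diff x one_coeffs = (\<lambda>_. 0)"
  by (auto simp: dir_diff_def pdiff_def one_raise)

lemma lap_one: "lap one_coeffs = (\<lambda>_. 0)"
  by (auto simp: lap_def pdiff_def one_raise)

text \<open>In the next lemmas the terms with a predecessor \<open>m - 1\<close> or \<open>i - 1\<close> carry the factor \<open>m\<close>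
  or \<open>i\<close>, so that truncated subtraction is harmless.\<close>

lemma mul_sq_pred:
  "real i * mul_sq (lin_sq_power x m (i - 1)) \<alpha> = real i * lin_sq_power x m i \<alpha>"
  by (cases i) (simp_all add: lin_sq_power_Suc_right)

lemma mul_lin_pred:
  "real m * mul_lin x (lin_sq_power x (m - 1) i) \<alpha> = real m * lin_sq_power x m i \<alpha>"
  by (cases m) (simp_all add: lin_sq_power_Suc)

lemma mul_lin_pred2:
  "real m * (real m - 1) * mul_lin x (lin_sq_power x (m - 2) i) \<alpha> =
   real m * (real m - 1) * lin_sq_power x (m - 1) i \<alpha>"
proof (cases "m > 1")
  case True
  then have "m - 1 = Suc (m - 2)" by simp
  then show ?thesis by (simp add: lin_sq_power_Suc)
next
  case False
  then have "m = 0 \<or> m = 1" by auto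
  then show ?thesis by auto
qed

lemma dir_diff_lin_sq_power:
  "dir_diff x (lin_sq_power x m i) =
    (\<lambda>\<alpha>. real m * (x \<bullet> x) * lin_sq_power x (m - 1) i \<alpha> + 2 * real i * lin_sq_power x (Suc m) (i - 1) \<alpha>)"
proof (induction m)
  case 0
  show ?case
  proof (induction i)
    case 0
    show ?case by (simp add: lin_sq_power_def dir_diff_one)
  next
    case (Suc i)
    have "dir_diff x (lin_sq_power x 0 (Suc i)) =
        (\<lambda>\<alpha>. 2 * real i * mul_sq (lin_sq_power x (Suc 0) (i - 1)) \<alpha> + 2 * lin_sq_power x (Suc 0) i \<alpha>)"
      unfolding lin_sq_power_Suc_right dir_diff_mul_sq Suc by (simp add: mul_sq_scale lin_sq_power_Suc)
    then show ?case using mul_sq_pred[of i x "Suc 0"] by (auto simp: algebra_simps)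
  qed
next
  case (Suc m)
  have "dir_diff x (lin_sq_power x (Suc m) i) \<alpha> =
      (x \<bullet> x) * (real m * mul_lin x (lin_sq_power x (m - 1) i) \<alpha>) +
      2 * real i * lin_sq_power x (Suc (Suc m)) (i - 1) \<alpha> + (x \<bullet> x) * lin_sq_power x m i \<alpha>" for \<alpha>
    unfolding lin_sq_power_Suc[of x m] dir_diff_mul_lin Suc
    by (simp add: mul_lin_add mul_lin_scale lin_sq_power_Suc)
  then show ?case unfolding mul_lin_pred by (auto simp: algebra_simps)
qed

text \<open>The Laplacian keeps the family \<open>lin_sq_power x m i\<close> invariant up to two
  neighbouring terms; hence a harmonic combination can be found by a two-term recursion.\<close>

lemma lap_lin_sq_power:
  fixes x :: "real^'n"
  shows "lap (lin_sq_power x m i) =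
    (\<lambda>\<alpha>. real m * (real m - 1) * (x \<bullet> x) * lin_sq_power x (m - 2) i \<alpha> +
         2 * real i * (2 * real i - 2 + real CARD('n) + 2 * real m) * lin_sq_power x m (i - 1) \<alpha>)"
proof (induction m)
  case 0
  show ?case
  proof (induction i)
    case 0
    show ?case by (simp add: lin_sq_power_def lap_one)
  next
    case (Suc i)
    have "real (mdeg \<alpha>) * lin_sq_power x 0 i \<alpha> = 2 * real i * lin_sq_power x 0 i \<alpha>" for \<alpha>
      using lin_sq_power_hom[of x 0 i \<alpha>] by (cases "lin_sq_power x 0 i \<alpha> = 0") auto
    then have e: "(4 * real (mdeg \<alpha>) + 2 * real CARD('n)) * lin_sq_power x 0 i \<alpha> =
        (8 * real i + 2 * real CARD('n)) * lin_sq_power x 0 i \<alpha>" for \<alpha>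
      by (simp add: algebra_simps)
    have "lap (lin_sq_power x 0 (Suc i)) \<alpha> =
        2 * (2 * real i - 2 + real CARD('n)) * (real i * mul_sq (lin_sq_power x 0 (i - 1)) \<alpha>) +
        (8 * real i + 2 * real CARD('n)) * lin_sq_power x 0 i \<alpha>" for \<alpha>
      unfolding lin_sq_power_Suc_right lap_mul_sq Suc e by (simp add: mul_sq_scale)
    then show ?case unfolding mul_sq_pred by (auto simp: algebra_simps)
  qed
next
  case (Suc m)
  have "lap (lin_sq_power x (Suc m) i) \<alpha> =
      (x \<bullet> x) * (real m * (real m - 1) * mul_lin x (lin_sq_power x (m - 2) i) \<alpha>) +
      2 * real i * (2 * real i - 2 + real CARD('n) + 2 * real m) * lin_sq_power x (Suc m) (i - 1) \<alpha> +
      2 * (real m * (x \<bullet> x) * lin_sq_power x (m - 1) i \<alpha> +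
        2 * real i * lin_sq_power x (Suc m) (i - 1) \<alpha>)" for \<alpha>
    unfolding lin_sq_power_Suc[of x m] lap_mul_lin Suc dir_diff_lin_sq_power
    by (simp add: mul_lin_add mul_lin_scale)
  then show ?case unfolding mul_lin_pred2 by (auto simp: algebra_simps)
qed

text \<open>Coefficients of the Gegenbauer polynomial of degree k and parameter n/2 - 1, scaled to
  leading coefficient 1. The recursion expresses that neighbouring terms cancel under the
  Laplacian.\<close>

fun zonal_coeff :: "real \<Rightarrow> nat \<Rightarrow> nat \<Rightarrow> real" where
  "zonal_coeff n k 0 = 1"
| "zonal_coeff n k (Suc i) = - zonal_coeff n k i * (real k - 2 * real i) * (real k - 2 * real i - 1)
     / (2 * (real i + 1) * (n + 2 * real k - 2 * real i - 4))"

text \<open>The harmonic projection of the \<open>2 * j\<close>-th power of the linear form \<open>inner x\<close>.\<close>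
definition zonal :: "nat \<Rightarrow> real^'n \<Rightarrow> 'n::finite coeffs" where
  "zonal j x = (\<lambda>\<alpha>. \<Sum>i\<le>j. zonal_coeff CARD('n) (2 * j) i * (x \<bullet> x) ^ i * lin_sq_power x (2 * j - 2 * i) i \<alpha>)"

lemma lap_zonal: "lap (zonal j x) = (\<lambda>_. 0)" for x :: "real^'n"
proof
  fix \<alpha> :: "'n \<Rightarrow> nat"
  define a where "a = zonal_coeff CARD('n) (2 * j)"
  define u where "u i = a i * (real (2*j) - 2 * real i) * (real (2*j) - 2 * real i - 1) * (x \<bullet> x) ^ Suc i *
      lin_sq_power x (2 * j - 2 * i - 2) i \<alpha>" for i
  define v where "v i = a i * (x \<bullet> x) ^ i * (2 * real i * (real CARD('n) + 4 * real j - 2 * real i - 2)) *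
      lin_sq_power x (2 * j - 2 * i) (i - 1) \<alpha>" for i
  have "lap (zonal j x) \<alpha> = (\<Sum>i\<le>j. u i + v i)"
    unfolding zonal_def lap_sum lap_scale lap_lin_sq_power a_def[symmetric]
    by (intro sum.cong refl) (simp add: u_def v_def of_nat_diff algebra_simps)
  also have "\<dots> = (\<Sum>i\<le>j. u i) + (\<Sum>i\<le>j. v i)" by (rule sum.distrib)
  \<comment> \<open>The boundary terms vanish: for i = j no linear factor is left to differentiate,
    and for i = 0 there is no squared norm. What remains is paired as \<open>u i\<close> with
    \<open>v (Suc i)\<close>.\<close>
  also have "(\<Sum>i\<le>j. u i) = (\<Sum>i<j. u i)"
    by (simp add: lessThan_Suc_atMost[symmetric] u_def)
  also have "(\<Sum>i\<le>j. v i) = (\<Sum>i<j. v (Suc i))"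
    unfolding sum.atMost_shift by (simp add: v_def)
  also have "(\<Sum>i<j. u i) + (\<Sum>i<j. v (Suc i)) = (\<Sum>i<j. u i + v (Suc i))"
    by (rule sum.distrib[symmetric])
  also have "\<dots> = 0"
  proof (intro sum.neutral ballI)
    fix i assume "i \<in> {..<j}"
    \<comment> \<open>For i < j the critical factor n + 4j - 2i - 4 of the denominator is at least
      n, so the recursion never divides by 0.\<close>
    then have "real (Suc i) \<le> real j" by (intro of_nat_mono) simp
    moreover have "real CARD('n) > 0" "real i \<ge> 0" by simp_all
    ultimately have "real CARD('n) + 2 * real (2 * j) - 2 * real i - 4 > 0"
      unfolding of_nat_mult of_nat_Suc of_nat_numeral by linarith
    then have d: "2 * (real i + 1) * (real CARD('n) + 2 * real (2 * j) - 2 * real i - 4) \<noteq> 0"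
      by (simp add: add_pos_nonneg less_imp_neq[symmetric])
    have e: "a (Suc i) * (2 * (real i + 1) * (real CARD('n) + 2 * real (2 * j) - 2 * real i - 4)) =
        - a i * (real (2*j) - 2 * real i) * (real (2*j) - 2 * real i - 1)"
      unfolding a_def zonal_coeff.simps(2) by (rule nonzero_eq_divide_eq[OF d, THEN iffD1]) (rule refl)
    have "v (Suc i) = a (Suc i) * (2 * (real i + 1) * (real CARD('n) + 2 * real (2 * j) - 2 * real i - 4)) *
        ((x \<bullet> x) ^ Suc i * lin_sq_power x (2 * j - 2 * Suc i) i \<alpha>)"
      unfolding v_def by (simp add: algebra_simps)
    also note e
    finally show "u i + v (Suc i) = 0" by (simp add: u_def)
  qed
  finally show "lap (zonal j x) \<alpha> = 0" .
qed

lemma ev_lin_sq_power: "ev (m + 2 * i) (lin_sq_power x m i) y = (x \<bullet> y) ^ m * (y \<bullet> y) ^ i"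
proof (induction m)
  case 0
  show ?case
    by (induction i) (simp_all add: lin_sq_power_Suc_right ev_mul_sq,
        simp add: ev_def mdeg_0 lin_sq_power_def one_coeffs_def mono_val_def)
qed (simp add: lin_sq_power_Suc ev_mul_lin)

lemma ev_zonal:
  fixes x :: "real^'n"
  shows "ev (2 * j) (zonal j x) y = (\<Sum>i\<le>j. zonal_coeff CARD('n) (2 * j) i * (x \<bullet> x) ^ i * (y \<bullet> y) ^ i *
     (x \<bullet> y) ^ (2 * j - 2 * i))"
  unfolding zonal_def ev_sum
proof (intro sum.cong refl)
  fix i assume "i \<in> {..j}"
  then show "zonal_coeff CARD('n) (2 * j) i * (x \<bullet> x) ^ i * ev (2 * j) (lin_sq_power x (2 * j - 2 * i) i) y =
     zonal_coeff CARD('n) (2 * j) i * (x \<bullet> x) ^ i * (y \<bullet> y) ^ i * (x \<bullet> y) ^ (2 * j - 2 * i)"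
    using ev_lin_sq_power[of "2 * j - 2 * i" i x y] by simp
qed

text \<open>Every term of \<open>zonal\<close> with a squared norm in it is orthogonal to harmonic
  polynomials, because multiplication by the squared norm is adjoint to \<open>lap\<close>. Only the
  pure power of the linear form survives, and it reproduces.\<close>

lemma fischer_zonal:
  assumes "\<And>\<beta>. mdeg \<beta> + 2 = 2 * j \<Longrightarrow> lap c \<beta> = 0"
  shows "fischer (2 * j) (zonal j x) c = fact (2 * j) * ev (2 * j) c x"
proof -
  have z: "fischer (2 * j) (lin_sq_power x (2 * j - 2 * i) i) c = 0" if "i \<in> {..j} - {0}" for i
  proof -
    from that obtain i' where i': "i = Suc i'" "j > 0" by (cases i) auto
    then have "fischer (2 * j) (lin_sq_power x (2 * j - 2 * i) i) c =
        fischer (2 * j - 2) (lin_sq_power x (2 * j - 2 * i) i') (lap c)"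
      using fischer_mul_sq[of "2 * (j - 1)" "lin_sq_power x (2 * j - 2 * i) i'" c]
      by (cases j) (simp_all add: lin_sq_power_Suc_right)
    also have "\<dots> = 0"
      using assms i' by (auto simp: fischer_def intro!: sum.neutral)
    finally show ?thesis .
  qed
  have "fischer (2 * j) (zonal j x) c = (\<Sum>i\<le>j. zonal_coeff CARD('a) (2 * j) i * (x \<bullet> x) ^ i *
      fischer (2 * j) (lin_sq_power x (2 * j - 2 * i) i) c)"
    unfolding zonal_def fischer_sum_left ..
  also have "\<dots> = fischer (2 * j) (lin_sq_power x (2 * j) 0) c"
    using z by (subst sum.remove[of _ 0]) auto
  finally show ?thesis
    by (simp add: lin_sq_power_def fischer_lin_power)
qed

lemma Harm_iff:
  "f \<in> Harm k \<longleftrightarrow> (\<exists>c. f = ev k c \<and> (\<forall>\<beta>. mdeg \<beta> + 2 = k \<longrightarrow> lap c \<beta> = 0))"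
proof -
  have "lap c \<beta> = (\<Sum>i\<in>UNIV. real ((\<beta> i + 2) * (\<beta> i + 1)) * c (\<beta>(i := \<beta> i + 2)))"
    for c :: "'a coeffs" and \<beta>
    unfolding lap_def pdiff_def raise_def by (intro sum.cong refl) (simp add: algebra_simps)
  then show ?thesis
    by (auto simp: Harm_def ev_def fun_eq_iff)
qed

text \<open>Up to a factorial, \<open>F\<close> represents the functional summing over R on harmonic
  polynomials. Since \<open>F\<close> is harmonic itself, the functional vanishes iff the Fischer
  square of \<open>F\<close> does, and that square is a positive multiple of the double sum.\<close>

theorem cond_C_iff_zonal_sum:
  fixes R :: "(real^'n) set"
  assumes "finite R"
  shows "cond_C R (2 * j) \<longleftrightarrow> (\<Sum>x\<in>R. \<Sum>y\<in>R. ev (2 * j) (zonal j x) y) = 0"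
proof -
  define F where "F = (\<lambda>\<alpha>. \<Sum>x\<in>R. zonal j x \<alpha>)"
  have lapF: "lap F = (\<lambda>_. 0)" unfolding F_def lap_sum lap_zonal by simp
  have evF: "ev (2 * j) F y = (\<Sum>x\<in>R. ev (2 * j) (zonal j x) y)" for y
    unfolding F_def ev_sum1 ..
  have fisF: "fischer (2 * j) F c = fact (2 * j) * (\<Sum>x\<in>R. ev (2 * j) c x)"
    if "\<And>\<beta>. mdeg \<beta> + 2 = 2 * j \<Longrightarrow> lap c \<beta> = 0" for c
    unfolding F_def fischer_sum1_left using fischer_zonal[OF that] by (simp add: sum_distrib_left)
  have swap: "(\<Sum>x\<in>R. \<Sum>y\<in>R. ev (2 * j) (zonal j x) y) = (\<Sum>y\<in>R. ev (2 * j) F y)"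
    unfolding evF by (rule sum.swap)
  show ?thesis
  proof
    assume "cond_C R (2 * j)"
    moreover have "ev (2 * j) F \<in> Harm (2 * j)" using lapF by (auto simp: Harm_iff)
    ultimately show "(\<Sum>x\<in>R. \<Sum>y\<in>R. ev (2 * j) (zonal j x) y) = 0"
      unfolding swap cond_C_def by blast
  next
    assume "(\<Sum>x\<in>R. \<Sum>y\<in>R. ev (2 * j) (zonal j x) y) = 0"
    then have "fischer (2 * j) F F = 0" using fisF[of F] lapF by (simp add: swap)
    then have F0: "F \<alpha> = 0" if "mdeg \<alpha> = 2 * j" for \<alpha> using fischer_self_eq_0 that by blast
    show "cond_C R (2 * j)"
      unfolding cond_C_def
    proof
      fix f :: "real^'n \<Rightarrow> real" assume "f \<in> Harm (2 * j)"
      then obtain c where c: "f = ev (2 * j) c" "\<And>\<beta>. mdeg \<beta> + 2 = 2 * j \<Longrightarrow> lap c \<beta> = 0"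
        by (auto simp: Harm_iff)
      have "fischer (2 * j) F c = 0" using F0 by (simp add: fischer_def)
      with fisF[OF c(2)] show "(\<Sum>x\<in>R. f x) = 0" by (simp add: c(1))
    qed
  qed
qed

section \<open>Simply laced root systems and eutaxy\<close>

definition simply_laced :: "'a::euclidean_space set \<Rightarrow> bool" where
  "simply_laced R \<longleftrightarrow> finite R \<and> (\<forall>x\<in>R. x \<bullet> x = 2) \<and> (\<forall>x\<in>R. \<forall>y\<in>R. x \<bullet> y \<in> \<int>) \<and>
     (\<forall>x\<in>R. \<forall>y\<in>R. x - (x \<bullet> y) *\<^sub>R y \<in> R)"

text \<open>Connectedness of the non-orthogonality graph, phrased by cuts, which is the form in
  which it is used.\<close>

definition irreducible_roots :: "'a::euclidean_space set \<Rightarrow> bool" where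
  "irreducible_roots R \<longleftrightarrow> (\<forall>A. A \<subseteq> R \<longrightarrow> A \<noteq> {} \<longrightarrow> A \<noteq> R \<longrightarrow> (\<exists>x\<in>A. \<exists>y\<in>R - A. x \<bullet> y \<noteq> 0))"

lemma simply_laced_if_root_system: "root_system R \<Longrightarrow> norm_two R \<Longrightarrow> simply_laced R"
  by (simp add: simply_laced_def root_system_def norm_two_def refl_root_def)

section \<open>The Casimir operator of a root system\<close>

definition casimir :: "'a::euclidean_space set \<Rightarrow> 'a \<Rightarrow> 'a" where
  "casimir R v = (\<Sum>x\<in>R. (x \<bullet> v) *\<^sub>R x)"

context
  fixes R :: "'a::euclidean_space set"
  assumes R: "simply_laced R"
begin

lemma simply_laced_finite: "finite R" using R by (simp add: simply_laced_def)

lemma simply_laced_norm: "x \<in> R \<Longrightarrow> x \<bullet> x = 2" using R by (simp add: simply_laced_def)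

lemma simply_laced_reflect: "x \<in> R \<Longrightarrow> y \<in> R \<Longrightarrow> x - (x \<bullet> y) *\<^sub>R y \<in> R"
  using R by (simp add: simply_laced_def)

lemma simply_laced_neg: "x \<in> R \<Longrightarrow> - x \<in> R"
  using simply_laced_reflect[of x x] by (simp add: simply_laced_norm scaleR_2)

lemma simply_laced_inner_2: "x \<in> R \<Longrightarrow> y \<in> R \<Longrightarrow> x \<bullet> y = 2 \<longleftrightarrow> x = y"
proof -
  assume "x \<in> R" "y \<in> R"
  then have "(x - y) \<bullet> (x - y) = 4 - 2 * (x \<bullet> y)"
    by (simp add: inner_diff simply_laced_norm inner_commute)
  then show ?thesis using \<open>x \<in> R\<close> simply_laced_norm by fastforce
qed

lemma simply_laced_inner_minus_2: "x \<in> R \<Longrightarrow> y \<in> R \<Longrightarrow> x \<bullet> y = -2 \<longleftrightarrow> x = - y"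
  using simply_laced_inner_2[of "x" "- y"] simply_laced_neg[of y] by (auto simp: inner_minus_right)

lemma simply_laced_inner_cases:
  assumes "x \<in> R" "y \<in> R" shows "x \<bullet> y \<in> {-2, -1, 0, 1, 2}"
proof -
  have "x \<bullet> y \<in> \<int>" using R assms by (simp add: simply_laced_def)
  then obtain k where k: "x \<bullet> y = of_int k" by (auto elim: Ints_cases)
  have "\<bar>x \<bullet> y\<bar> \<le> norm x * norm y" by (rule Cauchy_Schwarz_ineq2)
  also have "\<dots> = 2" using simply_laced_norm[OF assms(1)] simply_laced_norm[OF assms(2)]
    by (simp add: norm_eq_sqrt_inner)
  finally have "\<bar>k\<bar> \<le> 2" using k by linarith
  then have "k \<in> {-2, -1, 0, 1, 2}" by auto
  then show ?thesis by (auto simp: k)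
qed

lemma simply_laced_diff: "x \<in> R \<Longrightarrow> y \<in> R \<Longrightarrow> x \<bullet> y = 1 \<Longrightarrow> x - y \<in> R"
  using simply_laced_reflect[of x y] by simp

lemma simply_laced_add: "x \<in> R \<Longrightarrow> y \<in> R \<Longrightarrow> x \<bullet> y = -1 \<Longrightarrow> x + y \<in> R"
  using simply_laced_reflect[of x y] by simp

lemma sum_reflect:
  assumes "y \<in> R" shows "(\<Sum>x\<in>R. f (x - (x \<bullet> y) *\<^sub>R y)) = (\<Sum>x\<in>R. f x)"
proof -
  let ?s = "\<lambda>x. x - (x \<bullet> y) *\<^sub>R y"
  have inv: "?s (?s x) = x" for x
    by (simp add: inner_diff_left simply_laced_norm[OF assms] algebra_simps)
  show ?thesis
    by (rule sum.reindex_bij_witness[of R ?s ?s]) (auto simp: inv simply_laced_reflect assms)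
qed

text \<open>\<open>casimir R\<close> commutes with the reflection in y, since the reflection
  permutes R. Hence it preserves the line of y, the -1 eigenspace.\<close>

lemma casimir_root:
  assumes "y \<in> R" shows "casimir R y = (casimir R y \<bullet> y / 2) *\<^sub>R y"
proof -
  let ?s = "\<lambda>x. x - (x \<bullet> y) *\<^sub>R y"
  have "casimir R y = (\<Sum>x\<in>R. (?s x \<bullet> y) *\<^sub>R ?s x)"
    unfolding casimir_def by (rule sum_reflect[OF assms, symmetric])
  also have "\<dots> = (\<Sum>x\<in>R. ((x \<bullet> y) * (x \<bullet> y)) *\<^sub>R y - (x \<bullet> y) *\<^sub>R x)"
    by (intro sum.cong refl) (simp add: inner_diff_left simply_laced_norm[OF assms] algebra_simps)
  also have "\<dots> = (casimir R y \<bullet> y) *\<^sub>R y - casimir R y"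
    by (simp add: casimir_def sum_subtractf inner_sum_left scaleR_sum_left)
  finally have e: "2 *\<^sub>R casimir R y = (casimir R y \<bullet> y) *\<^sub>R y" by (simp only: eq_diff_eq scaleR_2)
  have "casimir R y = (1/2) *\<^sub>R (2 *\<^sub>R casimir R y)" by simp
  also have "\<dots> = (casimir R y \<bullet> y / 2) *\<^sub>R y" unfolding e by simp
  finally show ?thesis .
qed

text \<open>By self-adjointness, two non-orthogonal roots have equal eigenvalues; irreducibility
  spreads the value over R.\<close>

lemma casimir_irreducible:
  assumes "irreducible_roots R" "R \<noteq> {}"
  shows "\<exists>\<kappa>. \<forall>y\<in>R. casimir R y = \<kappa> *\<^sub>R y"
proof -
  define \<mu> where "\<mu> y = casimir R y \<bullet> y / 2" for y
  have cr: "casimir R y = \<mu> y *\<^sub>R y" if "y \<in> R" for y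
    unfolding \<mu>_def using that by (rule casimir_root)
  obtain y0 where y0: "y0 \<in> R" using assms by blast
  define A where "A = {y \<in> R. \<mu> y = \<mu> y0}"
  have "A = R"
  proof (rule ccontr)
    assume "A \<noteq> R"
    moreover have "A \<subseteq> R" "A \<noteq> {}" using y0 by (auto simp: A_def)
    ultimately obtain x y where xy: "x \<in> A" "y \<in> R - A" "x \<bullet> y \<noteq> 0"
      using assms(1) unfolding irreducible_roots_def by blast
    have "casimir R x \<bullet> y = casimir R y \<bullet> x"
      unfolding casimir_def inner_sum_left by (simp add: mult.commute)
    moreover have "casimir R x \<bullet> y = \<mu> x * (x \<bullet> y)" "casimir R y \<bullet> x = \<mu> y * (x \<bullet> y)"
      using xy by (auto simp: cr A_def inner_commute)
    ultimately show False using xy by (auto simp: A_def)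
  qed
  then have "casimir R y = \<mu> y0 *\<^sub>R y" if "y \<in> R" for y
    using cr[OF that] that by (auto simp: A_def)
  then show ?thesis by blast
qed

lemma casimir_span:
  assumes "\<And>y. y \<in> R \<Longrightarrow> casimir R y = \<kappa> *\<^sub>R y" and "v \<in> span R"
  shows "casimir R v = \<kappa> *\<^sub>R v"
  using assms(2)
proof (induction rule: span_induct)
  case base
  show ?case
    by (auto simp: subspace_def casimir_def inner_add_right scaleR_add_left sum.distrib
        scaleR_add_right scaleR_sum_right simp flip: scaleR_scaleR)
      (simp add: scaleR_left_commute flip: scaleR_scaleR scaleR_sum_right)
next
  case (step x)
  then show ?case by (rule assms(1))
qed

text \<open>The trace computed twice: once from the squared root lengths, once as the eigenvalue
  times the dimension of the span.\<close>

lemma casimir_trace: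
  assumes "\<And>y. y \<in> R \<Longrightarrow> casimir R y = \<kappa> *\<^sub>R y"
  shows "\<kappa> * real (dim R) = 2 * real (card R)"
proof -
  obtain B where B: "B \<subseteq> span R" "pairwise orthogonal B" "\<And>x. x \<in> B \<Longrightarrow> norm x = 1"
    "independent B" "card B = dim (span R)" "span B = span R"
    using orthonormal_basis_subspace[OF subspace_span[of R]] by blast
  have fB: "finite B" using B(4) by (rule independent_imp_finite)
  have "x \<bullet> x = (\<Sum>b\<in>B. (x \<bullet> b) * (x \<bullet> b))" if "x \<in> R" for x
  proof -
    have "x \<in> span B" using that B(6) by (simp add: span_base)
    then have "(\<Sum>b\<in>B. (x \<bullet> b) *\<^sub>R b) = x"
      using orthonormal_basis_expand[OF B(2) B(3)] fB by blast
    then have "x \<bullet> x = x \<bullet> (\<Sum>b\<in>B. (x \<bullet> b) *\<^sub>R b)" by simp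
    then show ?thesis by (simp add: inner_sum_right)
  qed
  then have "2 * real (card R) = (\<Sum>x\<in>R. \<Sum>b\<in>B. (x \<bullet> b) * (x \<bullet> b))"
    using simply_laced_norm by simp
  also have "\<dots> = (\<Sum>b\<in>B. casimir R b \<bullet> b)"
    by (subst sum.swap) (simp add: casimir_def inner_sum_left)
  also have "\<dots> = (\<Sum>b\<in>B. \<kappa>)"
    using B casimir_span[OF assms] by (intro sum.cong refl) (auto simp: norm_eq_1)
  finally show ?thesis using B(5) by (simp add: mult.commute)
qed

end

section \<open>Irreducible components\<close>

lemma nonorth_sym: "sym (nonorth R)"
  by (auto simp: nonorth_def sym_def inner_commute)

context
  fixes R :: "(real^'n) set" and C
  assumes R: "simply_laced R" and C: "C \<in> components R"
begin

lemma component_subset: "C \<subseteq> R" using C by (auto simp: components_def)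

lemma component_nonempty: "C \<noteq> {}" using C by (auto simp: components_def)

lemma component_closed: "u \<in> C \<Longrightarrow> v \<in> R \<Longrightarrow> u \<bullet> v \<noteq> 0 \<Longrightarrow> v \<in> C"
proof -
  assume a: "u \<in> C" "v \<in> R" "u \<bullet> v \<noteq> 0"
  then have "(u, v) \<in> nonorth R" using component_subset by (auto simp: nonorth_def)
  then show ?thesis using C a by (auto simp: components_def intro: rtrancl_into_rtrancl)
qed

lemma component_connected:
  assumes "u \<in> C" "v \<in> C" shows "(u, v) \<in> (nonorth R)\<^sup>*"
proof -
  obtain x where "(x, u) \<in> (nonorth R)\<^sup>*" "(x, v) \<in> (nonorth R)\<^sup>*"
    using C assms by (auto simp: components_def)
  then show ?thesis by (meson nonorth_sym sym_rtrancl symD rtrancl_trans)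
qed

lemma component_simply_laced: "simply_laced C"
proof -
  have "x - (x \<bullet> y) *\<^sub>R y \<in> C" if "x \<in> C" "y \<in> C" for x y
  proof (cases "x \<bullet> y = 0")
    case False
    have "y \<bullet> (x - (x \<bullet> y) *\<^sub>R y) = - (x \<bullet> y)"
      using simply_laced_norm[OF R, of y] that component_subset
      by (auto simp: inner_diff_right inner_commute)
    with False that show ?thesis
      using component_closed simply_laced_reflect[OF R, of x y] component_subset
      by (metis neg_equal_0_iff_equal subsetD)
  qed (simp add: that)
  then show ?thesis
    using R component_subset unfolding simply_laced_def by (meson finite_subset subsetD)
qed

lemma component_irreducible: "irreducible_roots C"
  unfolding irreducible_roots_def
proof (intro allI impI, rule ccontr)
  fix A assume A: "A \<subseteq> C" "A \<noteq> {}" "A \<noteq> C" "\<not> (\<exists>x\<in>A. \<exists>y\<in>C - A. x \<bullet> y \<noteq> 0)"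
  then obtain a c where ac: "a \<in> A" "c \<in> C - A" by blast
  then have "(a, c) \<in> (nonorth R)\<^sup>*" using A component_connected by blast
  then have "c \<in> A"
  proof (induction rule: rtrancl_induct)
    case (step y z)
    then have yz: "y \<in> A" "z \<in> R" "y \<bullet> z \<noteq> 0" by (auto simp: nonorth_def)
    then have "z \<in> C" using A(1) component_closed[of y z] by blast
    then show ?case using yz A(4) by blast
  qed (rule ac)
  then show False using ac by blast
qed

text \<open>Roots outside C are orthogonal to y and drop out of the sum; on C the trace formula
  identifies the eigenvalue.\<close>

lemma component_casimir:
  assumes "y \<in> C"
  shows "(\<Sum>x\<in>R. (x \<bullet> y) *\<^sub>R x) = (2 * coxeter_number C) *\<^sub>R y"
proof -
  obtain \<kappa> where l: "\<And>y. y \<in> C \<Longrightarrow> casimir C y = \<kappa> *\<^sub>R y"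
    using casimir_irreducible[OF component_simply_laced component_irreducible component_nonempty] by blast
  have "y \<noteq> 0" using simply_laced_norm[OF component_simply_laced assms] by auto
  then have "\<not> C \<subseteq> {0}" using assms by blast
  then have "dim C \<noteq> 0" by simp
  with casimir_trace[OF component_simply_laced l] have "\<kappa> = 2 * coxeter_number C"
    by (simp add: coxeter_number_def field_simps)
  moreover have "(\<Sum>x\<in>R. (x \<bullet> y) *\<^sub>R x) = casimir C y"
    unfolding casimir_def
    using component_subset component_closed assms simply_laced_finite[OF R]
    by (intro sum.mono_neutral_right) (force simp: inner_commute)+
  ultimately show ?thesis using l assms by simp
qed

end

lemma component_exists: "x \<in> R \<Longrightarrow> \<exists>C\<in>components R. x \<in> C"
  by (auto simp: components_def)

lemma components_disjoint:
  assumes "C \<in> components R" "D \<in> components R" "x \<in> C" "x \<in> D" shows "C = D"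
proof -
  have "y \<in> D" if CD: "C \<in> components R" "D \<in> components R" "x \<in> C" "x \<in> D" "y \<in> C" for C D y
  proof -
    obtain c where "C = {y \<in> R. (c, y) \<in> (nonorth R)\<^sup>*}"
      using CD(1) by (auto simp: components_def)
    moreover obtain d where "D = {y \<in> R. (d, y) \<in> (nonorth R)\<^sup>*}"
      using CD(2) by (auto simp: components_def)
    ultimately show ?thesis using CD(3-5)
      by (auto intro: rtrancl_trans dest: symD[OF sym_rtrancl[OF nonorth_sym]])
  qed
  with assms show ?thesis by blast
qed

section \<open>Moments of a strongly eutactic root system\<close>

locale eutactic =
  fixes R :: "(real^'n) set"
  assumes root_system: "root_system R" and nonempty: "R \<noteq> {}" and norm2: "norm_two R"
    and strongly_eutactic: "strongly_eutactic R" and spanning: "span R = UNIV"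
begin

definition h :: real where "h = real (card R) / real CARD('n)"

lemma simply_laced: "simply_laced R"
  using root_system norm2 by (rule simply_laced_if_root_system)

lemma card_R: "real (card R) = real CARD('n) * h"
  by (simp add: h_def)

text \<open>Equal Coxeter numbers make the eigenvalues on all components agree, so the operator is a
  scalar on the span of R. Its trace then shows that the common Coxeter number is |R| / n.\<close>

lemma casimir_R: "casimir R v = (2 * h) *\<^sub>R v"
  and coxeter_number_component: "C \<in> components R \<Longrightarrow> coxeter_number C = h"
proof -
  obtain x0 where "x0 \<in> R" using nonempty by blast
  then obtain C0 where C0: "C0 \<in> components R" using component_exists by blast
  have *: "casimir R y = (2 * coxeter_number C0) *\<^sub>R y" if y: "y \<in> R" for y
  proof -
    obtain C where C: "C \<in> components R" "y \<in> C" using component_exists[OF y] by blast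
    then have "coxeter_number C = coxeter_number C0"
      using C0 strongly_eutactic unfolding strongly_eutactic_def by blast
    then show ?thesis using component_casimir[OF simply_laced C]
      by (simp add: casimir_def)
  qed
  have "dim R = CARD('n)" using spanning by (metis dim_span dim_UNIV DIM_cart DIM_real mult_1_right)
  with casimir_trace[OF simply_laced *] have h: "h = coxeter_number C0"
    by (simp add: h_def field_simps)
  show "casimir R v = (2 * h) *\<^sub>R v"
    unfolding h by (rule casimir_span[OF simply_laced *]) (simp_all add: spanning)
  show "coxeter_number C = h" if "C \<in> components R"
    using that C0 strongly_eutactic unfolding strongly_eutactic_def h by blast
qed

lemma moment_2: "y \<in> R \<Longrightarrow> (\<Sum>x\<in>R. (x \<bullet> y)\<^sup>2) = 4 * h"
proof -
  assume "y \<in> R"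
  have "(\<Sum>x\<in>R. (x \<bullet> y)\<^sup>2) = casimir R y \<bullet> y"
    by (simp add: casimir_def inner_sum_left power2_eq_square)
  then show ?thesis
    using simply_laced_norm[OF simply_laced \<open>y \<in> R\<close>] by (simp add: casimir_R)
qed

text \<open>The excess over the second moment comes from y and -y only, each contributing
  \<open>4 ^ m - 4\<close>.\<close>

lemma moment_even:
  assumes y: "y \<in> R" and m: "m > 0"
  shows "(\<Sum>x\<in>R. (x \<bullet> y) ^ (2 * m)) = 2 * 4 ^ m + 4 * h - 8"
proof -
  have ny: "- y \<in> R" "- y \<noteq> y"
    using y simply_laced_neg[OF simply_laced] simply_laced_inner_2[OF simply_laced, of "- y" y]
      simply_laced_norm[OF simply_laced y] by auto
  have "(x \<bullet> y) ^ (2 * m) = (x \<bullet> y)\<^sup>2 + (if x = y then 4 ^ m - 4 else 0) + (if x = - y then 4 ^ m - 4 else 0)"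
    if "x \<in> R" for x
    using simply_laced_inner_cases[OF simply_laced that y] ny m
      simply_laced_inner_2[OF simply_laced that y] simply_laced_inner_minus_2[OF simply_laced that y]
    by (auto simp: power_mult)
  then have "(\<Sum>x\<in>R. (x \<bullet> y) ^ (2 * m)) =
      (\<Sum>x\<in>R. (x \<bullet> y)\<^sup>2 + (if x = y then 4 ^ m - 4 else 0) + (if x = - y then 4 ^ m - 4 else 0))"
    by (rule sum.cong[OF refl])
  also have "\<dots> = 4 * h + (4 ^ m - 4) + (4 ^ m - 4)"
    using moment_2[OF y] y ny simply_laced_finite[OF simply_laced] by (simp add: sum.distrib)
  finally show ?thesis by simp
qed

text \<open>The inner zonal sum is the same at every root, so the double sum is |R| times one of
  them. The index i = j is split off because there the exponent is 0: the zeroth moment is |R| and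
  \<open>moment_even\<close> does not apply.\<close>

lemma cond_C_iff_moments:
  "cond_C R (2 * j) \<longleftrightarrow> (\<Sum>i\<le>j. zonal_coeff CARD('n) (2 * j) i * 4 ^ i *
     (if i = j then CARD('n) * h else 2 * 4 ^ (j - i) + 4 * h - 8)) = 0" (is "_ \<longleftrightarrow> ?S = 0")
proof -
  have "(\<Sum>y\<in>R. ev (2 * j) (zonal j x) y) = ?S" if x: "x \<in> R" for x
  proof -
    have "(\<Sum>y\<in>R. ev (2 * j) (zonal j x) y) =
        (\<Sum>y\<in>R. \<Sum>i\<le>j. zonal_coeff CARD('n) (2 * j) i * 4 ^ i * (y \<bullet> x) ^ (2 * (j - i)))"
      unfolding ev_zonal using simply_laced_norm[OF simply_laced] x
      by (intro sum.cong refl)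
        (simp add: inner_commute diff_mult_distrib2 power_mult_distrib[symmetric])
    also have "\<dots> = (\<Sum>i\<le>j. zonal_coeff CARD('n) (2 * j) i * 4 ^ i * (\<Sum>y\<in>R. (y \<bullet> x) ^ (2 * (j - i))))"
      by (subst sum.swap) (simp add: sum_distrib_left)
    also have "\<dots> = ?S"
      using moment_even[OF x] card_R by (intro sum.cong refl) auto
    finally show ?thesis .
  qed
  then have "(\<Sum>x\<in>R. \<Sum>y\<in>R. ev (2 * j) (zonal j x) y) = real (card R) * ?S" by simp
  moreover have "card R \<noteq> 0" using nonempty simply_laced_finite[OF simply_laced] by simp
  ultimately show ?thesis
    unfolding cond_C_iff_zonal_sum[OF simply_laced_finite[OF simply_laced]] by simp
qed

end

section \<open>Root lattices and the attachment lemma\<close>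

definition lat :: "nat \<Rightarrow> (nat \<Rightarrow> 'a::real_vector) \<Rightarrow> 'a set" where
  "lat m b = {v. \<exists>c :: nat \<Rightarrow> int. v = (\<Sum>i<m. of_int (c i) *\<^sub>R b i)}"

lemma lat_base: "i < m \<Longrightarrow> b i \<in> lat m b"
  unfolding lat_def
  by (intro CollectI exI[of _ "\<lambda>j. if j = i then 1 else 0"])
    (simp add: if_distrib[of "\<lambda>t. of_int t *\<^sub>R _"] cong: if_cong)

lemma lat_add: "u \<in> lat m b \<Longrightarrow> v \<in> lat m b \<Longrightarrow> u + v \<in> lat m b"
proof -
  assume "u \<in> lat m b" "v \<in> lat m b"
  then obtain c d where "u = (\<Sum>i<m. of_int (c i) *\<^sub>R b i)" "v = (\<Sum>i<m. of_int (d i) *\<^sub>R b i)"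
    by (auto simp: lat_def)
  then show ?thesis unfolding lat_def
    by (intro CollectI exI[of _ "\<lambda>i. c i + d i"]) (simp add: scaleR_add_left sum.distrib)
qed

lemma lat_neg: "u \<in> lat m b \<Longrightarrow> - u \<in> lat m b"
proof -
  assume "u \<in> lat m b"
  then obtain c where "u = (\<Sum>i<m. of_int (c i) *\<^sub>R b i)" by (auto simp: lat_def)
  then show ?thesis unfolding lat_def
    by (intro CollectI exI[of _ "\<lambda>i. - c i"]) (simp add: sum_negf)
qed

lemma lat_diff: "u \<in> lat m b \<Longrightarrow> v \<in> lat m b \<Longrightarrow> u - v \<in> lat m b"
  using lat_add[of u m b "- v"] lat_neg[of v m b] by simp

lemma zero_in_lat: "0 \<in> lat m b"
  unfolding lat_def by (intro CollectI exI[of _ "\<lambda>_. 0"]) simp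

lemma sum_list_replicate_scaleR: "sum_list (replicate n x) = real n *\<^sub>R x" for x :: "'a::real_vector"
  by (induction n) (simp_all add: scaleR_add_left)

text \<open>Absorbing signs into the roots and multiplicities into repetition gives a length to
  induct on.\<close>

lemma lat_imp_sum_list:
  assumes R: "simply_laced R" and b: "\<And>i. i < m \<Longrightarrow> b i \<in> R" and v: "v \<in> lat m b"
  shows "\<exists>xs. set xs \<subseteq> R \<and> v = sum_list xs"
proof -
  obtain c where "v = (\<Sum>i<m. of_int (c i) *\<^sub>R b i)" using v by (auto simp: lat_def)
  moreover have "\<exists>xs. set xs \<subseteq> R \<and> (\<Sum>i<m'. of_int (c i) *\<^sub>R b i) = sum_list xs" if "m' \<le> m" for m'
    using that
  proof (induction m')
    case 0
    then show ?case by (intro exI[of _ "[]"]) simp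
  next
    case (Suc m')
    then obtain xs where xs: "set xs \<subseteq> R" "(\<Sum>i<m'. of_int (c i) *\<^sub>R b i) = sum_list xs" by auto
    define x where "x = (if c m' \<ge> 0 then b m' else - b m')"
    have "x \<in> R" using b[of m'] Suc.prems simply_laced_neg[OF R] by (auto simp: x_def)
    moreover have "of_int (c m') *\<^sub>R b m' = sum_list (replicate (nat \<bar>c m'\<bar>) x)"
      by (simp add: sum_list_replicate_scaleR x_def)
    ultimately show ?case using xs
      by (intro exI[of _ "xs @ replicate (nat \<bar>c m'\<bar>) x"]) (auto simp: set_replicate_conv_if)
  qed
  ultimately show ?thesis by blast
qed

text \<open>Since v has positive norm, some summand x has \<open>v \<bullet> x > 0\<close>;
  integrality and \<open>v \<bullet> x \<le> 2\<close> leave 1 or 2. The value 2 means v = x. For 1,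
  v - x is a shorter sum of norm 2, hence a root, and adding x back is a reflection.\<close>

lemma norm_2_sum_list_in_roots:
  assumes R: "simply_laced R"
  shows "set xs \<subseteq> R \<Longrightarrow> sum_list xs \<bullet> sum_list xs = 2 \<Longrightarrow> sum_list xs \<in> R"
proof (induction "length xs" arbitrary: xs rule: less_induct)
  case less
  define v where "v = sum_list xs"
  have "\<exists>x\<in>set xs. v \<bullet> x > 0"
  proof (rule ccontr)
    assume a: "\<not> (\<exists>x\<in>set xs. v \<bullet> x > 0)"
    have "v \<bullet> sum_list ys \<le> 0" if "set ys \<subseteq> set xs" for ys
      using that
    proof (induction ys)
      case (Cons y ys)
      then have "v \<bullet> y \<le> 0" using a by (auto simp: not_less)
      with Cons show ?case by (simp add: inner_add_right)
    qed simp
    from this[of xs] show False using less.prems by (simp add: v_def)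
  qed
  then obtain x where x: "x \<in> set xs" "v \<bullet> x > 0" by blast
  then have xR: "x \<in> R" "x \<bullet> x = 2" using less.prems simply_laced_norm[OF R] by auto
  have "sum_list ys \<bullet> x \<in> \<int>" if "set ys \<subseteq> R" for ys
    using that by (induction ys) (use R xR in \<open>auto simp: inner_add_left simply_laced_def\<close>)
  then have "v \<bullet> x \<in> \<int>" using less.prems by (simp add: v_def)
  then obtain k where k: "v \<bullet> x = of_int k" by (auto elim: Ints_cases)
  have vv: "v \<bullet> v = 2" using less.prems by (simp add: v_def)
  have "(v - x) \<bullet> (v - x) \<ge> 0" by simp
  then have "v \<bullet> x \<le> 2" using vv xR by (simp add: inner_diff inner_commute)
  then have "k = 1 \<or> k = 2" using x(2) k by auto
  then show ?case
  proof
    assume "k = 2"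
    then have "(v - x) \<bullet> (v - x) = 0" using vv xR k by (simp add: inner_diff inner_commute)
    then show ?thesis using xR by (simp add: v_def)
  next
    assume "k = 1"
    have e: "sum_list (remove1 x xs) = v - x" using sum_list_map_remove1[OF x(1), of id] by (simp add: v_def)
    have "sum_list (remove1 x xs) \<in> R"
    proof (rule less.hyps)
      show "length (remove1 x xs) < length xs"
        using x(1) length_pos_if_in_set[OF x(1)] by (simp add: length_remove1)
      show "set (remove1 x xs) \<subseteq> R" using less.prems set_remove1_subset by fastforce
      show "sum_list (remove1 x xs) \<bullet> sum_list (remove1 x xs) = 2"
        unfolding e using vv xR k \<open>k = 1\<close> by (simp add: inner_diff inner_commute)
    qed
    then have "v - x \<in> R" by (simp add: e)
    moreover have "(v - x) \<bullet> x = -1" using xR k \<open>k = 1\<close> by (simp add: inner_diff)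
    ultimately have "v - x + x \<in> R" using xR simply_laced_add[OF R] by blast
    then show ?thesis by (simp add: v_def)
  qed
qed

lemma norm_2_lat_in_roots:
  assumes "simply_laced R" "\<And>i. i < m \<Longrightarrow> b i \<in> R" "v \<in> lat m b" "v \<bullet> v = 2"
  shows "v \<in> R"
  using lat_imp_sum_list[OF assms(1-3)] norm_2_sum_list_in_roots[OF assms(1)] assms(4) by blast

text \<open>Independence of the indexed family: unlike independence of the image set, it rules out
  repetitions.\<close>

definition indep_family :: "nat \<Rightarrow> (nat \<Rightarrow> 'a::real_vector) \<Rightarrow> bool" where
  "indep_family m b \<longleftrightarrow> (\<forall>c. (\<Sum>i<m. c i *\<^sub>R b i) = 0 \<longrightarrow> (\<forall>i<m. c i = 0))"

lemma indep_family_inj: "indep_family m b \<Longrightarrow> inj_on b {..<m}"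
proof (rule inj_onI, rule ccontr)
  fix i j assume a: "indep_family m b" "i \<in> {..<m}" "j \<in> {..<m}" "b i = b j" "i \<noteq> j"
  define c :: "nat \<Rightarrow> real" where "c k = (if k = i then 1 else 0) - (if k = j then 1 else 0)" for k
  have "(\<Sum>k<m. c k *\<^sub>R b k) = 0"
    using a(2-4) by (simp add: c_def scaleR_diff_left sum_subtractf if_distrib[of "\<lambda>t. t *\<^sub>R _"] cong: if_cong)
  then have "c i = 0" using a(1,2) by (simp add: indep_family_def)
  then show False using a(5) by (simp add: c_def)
qed

lemma indep_family_independent:
  assumes "indep_family m b" shows "independent (b ` {..<m})"
proof -
  have "(\<Sum>v\<in>b ` {..<m}. u v *\<^sub>R v) = (\<Sum>i<m. u (b i) *\<^sub>R b i)" for u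
    by (simp add: sum.reindex[OF indep_family_inj[OF assms]])
  then show ?thesis
    using assms by (auto simp: dependent_finite indep_family_def)
qed

lemma attach:
  fixes R :: "'a::euclidean_space set"
  assumes R: "simply_laced R" and irr: "irreducible_roots R" and m: "m > 0"
    and b: "\<And>i. i < m \<Longrightarrow> b i \<in> R" and ind: "indep_family m b"
    and w: "\<And>i. i < m \<Longrightarrow> w i \<ge> (1::nat)"
    and \<theta>: "(\<Sum>i<m. real (w i) *\<^sub>R b i) \<bullet> (\<Sum>i<m. real (w i) *\<^sub>R b i) = 2"
    and nR: "\<not> R \<subseteq> lat m b"
  shows "\<exists>z\<in>R. \<exists>p<m. w p = 1 \<and> (\<forall>i<m. z \<bullet> b i = (if i = p then -1 else 0))"
proof -
  \<comment> \<open>\<open>g\<close> plays the role of the height: subtracting any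
    \<open>b i\<close> lowers it by 1.\<close>
  obtain g :: "'a \<Rightarrow> real" where g: "linear g" "\<And>i. i < m \<Longrightarrow> g (b i) = 1"
    using linear_independent_extend[OF indep_family_independent[OF ind], of "\<lambda>_. 1"] by auto
  define A where "A = R \<inter> lat m b"
  have "b 0 \<in> A" using m b lat_base[OF m] by (auto simp: A_def)
  then have "A \<noteq> {}" "A \<noteq> R" "A \<subseteq> R" using nR by (auto simp: A_def)
  then obtain x y where xy: "x \<in> A" "y \<in> R - A" "x \<bullet> y \<noteq> 0"
    using irr unfolding irreducible_roots_def by blast
  then have y: "y \<in> R" "y \<notin> lat m b" by (auto simp: A_def)
  obtain c where c: "x = (\<Sum>i<m. of_int (c i) *\<^sub>R b i)" using xy(1) by (auto simp: A_def lat_def)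
  define Y where "Y = {z \<in> R. z - y \<in> lat m b}"
  have "finite Y" "y \<in> Y" using simply_laced_finite[OF R] y zero_in_lat by (auto simp: Y_def)
  then obtain z where z: "z \<in> Y" "\<And>z'. z' \<in> Y \<Longrightarrow> g z \<le> g z'"
    using arg_min_if_finite[of Y g] by (metis empty_iff not_less)
  then have zR: "z \<in> R" "z - y \<in> lat m b" by (auto simp: Y_def)
  have zl: "z \<notin> lat m b"
  proof
    assume "z \<in> lat m b"
    from lat_diff[OF this zR(2)] show False using y by simp
  qed
  \<comment> \<open>The value 1 would make \<open>z - b i\<close> a root of the same coset below the
    minimum; the values 2 and -2 would put z itself into the lattice.\<close>
  have zb: "z \<bullet> b i = 0 \<or> z \<bullet> b i = -1" if i: "i < m" for i
  proof -
    have "z \<bullet> b i \<noteq> 1"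
    proof
      assume "z \<bullet> b i = 1"
      then have "z - b i \<in> R" using simply_laced_diff[OF R zR(1) b[OF i]] by simp
      moreover have "z - b i - y \<in> lat m b"
        using lat_diff[OF zR(2) lat_base[OF i, of b]] by (simp add: algebra_simps)
      ultimately have "g z \<le> g (z - b i)" by (intro z(2)) (simp add: Y_def)
      then show False using g i by (simp add: linear_diff)
    qed
    moreover have "z \<bullet> b i \<noteq> 2" "z \<bullet> b i \<noteq> -2"
      using simply_laced_inner_2[OF R zR(1) b[OF i]] simply_laced_inner_minus_2[OF R zR(1) b[OF i]]
        zl lat_base[OF i, of b] lat_neg[OF lat_base[OF i, of b]] by auto
    ultimately show ?thesis using simply_laced_inner_cases[OF R zR(1) b[OF i]] by auto
  qed
  \<comment> \<open>Otherwise z is orthogonal to the lattice. As y = z - l with l in the lattice,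
    comparing norms gives l = 0, so y = z would be orthogonal to x, against the choice of x and
    y.\<close>
  have "\<exists>p<m. z \<bullet> b p \<noteq> 0"
  proof (rule ccontr)
    assume a: "\<not> (\<exists>p<m. z \<bullet> b p \<noteq> 0)"
    have orth: "z \<bullet> v = 0" if "v \<in> lat m b" for v
      using that a by (auto simp: lat_def inner_sum_right)
    define l where "l = z - y"
    have "y \<bullet> y = z \<bullet> z + l \<bullet> l"
      using orth[OF zR(2)] by (simp add: l_def inner_diff inner_commute)
    then have "l = 0" using simply_laced_norm[OF R zR(1)] simply_laced_norm[OF R y(1)] by simp
    then have "y \<bullet> x = 0" using orth[of x] xy(1) by (simp add: l_def A_def)
    then show False using xy(3) by (simp add: inner_commute)
  qed
  then obtain p where p: "p < m" "z \<bullet> b p = -1" using zb by blast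
  \<comment> \<open>\<open>t\<close> stands for the highest root. It is a root in the lattice, so z
    differs from -t and \<open>z \<bullet> t \<ge> -1\<close>. No summand of this product is
    positive, so exactly one is nonzero, and its weight is 1.\<close>
  define t where "t = (\<Sum>i<m. real (w i) *\<^sub>R b i)"
  have tl: "t \<in> lat m b"
    unfolding lat_def t_def by (intro CollectI exI[of _ "\<lambda>i. int (w i)"]) simp
  then have tR: "t \<in> R" using norm_2_lat_in_roots[OF R b] \<theta> by (simp add: t_def)
  have "z \<noteq> - t" using zl lat_neg[OF tl] by auto
  then have "z \<bullet> t \<ge> -1"
    using simply_laced_inner_cases[OF R zR(1) tR] simply_laced_inner_minus_2[OF R zR(1) tR] by auto
  moreover have "z \<bullet> t = real (w p) * (z \<bullet> b p) + (\<Sum>i\<in>{..<m} - {p}. real (w i) * (z \<bullet> b i))"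
    using p(1) unfolding t_def inner_sum_right inner_scaleR_right by (intro sum.remove) auto
  ultimately have *: "real (w p) + (\<Sum>i\<in>{..<m} - {p}. real (w i) * - (z \<bullet> b i)) \<le> 1"
    using p by (simp add: sum_negf)
  have nn: "real (w i) * - (z \<bullet> b i) \<ge> 0" if "i \<in> {..<m} - {p}" for i
    using zb[of i] that by auto
  then have s0: "(\<Sum>i\<in>{..<m} - {p}. real (w i) * - (z \<bullet> b i)) \<ge> 0" by (rule sum_nonneg)
  then have wp: "w p = 1" using * w[OF p(1)] by linarith
  have "(\<Sum>i\<in>{..<m} - {p}. real (w i) * - (z \<bullet> b i)) = 0" using * s0 wp by simp
  then have "real (w i) * - (z \<bullet> b i) = 0" if "i \<in> {..<m} - {p}" for i
    using nn that by (subst (asm) sum_nonneg_eq_0_iff) auto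
  then have "z \<bullet> b i = 0" if "i < m" "i \<noteq> p" for i
    using w[OF that(1)] that by fastforce
  then show ?thesis using zR p wp by (intro bexI[of _ z] exI[of _ p]) auto
qed

text \<open>A root model: \<open>B i\<close> for \<open>i < m\<close> are base vectors with coordinates \<open>k < N\<close> and Gram matrix
  \<open>G\<close>, the highest root has coefficients \<open>w\<close>, and \<open>S\<close> consists of the vectors of norm 2 in the
  lattice.\<close>
definition root_model ::
  "nat \<Rightarrow> nat \<Rightarrow> (nat \<Rightarrow> nat \<Rightarrow> real) \<Rightarrow> (nat \<Rightarrow> nat \<Rightarrow> real) \<Rightarrow> (nat \<Rightarrow> nat) \<Rightarrow> (nat \<Rightarrow> real) set \<Rightarrow> bool" where
  "root_model m N B G w S \<longleftrightarrow> m > 0 \<and>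
     (\<forall>i<m. \<forall>k\<ge>N. B i k = 0) \<and>
     (\<forall>c. (\<forall>k<N. (\<Sum>i<m. c i * B i k) = 0) \<longrightarrow> (\<forall>i<m. c i = 0)) \<and>
     (\<forall>i<m. \<forall>j<m. (\<Sum>k<N. B i k * B j k) = G i j) \<and>
     (\<forall>i<m. w i \<ge> 1) \<and> (\<Sum>k<N. (\<Sum>i<m. real (w i) * B i k)\<^sup>2) = 2 \<and>
     S = {v. (\<exists>c :: nat \<Rightarrow> int. v = (\<lambda>k. \<Sum>i<m. of_int (c i) * B i k)) \<and> (\<Sum>k<N. (v k)\<^sup>2) = 2}"

text \<open>No linear map is demanded; for spanning R it is rebuilt from the inner products in
  \<open>equiv_stdI\<close>. The support condition is needed to place two copies side by
  side.\<close>

definition isometric :: "nat \<Rightarrow> 'a::real_inner set \<Rightarrow> (nat \<Rightarrow> real) set \<Rightarrow> bool" where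
  "isometric N R S \<longleftrightarrow>
     (\<exists>\<phi>. bij_betw \<phi> R S \<and> (\<forall>x\<in>R. \<forall>y\<in>R. x \<bullet> y = (\<Sum>k<N. \<phi> x k * \<phi> y k))) \<and> (\<forall>v\<in>S. \<forall>k\<ge>N. v k = 0)"

definition realizes :: "'a::real_inner set \<Rightarrow> nat \<Rightarrow> (nat \<Rightarrow> 'a) \<Rightarrow> (nat \<Rightarrow> nat \<Rightarrow> real) \<Rightarrow> bool" where
  "realizes R m b G \<longleftrightarrow> (\<forall>i<m. b i \<in> R) \<and> (\<forall>i<m. \<forall>j<m. b i \<bullet> b j = G i j)"

section \<open>Transfer from a root model to a realization of its Gram matrix\<close>

context
  fixes R :: "'a::euclidean_space set" and m N B G w S b
  assumes M: "root_model m N B G w S" and b: "realizes R m b G"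
begin

lemma model_inner:
  "(\<Sum>i<m. c i *\<^sub>R b i) \<bullet> (\<Sum>i<m. d i *\<^sub>R b i) = (\<Sum>k<N. (\<Sum>i<m. c i * B i k) * (\<Sum>i<m. d i * B i k))"
proof -
  have "(\<Sum>k<N. (\<Sum>i<m. c i * B i k) * (\<Sum>i<m. d i * B i k)) =
      (\<Sum>k<N. \<Sum>i<m. \<Sum>j<m. c i * d j * (B i k * B j k))"
    unfolding sum_product by (intro sum.cong refl) (simp add: mult_ac)
  also have "\<dots> = (\<Sum>i<m. \<Sum>j<m. \<Sum>k<N. c i * d j * (B i k * B j k))"
    by (subst sum.swap, rule sum.cong[OF refl], rule sum.swap)
  also have "\<dots> = (\<Sum>i<m. \<Sum>j<m. c i * d j * (b i \<bullet> b j))"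
    using M b by (intro sum.cong refl) (simp add: root_model_def realizes_def flip: sum_distrib_left)
  also have "\<dots> = (\<Sum>i<m. c i * (\<Sum>j<m. d j * (b i \<bullet> b j)))"
    by (simp only: sum_distrib_left mult.assoc)
  also have "\<dots> = (\<Sum>i<m. c i *\<^sub>R b i) \<bullet> (\<Sum>i<m. d i *\<^sub>R b i)"
    unfolding inner_sum_left by (simp add: inner_sum_right sum_distrib_left mult_ac)
  finally show ?thesis by (rule sym)
qed

text \<open>A combination vanishes iff its norm does, and norms depend on the Gram matrix only. This
  carries independence from the model to any realization.\<close>

lemma model_eq_0: "(\<Sum>i<m. c i *\<^sub>R b i) = 0 \<longleftrightarrow> (\<forall>k<N. (\<Sum>i<m. c i * B i k) = 0)"
proof -
  have "(\<Sum>i<m. c i *\<^sub>R b i) = 0 \<longleftrightarrow> (\<Sum>k<N. (\<Sum>i<m. c i * B i k) * (\<Sum>i<m. c i * B i k)) = 0"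
    using model_inner[of c c] inner_eq_zero_iff by metis
  then show ?thesis by (auto simp: sum_nonneg_eq_0_iff)
qed

lemma model_indep: "indep_family m b"
  using M by (simp add: indep_family_def model_eq_0 root_model_def)

lemma model_inj: "(\<Sum>i<m. c i *\<^sub>R b i) = (\<Sum>i<m. d i *\<^sub>R b i) \<Longrightarrow> i < m \<Longrightarrow> c i = d i"
  using model_indep[unfolded indep_family_def, THEN spec, of "\<lambda>i. c i - d i"]
  by (simp add: scaleR_diff_left sum_subtractf)

lemma model_dim:
  assumes "R \<subseteq> lat m b" shows "dim R = m"
proof -
  have "card (b ` {..<m}) = m" using indep_family_inj[OF model_indep] by (simp add: card_image)
  moreover have "R \<subseteq> span (b ` {..<m})"
  proof
    fix x assume "x \<in> R"
    then obtain c :: "nat \<Rightarrow> int" where x: "x = (\<Sum>i<m. of_int (c i) *\<^sub>R b i)"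
      using assms by (auto simp: lat_def)
    show "x \<in> span (b ` {..<m})"
      unfolding x by (intro span_sum span_scale, rule span_base) simp
  qed
  moreover have "b ` {..<m} \<subseteq> R" using b by (auto simp: realizes_def)
  ultimately show ?thesis
    using indep_family_independent[OF model_indep] by (metis basis_card_eq_dim)
qed

text \<open>Combinations with equal coefficients correspond. The image is all of S because R
  contains every vector of norm 2 in the lattice of its own roots.\<close>

lemma model_isometric:
  assumes R: "simply_laced R" and RL: "R \<subseteq> lat m b"
  shows "isometric N R S"
proof -
  have bR: "\<And>i. i < m \<Longrightarrow> b i \<in> R" using b by (auto simp: realizes_def)
  have S: "S = {v. (\<exists>c :: nat \<Rightarrow> int. v = (\<lambda>k. \<Sum>i<m. of_int (c i) * B i k)) \<and> (\<Sum>k<N. (v k)\<^sup>2) = 2}"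
    and supp: "\<And>i k. i < m \<Longrightarrow> k \<ge> N \<Longrightarrow> B i k = 0"
    using M by (simp_all add: root_model_def)
  define V where "V c = (\<Sum>i<m. real_of_int (c i) *\<^sub>R b i)" for c :: "nat \<Rightarrow> int"
  define W where "W c = (\<lambda>k. \<Sum>i<m. real_of_int (c i) * B i k)" for c :: "nat \<Rightarrow> int"
  \<comment> \<open>The choice is harmless: \<open>W_eq\<close> shows that equal vectors have equal
    images, by independence of b.\<close>
  define \<phi> where "\<phi> x = W (SOME c. x = V c)" for x
  have VW: "V c \<bullet> V d = (\<Sum>k<N. W c k * W d k)" for c d
    unfolding V_def W_def by (rule model_inner)
  have W_eq: "W c = W d" if "V c = V d" for c d
    using model_inj[of "\<lambda>i. real_of_int (c i)" "\<lambda>i. real_of_int (d i)"] that by (simp add: V_def W_def)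
  have V_eq: "V c = V d" if "W c = W d" for c d
  proof -
    have "(V c - V d) \<bullet> (V c - V d) = 0"
      using VW[of c c] VW[of c d] VW[of d d] that by (simp add: inner_diff inner_commute)
    then show ?thesis by simp
  qed
  have \<phi>V: "\<phi> (V c) = W c" for c
    unfolding \<phi>_def by (rule W_eq) (metis (mono_tags, lifting) someI)
  have RV: "\<exists>c. x = V c" if "x \<in> R" for x using RL that by (auto simp: lat_def V_def)
  have ip: "x \<bullet> y = (\<Sum>k<N. \<phi> x k * \<phi> y k)" if "x \<in> R" "y \<in> R" for x y
    using RV[OF that(1)] RV[OF that(2)] by (auto simp: \<phi>V VW)
  have "inj_on \<phi> R"
    by (rule inj_onI) (metis RV \<phi>V V_eq)
  moreover have "\<phi> ` R = S"
  proof (intro equalityI subsetI)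
    fix v assume "v \<in> \<phi> ` R"
    then obtain c where c: "v = W c" "V c \<in> R" using RV \<phi>V by blast
    then have "(\<Sum>k<N. (v k)\<^sup>2) = 2" using VW[of c c] simply_laced_norm[OF R] by (simp add: power2_eq_square)
    then show "v \<in> S" using c by (auto simp: S W_def)
  next
    fix v assume "v \<in> S"
    then obtain c where c: "v = W c" "(\<Sum>k<N. (v k)\<^sup>2) = 2" by (auto simp: S W_def)
    then have "V c \<bullet> V c = 2" by (simp add: VW power2_eq_square)
    then have "V c \<in> R" by (intro norm_2_lat_in_roots[OF R bR]) (auto simp: V_def lat_def)
    then show "v \<in> \<phi> ` R" using c(1) \<phi>V by (metis imageI)
  qed
  moreover have "\<forall>v\<in>S. \<forall>k\<ge>N. v k = 0" using supp by (auto simp: S)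
  ultimately show ?thesis using ip by (auto simp: isometric_def bij_betw_def)
qed

lemma model_attach:
  assumes R: "simply_laced R" and irr: "irreducible_roots R"
  shows "isometric N R S \<and> dim R = m \<or>
    (\<exists>z\<in>R. \<exists>p<m. w p = 1 \<and> (\<forall>i<m. z \<bullet> b i = (if i = p then -1 else 0)))"
proof (cases "R \<subseteq> lat m b")
  case True
  then show ?thesis using model_isometric[OF R] model_dim by blast
next
  case False
  have "(\<Sum>i<m. real (w i) *\<^sub>R b i) \<bullet> (\<Sum>i<m. real (w i) *\<^sub>R b i) = 2"
    unfolding model_inner using M by (simp add: root_model_def power2_eq_square)
  then show ?thesis
    using attach[OF R irr _ _ model_indep _ _ False, of w] M b by (simp add: root_model_def realizes_def)
qed

end

section \<open>Classification of irreducible simply laced root systems\<close>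

text \<open>Gram matrices of the simply laced diagrams: a path, and a path \<open>0, \<dots>, k - 1\<close> with a further
  vertex \<open>k\<close> joined to the vertex \<open>p\<close>.\<close>
definition gram_path :: "nat \<Rightarrow> nat \<Rightarrow> real" where
  "gram_path i j = (if i = j then 2 else if i = Suc j \<or> j = Suc i then -1 else 0)"

definition gram_branch :: "nat \<Rightarrow> nat \<Rightarrow> nat \<Rightarrow> nat \<Rightarrow> real" where
  "gram_branch k p i j = (if i = k \<or> j = k then if i = j then 2 else if i = p \<or> j = p then -1 else 0
     else gram_path i j)"

text \<open>Coefficients of the highest root in the numbering of
  \<open>gram_branch (k - 1) 1\<close>: the vertices 0 and k - 1 are the two fork ends, k - 2 is the
  far end of the path.\<close>

definition wt_D :: "nat \<Rightarrow> nat \<Rightarrow> nat" where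
  "wt_D k i = (if i = 0 \<or> i = k - 2 \<or> i = k - 1 then 1 else 2)"

text \<open>Coefficients of the highest root, here and for E_7 and E_8; the last entry belongs to
  the extra vertex attached to vertex 2. The entries 1 mark the only places where a diagram can
  grow.\<close>

definition wt_E6 :: "nat \<Rightarrow> nat" where "wt_E6 i = [1, 2, 3, 2, 1, 2] ! i"
definition wt_E7 :: "nat \<Rightarrow> nat" where "wt_E7 i = [2, 3, 4, 3, 2, 1, 2] ! i"
definition wt_E8 :: "nat \<Rightarrow> nat" where "wt_E8 i = [2, 4, 6, 5, 4, 3, 2, 3] ! i"

section \<open>Enlarging, reversing and cutting diagrams\<close>

lemma gram_path_commute: "gram_path i j = gram_path j i"
  by (auto simp: gram_path_def)

lemma gram_branch_commute: "gram_branch k p i j = gram_branch k p j i"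
  unfolding gram_branch_def gram_path_def by auto

lemma realizesI:
  assumes "\<And>i. i < m \<Longrightarrow> b i \<in> R" "\<And>i j. i \<le> j \<Longrightarrow> j < m \<Longrightarrow> b i \<bullet> b j = G i j" "\<And>i j. G i j = G j i"
  shows "realizes R m b G"
  unfolding realizes_def
proof (intro conjI allI impI)
  fix i j assume "i < m" "j < m"
  then show "b i \<bullet> b j = G i j"
    using assms(2)[of i j] assms(2)[of j i] assms(3)[of i j] by (cases "i \<le> j") (auto simp: inner_commute)
qed (rule assms(1))

lemma realizes_root: "realizes R m b G \<Longrightarrow> i < m \<Longrightarrow> b i \<in> R"
  by (simp add: realizes_def)

lemma realizes_inner: "realizes R m b G \<Longrightarrow> i < m \<Longrightarrow> j < m \<Longrightarrow> b i \<bullet> b j = G i j"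
  by (simp add: realizes_def)

lemma realizes_path_cons:
  assumes b: "realizes R k b gram_path" and z: "z \<in> R" "z \<bullet> z = 2"
    "\<And>i. i < k \<Longrightarrow> z \<bullet> b i = (if i = 0 then -1 else 0)"
  shows "realizes R (Suc k) (case_nat z b) gram_path"
proof (rule realizesI)
  show "case_nat z b i \<in> R" if "i < Suc k" for i
    using that z realizes_root[OF b] by (cases i) auto
  show "case_nat z b i \<bullet> case_nat z b j = gram_path i j" if "i \<le> j" "j < Suc k" for i j
    using that z realizes_inner[OF b] by (cases i; cases j) (auto simp: gram_path_def)
qed (rule gram_path_commute)

lemma realizes_path_snoc:
  assumes b: "realizes R k b gram_path" and z: "z \<in> R" "z \<bullet> z = 2"
    "\<And>i. i < k \<Longrightarrow> z \<bullet> b i = (if i = k - 1 then -1 else 0)"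
  shows "realizes R (Suc k) (b(k := z)) gram_path"
proof (rule realizesI)
  show "(b(k := z)) i \<in> R" if "i < Suc k" for i
    using that z realizes_root[OF b] by (auto simp: less_Suc_eq)
  show "(b(k := z)) i \<bullet> (b(k := z)) j = gram_path i j" if "i \<le> j" "j < Suc k" for i j
    using that z(2) z(3)[of i] realizes_inner[OF b, of i j]
    by (cases "j = k"; cases "i = k") (auto simp: gram_path_def inner_commute split: if_splits)
qed (rule gram_path_commute)

lemma realizes_branch:
  assumes b: "realizes R k b gram_path" and z: "z \<in> R" "z \<bullet> z = 2"
    "\<And>i. i < k \<Longrightarrow> z \<bullet> b i = (if i = p then -1 else 0)" and "p < k"
  shows "realizes R (Suc k) (b(k := z)) (gram_branch k p)"
proof (rule realizesI)
  show "(b(k := z)) i \<in> R" if "i < Suc k" for i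
    using that z realizes_root[OF b] by (auto simp: less_Suc_eq)
  show "(b(k := z)) i \<bullet> (b(k := z)) j = gram_branch k p i j" if "i \<le> j" "j < Suc k" for i j
    using that z(2) z(3)[of i] \<open>p < k\<close> realizes_inner[OF b, of i j]
    by (cases "j = k"; cases "i = k") (auto simp: gram_branch_def inner_commute split: if_splits)
qed (rule gram_branch_commute)

lemma realizes_branch_path: "realizes R (Suc k) b (gram_branch k p) \<Longrightarrow> realizes R k b gram_path"
  by (simp add: realizes_def gram_branch_def)

lemma realizes_path_rev:
  assumes "realizes R k b gram_path" shows "realizes R k (\<lambda>i. b (k - 1 - i)) gram_path"
proof (rule realizesI)
  show "b (k - 1 - i) \<bullet> b (k - 1 - j) = gram_path i j" if "i \<le> j" "j < k" for i j
  proof -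
    have "(k - 1 - i = k - 1 - j) = (i = j)" "(k - 1 - i = Suc (k - 1 - j)) = (j = Suc i)"
      "(k - 1 - j = Suc (k - 1 - i)) = (i = Suc j)"
      using that by linarith+
    then show ?thesis
      using that realizes_inner[OF assms, of "k - 1 - i" "k - 1 - j"] unfolding gram_path_def by simp
  qed
qed (simp add: realizes_root[OF assms], rule gram_path_commute)

lemma realizes_path_sub:
  assumes "realizes R k b gram_path" "q + l \<le> k" shows "realizes R l (\<lambda>i. b (q + i)) gram_path"
  using assms(2) realizes_root[OF assms(1)] realizes_inner[OF assms(1)]
  unfolding realizes_def by (simp add: gram_path_def)

text \<open>The bound that makes a longest path exist. Vertices are distinct because the entry 2
  occurs only on the diagonal.\<close>

lemma realizes_path_le_card:
  assumes "simply_laced R" "realizes R k b gram_path" shows "k \<le> card R"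
proof -
  have "inj_on b {..<k}"
  proof (rule inj_onI)
    fix i j assume a: "i \<in> {..<k}" "j \<in> {..<k}" "b i = b j"
    then have "gram_path i j = gram_path i i"
      using realizes_inner[OF assms(2), of i j] realizes_inner[OF assms(2), of i i] by simp
    then show "i = j" by (auto simp: gram_path_def split: if_splits)
  qed
  moreover have "b ` {..<k} \<subseteq> R" using assms(2) by (auto simp: realizes_def)
  ultimately show ?thesis
    using card_inj_on_le[of b "{..<k}" R] simply_laced_finite[OF assms(1)] by simp
qed

lemma model_attachE:
  assumes "root_model m N B G w S" "realizes R m b G" "simply_laced R" "irreducible_roots R"
    "\<not> (isometric N R S \<and> dim R = m)"
  obtains z p where "z \<in> R" "p < m" "w p = 1" "\<And>i. i < m \<Longrightarrow> z \<bullet> b i = (if i = p then -1 else 0)"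
proof -
  have "\<exists>z\<in>R. \<exists>p<m. w p = 1 \<and> (\<forall>i<m. z \<bullet> b i = (if i = p then -1 else 0))"
    using model_attach[OF assms(1-4)] assms(5) by linarith
  then show ?thesis using that by blast
qed

section \<open>Growth of diagrams in an irreducible root system\<close>

locale irreducible =
  fixes R :: "'a::euclidean_space set"
  assumes R: "simply_laced R" and irr: "irreducible_roots R" and ne: "R \<noteq> {}"
begin

text \<open>No coefficient of the highest root of E_8 is 1, so nothing can be attached.\<close>

lemma E8_case:
  assumes M: "root_model 8 N B (gram_branch 7 2) wt_E8 S" and b: "realizes R 8 b (gram_branch 7 2)"
  shows "isometric N R S \<and> dim R = 8"
proof -
  have "wt_E8 p \<noteq> 1" if "p < 8" for p
  proof -
    from that have "p \<in> {0, 1, 2, 3, 4, 5, 6, 7}" by auto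
    then show ?thesis by (auto simp: wt_E8_def)
  qed
  then show ?thesis using model_attach[OF M b R irr] by blast
qed

text \<open>The coefficient 1 occurs only at vertex 5, the free end of the long arm. The new root
  becomes path vertex 6 and the old branch vertex is renumbered 7.\<close>

lemma E7_case:
  assumes M: "root_model 7 N B (gram_branch 6 2) wt_E7 S" and b: "realizes R 7 b (gram_branch 6 2)"
  shows "isometric N R S \<and> dim R = 7 \<or> (\<exists>b. realizes R 8 b (gram_branch 7 2))"
proof (subst disj_commute, rule disjCI)
  assume "\<not> (isometric N R S \<and> dim R = 7)"
  then obtain z p where z: "z \<in> R" "p < 7" "wt_E7 p = 1" "\<And>i. i < 7 \<Longrightarrow> z \<bullet> b i = (if i = p then -1 else 0)"
    by (rule model_attachE[OF M b R irr]) (rule that)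
  have p: "p = 5"
  proof -
    from z(2) have "p \<in> {0, 1, 2, 3, 4, 5, 6}" by auto
    with z(3) show ?thesis by (auto simp: wt_E7_def)
  qed
  have c: "realizes R 6 b gram_path" using realizes_branch_path[of R 6 b 2] b by simp
  then have c': "realizes R 7 (b(6 := z)) gram_path"
    using realizes_path_snoc[OF c z(1)] z(4) p simply_laced_norm[OF R z(1)] by simp
  have "b 6 \<bullet> (b(6 := z)) i = (if i = 2 then -1 else 0)" if "i < 7" for i
    using that realizes_inner[OF b, of 6 i] z(4)[of 6] p
    by (cases "i = 6") (auto simp: gram_branch_def inner_commute[of _ z])
  then have "realizes R 8 ((b(6 := z))(7 := b 6)) (gram_branch 7 2)"
    using realizes_branch[OF c', of "b 6" 2] b simply_laced_norm[OF R] by (simp add: realizes_def)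
  then show "\<exists>b. realizes R 8 b (gram_branch 7 2)" by blast
qed

text \<open>The coefficient 1 occurs at both ends of the path. Reversal fixes the branching vertex
  2, so the new root may be assumed to sit at the end 4.\<close>

lemma E6_case:
  assumes M: "root_model 6 N B (gram_branch 5 2) wt_E6 S" and b: "realizes R 6 b (gram_branch 5 2)"
  shows "isometric N R S \<and> dim R = 6 \<or> (\<exists>b. realizes R 7 b (gram_branch 6 2))"
proof (subst disj_commute, rule disjCI)
  assume "\<not> (isometric N R S \<and> dim R = 6)"
  then obtain z p where z: "z \<in> R" "p < 6" "wt_E6 p = 1" "\<And>i. i < 6 \<Longrightarrow> z \<bullet> b i = (if i = p then -1 else 0)"
    by (rule model_attachE[OF M b R irr]) (rule that)
  have p: "p = 0 \<or> p = 4"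
  proof -
    from z(2) have "p \<in> {0, 1, 2, 3, 4, 5}" by auto
    with z(3) show ?thesis by (auto simp: wt_E6_def)
  qed
  have c: "realizes R 5 b gram_path" using realizes_branch_path[of R 5 b 2] b by simp
  obtain c where c: "realizes R 5 c gram_path" "\<And>i. i < 5 \<Longrightarrow> z \<bullet> c i = (if i = 4 then -1 else 0)"
    "\<And>i. i < 5 \<Longrightarrow> b 5 \<bullet> c i = (if i = 2 then -1 else 0)"
  proof (cases "p = 4")
    case True
    then show ?thesis using that[of b] c z(4) realizes_inner[OF b, of 5] by (auto simp: gram_branch_def)
  next
    case False
    show ?thesis
    proof (rule that[of "\<lambda>i. b (5 - 1 - i)"])
      show "realizes R 5 (\<lambda>i. b (5 - 1 - i)) gram_path" by (rule realizes_path_rev[OF c])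
      fix i :: nat assume "i < 5"
      then show "z \<bullet> b (5 - 1 - i) = (if i = 4 then -1 else 0)"
        using z(4)[of "5 - 1 - i"] p False by auto
      have "b 5 \<bullet> b (5 - 1 - i) = (if 5 - 1 - i = 2 then -1 else 0)"
        using realizes_inner[OF b, of 5 "5 - 1 - i"] \<open>i < 5\<close> by (simp add: gram_branch_def)
      also have "(5 - 1 - i = 2) = (i = 2)" using \<open>i < 5\<close> by linarith
      finally show "b 5 \<bullet> b (5 - 1 - i) = (if i = 2 then -1 else 0)" .
    qed
  qed
  then have c': "realizes R 6 (c(5 := z)) gram_path"
    using realizes_path_snoc[OF c(1) z(1)] simply_laced_norm[OF R z(1)] by simp
  have "b 5 \<bullet> (c(5 := z)) i = (if i = 2 then -1 else 0)" if "i < 6" for i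
    using that c(3)[of i] z(4)[of 5] p by (cases "i = 5") (auto simp: inner_commute[of _ z])
  then have "realizes R 7 ((c(5 := z))(6 := b 5)) (gram_branch 6 2)"
    using realizes_branch[OF c', of "b 5" 2] b simply_laced_norm[OF R] by (simp add: realizes_def)
  then show "\<exists>b. realizes R 7 b (gram_branch 6 2)" by blast
qed

text \<open>Each vertex with coefficient 1 is an end of some path of k roots, so an attached root
  would produce a longer path than \<open>max\<close> allows.\<close>

lemma D_case:
  assumes M: "root_model (Suc k) N B (gram_branch k 1) (wt_D (Suc k)) S" and k: "k \<ge> 3"
    and b: "realizes R (Suc k) b (gram_branch k 1)"
    and max: "\<And>c. \<not> realizes R (Suc k) c gram_path"
  shows "isometric N R S \<and> dim R = Suc k"
proof (rule ccontr)
  assume "\<not> (isometric N R S \<and> dim R = Suc k)"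
  then obtain z p where z: "z \<in> R" "p < Suc k" "wt_D (Suc k) p = 1"
      "\<And>i. i < Suc k \<Longrightarrow> z \<bullet> b i = (if i = p then -1 else 0)"
    by (rule model_attachE[OF M b R irr]) (rule that)
  have z2: "z \<bullet> z = 2" by (rule simply_laced_norm[OF R z(1)])
  have c: "realizes R k b gram_path" using realizes_branch_path[OF b] .
  have "p = 0 \<or> p = Suc k - 2 \<or> p = Suc k - 1"
    by (rule ccontr) (use z(3) in \<open>simp add: wt_D_def\<close>)
  then consider "p = 0" | "p = k - 1" | "p = k" by fastforce
  then show False
  proof cases
    case 1
    then have "z \<bullet> b i = (if i = 0 then -1 else 0)" if "i < k" for i using z(4)[of i] that by simp
    then show ?thesis using realizes_path_cons[OF c z(1) z2] max by blast
  next
    case 2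
    then have "z \<bullet> b i = (if i = k - 1 then -1 else 0)" if "i < k" for i using z(4)[of i] that by simp
    then show ?thesis using realizes_path_snoc[OF c z(1) z2] max by blast
  next
    case 3
    \<comment> \<open>The fork ends 0 and k have the same single neighbour, so exchanging them
      yields another path, which z prolongs at \<open>b k\<close>.\<close>
    define b' where "b' = b(0 := b k)"
    have c': "realizes R k b' gram_path"
    proof (rule realizesI)
      show "b' i \<bullet> b' j = gram_path i j" if "i \<le> j" "j < k" for i j
        using that k realizes_inner[OF b, of k j] realizes_inner[OF b, of k k] realizes_inner[OF b, of i j]
        by (cases "i = 0"; cases "j = 0") (auto simp: b'_def gram_branch_def gram_path_def)
    qed (simp add: b'_def realizes_root[OF b], rule gram_path_commute)
    have "z \<bullet> b' i = (if i = 0 then -1 else 0)" if "i < k" for i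
      using z(4)[of i] z(4)[of k] 3 that by (simp add: b'_def)
    then show ?thesis using realizes_path_cons[OF c' z(1) z2] max by blast
  qed
qed

theorem classification:
  assumes MA: "\<And>k. k \<ge> 1 \<Longrightarrow> root_model k (Suc k) BA gram_path (\<lambda>_. 1) (std_A k)"
    and MD: "\<And>k. k \<ge> 4 \<Longrightarrow> root_model k k (BD k) (gram_branch (k - 1) 1) (wt_D k) (std_D k)"
    and M6: "root_model 6 8 BE6 (gram_branch 5 2) wt_E6 std_E6"
    and M7: "root_model 7 8 BE7 (gram_branch 6 2) wt_E7 std_E7"
    and M8: "root_model 8 8 BE8 (gram_branch 7 2) wt_E8 std_E8"
  shows "(\<exists>k\<ge>1. isometric (Suc k) R (std_A k) \<and> dim R = k) \<or>
    (\<exists>k\<ge>4. isometric k R (std_D k) \<and> dim R = k) \<or>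
    isometric 8 R std_E6 \<and> dim R = 6 \<or> isometric 8 R std_E7 \<and> dim R = 7 \<or>
    isometric 8 R std_E8 \<and> dim R = 8"
proof (cases "\<exists>b. realizes R 6 b (gram_branch 5 2)")
  case True
  then show ?thesis using E6_case[OF M6] E7_case[OF M7] E8_case[OF M8] by blast
next
  case noE6: False
  define P where "P k \<longleftrightarrow> (\<exists>b. realizes R k b gram_path)" for k
  obtain r where r: "r \<in> R" using ne by blast
  have P1: "P 1" unfolding P_def realizes_def gram_path_def
    by (rule exI[of _ "\<lambda>_. r"]) (use r simply_laced_norm[OF R r] in auto)
  have bound: "k \<le> card R" if "P k" for k
    using that realizes_path_le_card[OF R] by (auto simp: P_def)
  define k where "k = Greatest P"
  have Pk: "P k" and max: "\<And>l. P l \<Longrightarrow> l \<le> k"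
    unfolding k_def using GreatestI_nat[of P, OF P1 bound] Greatest_le_nat[of P _ "card R"] bound by blast+
  have k1: "k \<ge> 1" using max[OF P1] .
  have noS: "\<not> realizes R (Suc k) c gram_path" for c using max[of "Suc k"] by (auto simp: P_def)
  obtain b where b: "realizes R k b gram_path" using Pk by (auto simp: P_def)
  show ?thesis
  proof (cases "isometric (Suc k) R (std_A k) \<and> dim R = k")
    case True
    then show ?thesis using k1 by blast
  next
    case False
    then obtain z p where z: "z \<in> R" "p < k" "\<And>i. i < k \<Longrightarrow> z \<bullet> b i = (if i = p then -1 else 0)"
      by (rule model_attachE[OF MA[OF k1] b R irr]) (rule that)
    have z2: "z \<bullet> z = 2" by (rule simply_laced_norm[OF R z(1)])
    have p0: "p \<noteq> 0"
    proof
      assume "p = 0"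
      from realizes_path_cons[OF b z(1) z2 z(3)[unfolded this]] noS show False by blast
    qed
    have pk: "p \<noteq> k - 1"
    proof
      assume "p = k - 1"
      from realizes_path_snoc[OF b z(1) z2 z(3)[unfolded this]] noS show False by blast
    qed
    have k3: "k \<ge> 3" using p0 pk z(2) by auto
    obtain c where c: "realizes R (Suc k) c (gram_branch k 1)"
    proof -
      \<comment> \<open>Next to an end of the path the new root gives type D, after a reversal if
        necessary. Elsewhere two path vertices remain on either side of p, and together with z they
        form the excluded E_6.\<close>
      consider "p = 1" | "p = k - 2" | "2 \<le> p" "p + 3 \<le> k" using p0 pk z(2) by linarith
      then show ?thesis
      proof cases
        case 1
        then show ?thesis using that[OF realizes_branch[OF b z(1) z2, of 1]] z(3) k3 by simp
      next
        case 2
        have "z \<bullet> b (k - 1 - i) = (if i = 1 then -1 else 0)" if "i < k" for i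
          using z(3)[of "k - 1 - i"] 2 that k3 by auto
        then show ?thesis using that[OF realizes_branch[OF realizes_path_rev[OF b] z(1) z2, of 1]] k3 by simp
      next
        case 3
        have "z \<bullet> b (p - 2 + i) = (if i = 2 then -1 else 0)" if "i < 5" for i
          using z(3)[of "p - 2 + i"] 3 that by auto
        then have "realizes R (Suc 5) ((\<lambda>i. b (p - 2 + i))(5 := z)) (gram_branch 5 2)"
          using 3 by (intro realizes_branch[OF realizes_path_sub[OF b] z(1) z2]) auto
        then show ?thesis using noE6 by (simp add: numeral_eq_Suc)
      qed
    qed
    have "root_model (Suc k) (Suc k) (BD (Suc k)) (gram_branch k 1) (wt_D (Suc k)) (std_D (Suc k))"
      using MD[of "Suc k"] k3 by simp
    from D_case[OF this k3 c noS] show ?thesis using k3 by (intro disjI2 disjI1 exI[of _ "Suc k"]) auto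
  qed
qed

end

section \<open>Models of the root systems A and D\<close>

lemma sum_squares_eq_2:
  fixes f :: "nat \<Rightarrow> int"
  assumes "(\<Sum>k<N. (f k)\<^sup>2) = 2"
  obtains i j where "i < j" "j < N" "f i \<in> {1, -1}" "f j \<in> {1, -1}"
    "\<And>k. k < N \<Longrightarrow> k \<noteq> i \<Longrightarrow> k \<noteq> j \<Longrightarrow> f k = 0"
proof -
  define A where "A = {k \<in> {..<N}. f k \<noteq> 0}"
  have s: "(\<Sum>k\<in>A. (f k)\<^sup>2) = 2"
    unfolding assms[symmetric] A_def by (rule sum.mono_neutral_left) auto
  have sq: "(f k)\<^sup>2 = 1" if "k \<in> A" for k
  proof -
    have "(f k)\<^sup>2 \<le> (\<Sum>k\<in>A. (f k)\<^sup>2)" by (rule member_le_sum) (use that in \<open>auto simp: A_def\<close>)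
    then have le: "(f k)\<^sup>2 \<le> 2" using s by simp
    have "\<bar>f k\<bar> < 2"
    proof (rule ccontr)
      assume "\<not> \<bar>f k\<bar> < 2"
      then have "2\<^sup>2 \<le> \<bar>f k\<bar>\<^sup>2" by (intro power_mono) auto
      then show False using le by simp
    qed
    moreover have "f k \<noteq> 0" using that by (simp add: A_def)
    ultimately have "\<bar>f k\<bar> = 1" by linarith
    then show ?thesis by (metis power2_abs one_power2)
  qed
  then have "(\<Sum>k\<in>A. (f k)\<^sup>2) = int (card A)" by simp
  then have "card A = 2" using s by simp
  then obtain i j where ij: "A = {i, j}" "i < j"
    by (metis card_2_iff insert_commute linorder_neqE_nat)
  have pm: "f k \<in> {1, -1}" if "k \<in> A" for k using sq[OF that] by (simp add: power2_eq_1_iff)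
  show ?thesis
  proof (rule that[OF ij(2)])
    have "i \<in> A" "j \<in> A" using ij by auto
    then show "j < N" "f i \<in> {1, -1}" "f j \<in> {1, -1}" using pm[of i] pm[of j] by (auto simp: A_def)
    show "f k = 0" if "k < N" "k \<noteq> i" "k \<noteq> j" for k
      using that ij(1) unfolding A_def by blast
  qed
qed

lemma sum_ee: "(\<Sum>i<m. c i * ee i k) = (if k < m then c k else 0)"
  by (simp add: ee_def if_distrib[of "\<lambda>t. _ * t"] cong: if_cong)

lemma sum_ee': "(\<Sum>k<N. ee i k * c k) = (if i < N then c i else 0)"
  by (simp add: ee_def if_distrib[of "\<lambda>t. t * _"] cong: if_cong)

lemma sum_ee_Suc: "(\<Sum>i<m. c i * ee (Suc i) k) = (if 0 < k \<and> k \<le> m then c (k - 1) else 0)"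
proof (cases k)
  case (Suc l)
  then have "(\<Sum>i<m. c i * ee (Suc i) k) = (\<Sum>i<m. c i * ee i l)" by (simp add: ee_def)
  with Suc show ?thesis by (simp add: sum_ee Suc_le_eq)
qed (simp add: ee_def)

lemma norm_two_ee:
  assumes "i \<noteq> j" "i < N" "j < N"
  shows "(\<Sum>k<N. (s * ee i k + t * ee j k)\<^sup>2) = s\<^sup>2 + t\<^sup>2"
proof -
  have "(\<Sum>k<N. (s * ee i k + t * ee j k)\<^sup>2) = (\<Sum>k\<in>{i, j}. (s * ee i k + t * ee j k)\<^sup>2)"
    using assms by (intro sum.mono_neutral_right) (auto simp: ee_def)
  then show ?thesis using assms(1) by (simp add: ee_def)
qed

lemma int_vector_norm_2:
  fixes f :: "nat \<Rightarrow> int"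
  assumes v: "\<And>k. v k = real_of_int (f k)" and supp: "\<And>k. k \<ge> N \<Longrightarrow> f k = 0"
    and norm: "(\<Sum>k<N. (v k)\<^sup>2) = 2"
  obtains i j where "i < j" "j < N" "f i \<in> {1, -1}" "f j \<in> {1, -1}"
    "v = (\<lambda>k. of_int (f i) * ee i k + of_int (f j) * ee j k)"
proof -
  have "real_of_int (\<Sum>k<N. (f k)\<^sup>2) = 2" using norm by (simp add: v)
  then have "(\<Sum>k<N. (f k)\<^sup>2) = 2" by linarith
  then obtain i j where ij: "i < j" "j < N" "f i \<in> {1, -1}" "f j \<in> {1, -1}"
      "\<And>k. k < N \<Longrightarrow> k \<noteq> i \<Longrightarrow> k \<noteq> j \<Longrightarrow> f k = 0" by (rule sum_squares_eq_2) (rule that)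
  have "v k = of_int (f i) * ee i k + of_int (f j) * ee j k" for k
    using ij(1) ij(5)[of k] supp[of k] by (cases "k < N") (auto simp: v ee_def)
  then show ?thesis using that[OF ij(1-4)] by blast
qed

definition base_A :: "nat \<Rightarrow> nat \<Rightarrow> real" where
  "base_A i k = ee i k - ee (Suc i) k"

lemma sum_base_A:
  "(\<Sum>i<m. c i * base_A i k) = (if k < m then c k else 0) - (if 0 < k \<and> k \<le> m then c (k - 1) else 0)"
  by (simp add: base_A_def right_diff_distrib sum_subtractf sum_ee sum_ee_Suc)

lemma base_A_inner: "i < m \<Longrightarrow> j < m \<Longrightarrow> (\<Sum>k<Suc m. base_A i k * base_A j k) = gram_path i j"
proof -
  assume "i < m" "j < m"
  then have "(\<Sum>k<Suc m. base_A i k * base_A j k) = base_A j i - base_A j (Suc i)"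
    unfolding base_A_def[of i] left_diff_distrib sum_subtractf sum_ee' by simp
  then show ?thesis by (auto simp: base_A_def ee_def gram_path_def)
qed

lemma sum_partial_zero_imp_zero:
  fixes c :: "nat \<Rightarrow> real"
  assumes "\<And>k. k < m \<Longrightarrow> c k - (if 0 < k then c (k - 1) else 0) = 0" "i < m"
  shows "c i = 0"
  using assms(2)
proof (induction i)
  case 0
  then show ?case using assms(1)[of 0] by simp
next
  case (Suc i)
  then show ?case using assms(1)[of "Suc i"] by simp
qed

text \<open>The coefficient of \<open>base_A l\<close> is the partial sum of the coordinates up to
  l. Conversely, the coordinates of a lattice vector sum to 0, which forces its two entries to have
  opposite signs.\<close>

lemma std_A_lattice:
  assumes "m \<ge> 1"
  shows "std_A m = {v. (\<exists>c. v = (\<lambda>k. \<Sum>i<m. real_of_int (c i) * base_A i k)) \<and> (\<Sum>k<Suc m. (v k)\<^sup>2) = 2}"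
    (is "_ = ?S")
proof (intro equalityI subsetI)
  fix v assume "v \<in> std_A m"
  then obtain i j where v: "v = (\<lambda>k. ee i k - ee j k)" and ij: "i \<le> m" "j \<le> m" "i \<noteq> j"
    unfolding std_A_def by blast
  define c :: "nat \<Rightarrow> int" where "c l = (if i \<le> l then 1 else 0) - (if j \<le> l then 1 else 0)" for l
  have "v k = (\<Sum>i<m. real_of_int (c i) * base_A i k)" for k
  proof -
    have "(if k < m then c k else 0) - (if 0 < k \<and> k \<le> m then c (k - 1) else 0) =
        (if k = i then 1 else 0) - (if k = j then 1 else 0)"
    proof (cases k)
      case 0
      then show ?thesis using ij assms by (simp add: c_def)
    next
      case (Suc l)
      have st: "(if x \<le> l then 1 else 0) = (if x \<le> Suc l then 1 else 0) - (if Suc l = x then 1 else (0::int))" for x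
        by simp
      have "c l = c (Suc l) - (if Suc l = i then 1 else 0) + (if Suc l = j then 1 else 0)"
        unfolding c_def st by (simp only: diff_diff_eq2 diff_add_eq)
      moreover have "c (Suc l) = 0" if "Suc l = m" using ij that by (simp add: c_def)
      ultimately show ?thesis unfolding Suc using ij(1,2)
        by (cases "Suc l < m"; cases "Suc l = m") auto
    qed
    then have "real_of_int ((if k < m then c k else 0) - (if 0 < k \<and> k \<le> m then c (k - 1) else 0)) = v k"
      by (simp add: v ee_def)
    then show ?thesis
      unfolding sum_base_A by (simp only: of_int_diff if_distrib[of real_of_int] of_int_0)
  qed
  moreover have "(\<Sum>k<Suc m. (v k)\<^sup>2) = 2"
    using norm_two_ee[of i j "Suc m" 1 "-1"] ij by (simp add: v del: sum.lessThan_Suc)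
  ultimately show "v \<in> ?S" by blast
next
  fix v assume "v \<in> ?S"
  then obtain c :: "nat \<Rightarrow> int" where c: "v = (\<lambda>k. \<Sum>i<m. real_of_int (c i) * base_A i k)"
      "(\<Sum>k<Suc m. (v k)\<^sup>2) = 2" by blast
  define f where "f k = (if k < m then c k else 0) - (if 0 < k \<and> k \<le> m then c (k - 1) else 0)" for k
  have "v k = real_of_int (f k)" for k unfolding c(1) sum_base_A f_def by simp
  moreover have "f k = 0" if "k \<ge> Suc m" for k using that by (simp add: f_def)
  ultimately obtain i j where ij: "i < j" "j < Suc m" "f i \<in> {1, -1}" "f j \<in> {1, -1}"
      and v: "v = (\<lambda>k. of_int (f i) * ee i k + of_int (f j) * ee j k)"
    using c(2) by (rule int_vector_norm_2) (assumption, rule that)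
  have "(\<Sum>k<l. real_of_int (f k)) = (if l = 0 then 0 else real_of_int (c (l - 1)))" if "l \<le> m" for l
    using that by (induction l) (auto simp: f_def)
  from this[of m] have "(\<Sum>k<Suc m. real_of_int (f k)) = 0" using assms by (simp add: f_def)
  then have "(\<Sum>k<Suc m. v k) = 0"
    using \<open>\<And>k. v k = real_of_int (f k)\<close> by simp
  moreover have "(\<Sum>k<Suc m. v k) = of_int (f i) + of_int (f j)"
    using ij(1,2) sum_ee'[of i "\<lambda>_. of_int (f i)" "Suc m"] sum_ee'[of j "\<lambda>_. of_int (f j)" "Suc m"]
    unfolding v sum.distrib by (simp add: mult.commute del: sum.lessThan_Suc)
  ultimately have "f i = 1 \<and> f j = -1 \<or> f i = -1 \<and> f j = 1" using ij(3,4) by auto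
  then have "v = (\<lambda>k. ee i k - ee j k) \<or> v = (\<lambda>k. ee j k - ee i k)" using v by auto
  moreover have "i \<le> m" "j \<le> m" "i \<noteq> j" using ij(1,2) by auto
  ultimately show "v \<in> std_A m" unfolding std_A_def by blast
qed

lemma root_model_A:
  assumes "m \<ge> 1"
  shows "root_model m (Suc m) base_A gram_path (\<lambda>_. 1) (std_A m)"
  unfolding root_model_def
proof (intro conjI allI impI)
  show "c i = 0" if c: "\<forall>k<Suc m. (\<Sum>i<m. c i * base_A i k) = 0" and i: "i < m" for c i
  proof (rule sum_partial_zero_imp_zero[OF _ i])
    show "c k - (if 0 < k then c (k - 1) else 0) = 0" if "k < m" for k
      using c[rule_format, of k] that by (simp add: sum_base_A split: if_splits)
  qed
  show "(\<Sum>k<Suc m. (\<Sum>i<m. real 1 * base_A i k)\<^sup>2) = 2"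
  proof -
    have "(\<Sum>i<m. real 1 * base_A i k) = 1 * ee 0 k + -1 * ee m k" for k
      using assms unfolding sum_base_A by (auto simp: ee_def)
    then show ?thesis using norm_two_ee[of 0 m "Suc m" 1 "-1"] assms by (simp del: sum.lessThan_Suc)
  qed
  show "(\<Sum>k<Suc m. base_A i k * base_A j k) = gram_path i j" if "i < m" "j < m" for i j
    using that by (rule base_A_inner)
  show "std_A m = {v. (\<exists>c. v = (\<lambda>k. \<Sum>i<m. real_of_int (c i) * base_A i k)) \<and> (\<Sum>k<Suc m. (v k)\<^sup>2) = 2}"
    by (rule std_A_lattice[OF assms])
qed (use assms in \<open>auto simp: base_A_def ee_def\<close>)

text \<open>The sign of the last vector makes its product with the vector of vertex 1 equal to -1,
  while it stays orthogonal to that of vertex 0.\<close>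

definition base_D :: "nat \<Rightarrow> nat \<Rightarrow> nat \<Rightarrow> real" where
  "base_D n i k = (if i = n - 1 then - (ee 0 k + ee 1 k) else base_A i k)"

lemma sum_base_D:
  "(\<Sum>i<Suc m. c i * base_D (Suc m) i k) =
    (if k < m then c k else 0) - (if 0 < k \<and> k \<le> m then c (k - 1) else 0) - c m * (ee 0 k + ee 1 k)"
proof -
  have "(\<Sum>i<m. c i * base_D (Suc m) i k) = (\<Sum>i<m. c i * base_A i k)"
    by (intro sum.cong refl) (simp add: base_D_def)
  then show ?thesis by (simp add: sum_base_A base_D_def algebra_simps)
qed

lemma base_D_inner:
  assumes "m \<ge> 2" "i < Suc m" "j < Suc m"
  shows "(\<Sum>k<Suc m. base_D (Suc m) i k * base_D (Suc m) j k) = gram_branch m 1 i j"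
proof -
  have y: "(\<Sum>k<Suc m. - (ee 0 k + ee 1 k) * c k) = - (c 0 + c 1)" for c
  proof -
    have "(\<Sum>k<Suc m. - (ee 0 k + ee 1 k) * c k) = - ((\<Sum>k<Suc m. ee 0 k * c k) + (\<Sum>k<Suc m. ee 1 k * c k))"
      unfolding sum.distrib[symmetric] sum_negf[symmetric] by (intro sum.cong refl) (simp add: algebra_simps)
    then show ?thesis using assms(1) unfolding sum_ee' by simp
  qed
  show ?thesis
  proof (cases "i = m")
    case True
    then have "(\<Sum>k<Suc m. base_D (Suc m) i k * base_D (Suc m) j k) = - (base_D (Suc m) j 0 + base_D (Suc m) j 1)"
      using y[of "base_D (Suc m) j"] by (simp add: base_D_def[of _ m] del: sum.lessThan_Suc)
    then show ?thesis using True assms by (auto simp: base_D_def base_A_def ee_def gram_branch_def)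
  next
    case i: False
    show ?thesis
    proof (cases "j = m")
      case True
      then have "(\<Sum>k<Suc m. base_D (Suc m) i k * base_D (Suc m) j k) = - (base_A i 0 + base_A i 1)"
        using y[of "base_A i"] i by (simp add: base_D_def mult.commute del: sum.lessThan_Suc)
      then show ?thesis using True i assms by (auto simp: base_A_def ee_def gram_branch_def)
    next
      case False
      then have "(\<Sum>k<Suc m. base_D (Suc m) i k * base_D (Suc m) j k) = gram_path i j"
        using base_A_inner[of i m j] i assms by (simp add: base_D_def del: sum.lessThan_Suc)
      then show ?thesis using False i by (simp add: gram_branch_def)
    qed
  qed
qed

lemma std_D_lattice:
  assumes "m \<ge> 3"
  shows "std_D (Suc m) = {v. (\<exists>c. v = (\<lambda>k. \<Sum>i<Suc m. real_of_int (c i) * base_D (Suc m) i k)) \<and> (\<Sum>k<Suc m. (v k)\<^sup>2) = 2}"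
    (is "_ = ?S")
proof (intro equalityI subsetI)
  fix v assume "v \<in> std_D (Suc m)"
  then obtain i j s t where v: "v = (\<lambda>k. s * ee i k + t * ee j k)" and ij: "i < j" "j < Suc m"
      and st: "s \<in> {1, -1}" "t \<in> {1, -1}"
    unfolding std_D_def by blast
  obtain s' where s': "s = of_int s'" "s' = 1 \<or> s' = -1" using st(1) that[of 1] that[of "-1"] by auto
  obtain t' where t': "t = of_int t'" "t' = 1 \<or> t' = -1" using st(2) that[of 1] that[of "-1"] by auto
  \<comment> \<open>\<open>q\<close> is the coefficient of the branch vertex. That vertex takes q
    away from the coordinates 0 and 1, so the path coefficients are the partial sums
    \<open>P\<close> increased by q at 0 and by 2q from 1 on. At coordinate m the surplus cancels
    because \<open>s' + t' = - (2 * q)\<close>.\<close>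
  define q where "q = - ((s' + t') div 2)"
  have q: "s' + t' = - (2 * q)" using s' t' by (auto simp: q_def)
  define P where "P l = (if i \<le> l then s' else 0) + (if j \<le> l then t' else 0)" for l
  define c where "c l = (if l = m then q else P l + (if l = 0 then q else 2 * q))" for l
  have "v k = (\<Sum>i<Suc m. real_of_int (c i) * base_D (Suc m) i k)" for k
  proof -
    have "(if k < m then c k else 0) - (if 0 < k \<and> k \<le> m then c (k - 1) else 0) -
        c m * ((if k = 0 then 1 else 0) + (if k = 1 then 1 else 0)) =
      (if k = i then s' else 0) + (if k = j then t' else 0)"
    proof (cases k)
      case 0
      then show ?thesis using ij assms by (simp add: c_def P_def)
    next
      case (Suc l)
      have "(if x \<le> l then y else 0) = (if x \<le> Suc l then y else 0) - (if Suc l = x then y else (0::int))" for x y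
        by simp
      then have Pl: "P l = P (Suc l) - ((if Suc l = i then s' else 0) + (if Suc l = j then t' else 0))"
        unfolding P_def by simp
      have Pm: "P (Suc l) = - (2 * q)" if "Suc l = m" using ij that q by (simp add: P_def)
      consider "Suc l < m" | "Suc l = m" | "Suc l > m" by linarith
      then show ?thesis
      proof cases
        case 1
        then show ?thesis unfolding Suc using assms by (simp add: c_def Pl)
      next
        case 2
        then have "c l = P l + 2 * q" using assms by (auto simp: c_def)
        then show ?thesis unfolding Suc using 2 assms Pl Pm by auto
      next
        case 3
        then show ?thesis unfolding Suc using ij assms by auto
      qed
    qed
    then have "real_of_int ((if k < m then c k else 0) - (if 0 < k \<and> k \<le> m then c (k - 1) else 0) -
        c m * ((if k = 0 then 1 else 0) + (if k = 1 then 1 else 0))) = v k"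
      by (simp add: v s'(1) t'(1) ee_def)
    then show ?thesis unfolding sum_base_D ee_def
      by (simp only: of_int_diff of_int_mult of_int_add if_distrib[of real_of_int] of_int_0 of_int_1)
  qed
  moreover have "(\<Sum>k<Suc m. (v k)\<^sup>2) = 2"
    unfolding v using norm_two_ee[of i j "Suc m" s t] ij st by auto
  ultimately show "v \<in> ?S" by blast
next
  fix v assume "v \<in> ?S"
  then obtain c :: "nat \<Rightarrow> int" where c: "v = (\<lambda>k. \<Sum>i<Suc m. real_of_int (c i) * base_D (Suc m) i k)"
      "(\<Sum>k<Suc m. (v k)\<^sup>2) = 2" by blast
  define f where "f k = (if k < m then c k else 0) - (if 0 < k \<and> k \<le> m then c (k - 1) else 0) -
      c m * ((if k = 0 then 1 else 0) + (if k = 1 then 1 else 0))" for k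
  have "v k = real_of_int (f k)" for k unfolding c(1) sum_base_D f_def by (simp add: ee_def)
  moreover have "f k = 0" if "k \<ge> Suc m" for k using that assms by (simp add: f_def)
  ultimately obtain i j where ij: "i < j" "j < Suc m" "f i \<in> {1, -1}" "f j \<in> {1, -1}"
      and v: "v = (\<lambda>k. of_int (f i) * ee i k + of_int (f j) * ee j k)"
    using c(2) by (rule int_vector_norm_2) (assumption, rule that)
  have "real_of_int (f i) \<in> {1, -1}" "real_of_int (f j) \<in> {1, -1}" using ij(3,4) by auto
  then show "v \<in> std_D (Suc m)" using ij(1,2) v unfolding std_D_def by blast
qed

lemma root_model_D_Suc:
  assumes "m \<ge> 3"
  shows "root_model (Suc m) (Suc m) (base_D (Suc m)) (gram_branch m 1) (wt_D (Suc m)) (std_D (Suc m))"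
  unfolding root_model_def
proof (intro conjI allI impI)
  show "c i = 0" if c: "\<forall>k<Suc m. (\<Sum>i<Suc m. c i * base_D (Suc m) i k) = 0" and i: "i < Suc m" for c i
  proof -
    have e: "(if k < m then c k else 0) - (if 0 < k then c (k - 1) else 0) - c m * (ee 0 k + ee 1 k) = 0"
      if "k < Suc m" for k
      using c[rule_format, of k] that unfolding sum_base_D by (simp split: if_splits)
    \<comment> \<open>The system is solved from the top: coordinate m gives this, the coordinates 2
      to m - 1 make c constant on 1 to m - 1, and the coordinates 0 and 1 settle \<open>c 0\<close>
      and \<open>c m\<close>.\<close>
    have last: "c (m - 1) = 0" using e[of m] assms by (simp add: ee_def)
    have const: "c l = c 1" if "1 \<le> l" "l < m" for l
      using that
    proof (induction l rule: dec_induct)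
      case (step l)
      then show ?case using e[of "Suc l"] by (simp add: ee_def)
    qed simp
    have "c 1 = 0" using const[of "m - 1"] last assms by simp
    moreover have "c 0 = c m" "c 1 - c 0 = c m" using e[of 0] e[of 1] assms by (auto simp: ee_def)
    ultimately have "c 0 = 0" "c m = 0" by auto
    with const[of i] \<open>c 1 = 0\<close> i show ?thesis by (cases "i = 0"; cases "i = m") auto
  qed
  show "(\<Sum>k<Suc m. (\<Sum>i<Suc m. real (wt_D (Suc m) i) * base_D (Suc m) i k)\<^sup>2) = 2"
  proof -
    have "(\<Sum>i<Suc m. real (wt_D (Suc m) i) * base_D (Suc m) i k) = -1 * ee (m - 1) k + -1 * ee m k"
      if k: "k < Suc m" for k
    proof -
      consider "k = 0" | "k = 1" | "2 \<le> k" "k < m - 1" | "k = m - 1" | "k = m"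
        using k assms by linarith
      then show ?thesis
        unfolding sum_base_D using assms by cases (auto simp: wt_D_def ee_def)
    qed
    then have "(\<Sum>k<Suc m. (\<Sum>i<Suc m. real (wt_D (Suc m) i) * base_D (Suc m) i k)\<^sup>2) =
        (\<Sum>k<Suc m. (-1 * ee (m - 1) k + -1 * ee m k)\<^sup>2)"
      by (intro sum.cong refl) (simp del: sum.lessThan_Suc)
    then show ?thesis using norm_two_ee[of "m - 1" m "Suc m" "-1" "-1"] assms by (simp del: sum.lessThan_Suc)
  qed
  show "(\<Sum>k<Suc m. base_D (Suc m) i k * base_D (Suc m) j k) = gram_branch m 1 i j" if "i < Suc m" "j < Suc m" for i j
    using base_D_inner[of m i j] assms that by simp
  show "std_D (Suc m) = {v. (\<exists>c. v = (\<lambda>k. \<Sum>i<Suc m. real_of_int (c i) * base_D (Suc m) i k)) \<and> (\<Sum>k<Suc m. (v k)\<^sup>2) = 2}"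
    by (rule std_D_lattice[OF assms])
qed (use assms in \<open>auto simp: base_D_def base_A_def ee_def wt_D_def\<close>)

lemma root_model_D:
  assumes "n \<ge> 4"
  shows "root_model n n (base_D n) (gram_branch (n - 1) 1) (wt_D n) (std_D n)"
  using root_model_D_Suc[of "n - 1"] assms by simp

section \<open>Models of the exceptional root systems\<close>

lemma sum_less_8: "(\<Sum>i<8. f i) = f 0 + f 1 + f 2 + f 3 + f 4 + f 5 + f 6 + f (7::nat)"
  by (simp add: numeral_eq_Suc)
lemma sum_less_7: "(\<Sum>i<7. f i) = f 0 + f 1 + f 2 + f 3 + f 4 + f 5 + f (6::nat)"
  by (simp add: numeral_eq_Suc)
lemma sum_less_6: "(\<Sum>i<6. f i) = f 0 + f 1 + f 2 + f 3 + f 4 + f (5::nat)"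
  by (simp add: numeral_eq_Suc)

lemma all_less_8: "(\<forall>k<8. P k) \<longleftrightarrow> P 0 \<and> P 1 \<and> P 2 \<and> P 3 \<and> P 4 \<and> P 5 \<and> P 6 \<and> P (7::nat)"
  by (auto simp: numeral_eq_Suc All_less_Suc)
lemma all_less_7: "(\<forall>k<7. P k) \<longleftrightarrow> P 0 \<and> P 1 \<and> P 2 \<and> P 3 \<and> P 4 \<and> P 5 \<and> P (6::nat)"
  by (auto simp: numeral_eq_Suc All_less_Suc)
lemma all_less_6: "(\<forall>k<6. P k) \<longleftrightarrow> P 0 \<and> P 1 \<and> P 2 \<and> P 3 \<and> P 4 \<and> P (5::nat)"
  by (auto simp: numeral_eq_Suc All_less_Suc)

text \<open>Bourbaki's simple roots of \<open>E\<^sub>m\<close> in the order \<open>1, 3, 4, \<dots>, m, 2\<close>.\<close>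
definition base_E :: "nat \<Rightarrow> nat \<Rightarrow> nat \<Rightarrow> real" where
  "base_E m i k = (if i = m - 1 then ee 0 k + ee 1 k
     else if i = 0 then if k = 0 \<or> k = 7 then 1/2 else if k < 7 then -1/2 else 0
     else ee i k - ee (i - 1) k)"

lemma sum_base_E8:
  "(\<Sum>i<8. c i * base_E 8 i 0) = c 0 / 2 - c 1 + c 7"
  "(\<Sum>i<8. c i * base_E 8 i 1) = - c 0 / 2 + c 1 - c 2 + c 7"
  "(\<Sum>i<8. c i * base_E 8 i 2) = - c 0 / 2 + c 2 - c 3"
  "(\<Sum>i<8. c i * base_E 8 i 3) = - c 0 / 2 + c 3 - c 4"
  "(\<Sum>i<8. c i * base_E 8 i 4) = - c 0 / 2 + c 4 - c 5"
  "(\<Sum>i<8. c i * base_E 8 i 5) = - c 0 / 2 + c 5 - c 6"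
  "(\<Sum>i<8. c i * base_E 8 i 6) = - c 0 / 2 + c 6"
  "(\<Sum>i<8. c i * base_E 8 i 7) = c 0 / 2"
  "k \<ge> 8 \<Longrightarrow> (\<Sum>i<8. c i * base_E 8 i k) = 0"
  by (simp_all add: sum_less_8 base_E_def ee_def)

text \<open>E_7 is E_8 without the end 6 of its path, and its branch vertex 6 is vertex 7 there.
  Likewise E_6 lacks the vertices 5 and 6, so all three types share the computations for
  E_8.\<close>

lemma sum_base_E7:
  "(\<Sum>i<7. c i * base_E 7 i k) = (\<Sum>i<8. (c(6 := 0, 7 := c 6)) i * base_E 8 i k)"
  by (simp add: sum_less_8 sum_less_7 base_E_def)

lemma sum_base_E6:
  "(\<Sum>i<6. c i * base_E 6 i k) = (\<Sum>i<8. (c(5 := 0, 6 := 0, 7 := c 5)) i * base_E 8 i k)"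
  by (simp add: sum_less_8 sum_less_6 base_E_def)

lemma base_E8_indep:
  assumes "\<forall>k<8. (\<Sum>i<8. c i * base_E 8 i k) = 0" shows "\<forall>i<8. c i = 0"
proof -
  have "c 0 / 2 - c 1 + c 7 = 0" "- c 0 / 2 + c 1 - c 2 + c 7 = 0" "- c 0 / 2 + c 2 - c 3 = 0"
    "- c 0 / 2 + c 3 - c 4 = 0" "- c 0 / 2 + c 4 - c 5 = 0" "- c 0 / 2 + c 5 - c 6 = 0"
    "- c 0 / 2 + c 6 = 0" "c 0 / 2 = 0"
    using assms unfolding all_less_8 sum_base_E8 by simp_all
  then show ?thesis unfolding all_less_8 by simp
qed

text \<open>The usual description of the E_8 lattice: coordinates all integral
  (\<open>e = 0\<close>) or all half-integral (\<open>e = 1\<close>), with even sum. It makes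
  membership linear in the integers \<open>f\<close>, \<open>e\<close>, \<open>z\<close>.\<close>

lemma std_E8_iff:
  fixes v :: "nat \<Rightarrow> real"
  shows "v \<in> std_E8 \<longleftrightarrow> (\<forall>k\<ge>8. v k = 0) \<and> (\<Sum>k<8. (v k)\<^sup>2) = 2 \<and>
     (\<exists>f e z. e \<in> {0, 1} \<and> (\<forall>k<8. v k = real_of_int e / 2 + real_of_int (f k)) \<and> 4 * e + (\<Sum>k<8. f k) = 2 * z)"
proof
  assume "v \<in> std_E8"
  then consider "v \<in> std_D 8" | "\<forall>k<8. v k = 1/2 \<or> v k = -1/2" "\<forall>k\<ge>8. v k = 0" "even (card {k. k < 8 \<and> v k < 0})"
    by (auto simp: std_E8_def)
  then show "(\<forall>k\<ge>8. v k = 0) \<and> (\<Sum>k<8. (v k)\<^sup>2) = 2 \<and>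
     (\<exists>f e z. e \<in> {0, 1} \<and> (\<forall>k<8. v k = real_of_int e / 2 + real_of_int (f k)) \<and> 4 * e + (\<Sum>k<8. f k) = 2 * z)"
  proof cases
    case 1
    then obtain i j s t where v: "v = (\<lambda>k. s * ee i k + t * ee j k)" and ij: "i < j" "j < 8"
        and st: "s \<in> {1, -1}" "t \<in> {1, -1}"
      unfolding std_D_def by blast
    obtain s' where s': "s = of_int s'" "s' = 1 \<or> s' = -1" using st(1) that[of 1] that[of "-1"] by auto
    obtain t' where t': "t = of_int t'" "t' = 1 \<or> t' = -1" using st(2) that[of 1] that[of "-1"] by auto
    define f where "f k = (if k = i then s' else 0) + (if k = j then t' else 0)" for k
    have "v k = real_of_int 0 / 2 + real_of_int (f k)" for k by (simp add: v f_def s' t' ee_def)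
    moreover have "(\<Sum>k<8. f k) = s' + t'" using ij by (simp add: f_def sum.distrib)
    then have "4 * 0 + (\<Sum>k<8. f k) = 2 * ((s' + t') div 2)" using s' t' by auto
    moreover have "(\<Sum>k<8. (v k)\<^sup>2) = 2" unfolding v using norm_two_ee[of i j 8 s t] ij st by auto
    moreover have "\<forall>k\<ge>8. v k = 0" using ij by (auto simp: v ee_def)
    ultimately show ?thesis by (intro conjI exI[of _ f] exI[of _ 0] exI[of _ "(s' + t') div 2"]) blast+
  next
    case 2
    define f :: "nat \<Rightarrow> int" where "f k = (if v k < 0 then -1 else 0)" for k
    have "v k = 1 / 2 + real_of_int (f k)" if "k < 8" for k using 2(1) that by (auto simp: f_def)
    moreover have "(\<Sum>k<8. f k) = - int (card {k. k < 8 \<and> v k < 0})"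
    proof -
      have "(\<Sum>k<8. f k) = (\<Sum>k\<in>{k. k < 8 \<and> v k < 0}. f k)"
        by (rule sum.mono_neutral_right) (auto simp: f_def)
      then show ?thesis by (simp add: f_def)
    qed
    moreover obtain z where "card {k. k < 8 \<and> v k < 0} = 2 * z" using 2(3) by blast
    ultimately have "4 * 1 + (\<Sum>k<8. f k) = 2 * (2 - int z)" "\<And>k. k < 8 \<Longrightarrow> v k = 1 / 2 + real_of_int (f k)" by auto
    moreover have "(v k)\<^sup>2 = 1 / 4" if "k < 8" for k
    proof -
      have "v k = 1/2 \<or> v k = -1/2" using 2(1) that by blast
      then show ?thesis by (elim disjE ssubst) (simp_all add: power2_eq_square)
    qed
    then have "(\<Sum>k<8. (v k)\<^sup>2) = (\<Sum>k<8::nat. 1 / 4)" by (intro sum.cong refl) simp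
    then have "(\<Sum>k<8. (v k)\<^sup>2) = 2" by simp
    ultimately show ?thesis using 2(2)
      by (intro conjI exI[of _ f] exI[of _ 1] exI[of _ "2 - int z"]) auto
  qed
next
  assume "(\<forall>k\<ge>8. v k = 0) \<and> (\<Sum>k<8. (v k)\<^sup>2) = 2 \<and>
     (\<exists>f e z. e \<in> {0, 1} \<and> (\<forall>k<8. v k = real_of_int e / 2 + real_of_int (f k)) \<and> 4 * e + (\<Sum>k<8. f k) = 2 * z)"
  then obtain f :: "nat \<Rightarrow> int" and e z :: int where v: "\<forall>k\<ge>8. v k = 0" "(\<Sum>k<8. (v k)\<^sup>2) = 2"
      "e \<in> {0, 1}" "\<forall>k<8. v k = real_of_int e / 2 + real_of_int (f k)" "4 * e + (\<Sum>k<8. f k) = 2 * z" by blast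
  from v(3) consider "e = 0" | "e = 1" by auto
  then show "v \<in> std_E8"
  proof cases
    case 1
    define g where "g k = (if k < 8 then f k else 0)" for k
    have "v k = real_of_int (g k)" for k using v(1,4) 1 by (simp add: g_def)
    moreover have "g k = 0" if "k \<ge> 8" for k using that by (simp add: g_def)
    ultimately obtain i j where ij: "i < j" "j < 8" "g i \<in> {1, -1}" "g j \<in> {1, -1}"
        and vg: "v = (\<lambda>k. of_int (g i) * ee i k + of_int (g j) * ee j k)"
      using v(2) by (rule int_vector_norm_2) (assumption, rule that)
    have "real_of_int (g i) \<in> {1, -1}" "real_of_int (g j) \<in> {1, -1}" using ij(3,4) by auto
    then have "v \<in> std_D 8" using ij(1,2) vg unfolding std_D_def by blast
    then show ?thesis by (simp add: std_E8_def)
  next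
    case 2
    \<comment> \<open>Eight half-integers have squares of at least 1/4 each; the total 2 forces
      equality everywhere.\<close>
    have ge: "(v k)\<^sup>2 \<ge> 1 / 4" if "k < 8" for k
    proof -
      have "v k = 1 / 2 + real_of_int (f k)" using v(4) 2 that by simp
      then have "(v k)\<^sup>2 = 1 / 4 + real_of_int (f k * (f k + 1))"
        by (simp add: power2_eq_square algebra_simps)
      moreover have "f k * (f k + 1) \<ge> 0" by (cases "f k \<ge> 0") (auto intro: mult_nonpos_nonpos)
      then have "real_of_int (f k * (f k + 1)) \<ge> 0" by (simp only: of_int_0_le_iff)
      ultimately show ?thesis by linarith
    qed
    have "(\<Sum>k<8. (v k)\<^sup>2 - 1 / 4) = 0" using v(2) by (simp add: sum_subtractf)
    then have eq: "(v k)\<^sup>2 - 1 / 4 = 0" if "k < 8" for k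
      using ge that by (subst (asm) sum_nonneg_eq_0_iff) auto
    have half: "v k = 1 / 2 \<or> v k = -1 / 2" if "k < 8" for k
    proof -
      have "(v k - 1 / 2) * (v k + 1 / 2) = 0"
        using eq[OF that] by (simp add: power2_eq_square algebra_simps)
      then show ?thesis by auto
    qed
    have "f k = (if v k < 0 then -1 else 0)" if "k < 8" for k
      using v(4) 2 that half[OF that] by auto
    then have "(\<Sum>k<8. f k) = (\<Sum>k<8. if v k < 0 then -1 else 0)" by (intro sum.cong) auto
    also have "\<dots> = (\<Sum>k\<in>{k. k < 8 \<and> v k < 0}. -1)"
      by (rule sum.mono_neutral_cong_right) auto
    finally have "(\<Sum>k<8. f k) = - int (card {k. k < 8 \<and> v k < 0})" by simp
    then have "int (card {k. k < 8 \<and> v k < 0}) = 2 * (2 - z)" using v(5) 2 by simp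
    then have "even (card {k. k < 8 \<and> v k < 0})" by (metis dvd_triv_left even_of_nat)
    then show ?thesis using half v(1) by (simp add: std_E8_def)
  qed
qed

text \<open>The two extra equations turn the orthogonality conditions defining E_7 and E_6 into the
  vanishing of the coefficients of the omitted vertices 6 and 5.\<close>

lemma std_E8_coeffs:
  assumes "v \<in> std_E8"
  obtains c where "v = (\<lambda>k. \<Sum>i<8. real_of_int (c i) * base_E 8 i k)"
    "real_of_int (c 6) = v 6 + v 7" "real_of_int (c 5) = v 5 + v 6 + 2 * v 7"
proof -
  obtain f :: "nat \<Rightarrow> int" and e z :: int where supp: "\<forall>k\<ge>8. v k = 0"
    and v: "\<forall>k<8. v k = real_of_int e / 2 + real_of_int (f k)" and z: "4 * e + (\<Sum>k<8. f k) = 2 * z"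
    using assms unfolding std_E8_iff by blast
  \<comment> \<open>Solution of the system \<open>sum_base_E8\<close>: the coordinates 7 down to 2
    determine all but \<open>c 1\<close> and \<open>c 7\<close>. The remaining division by 2 is
    supplied by \<open>z\<close>, half the coordinate sum.\<close>
  define c where "c i = [e + 2 * f 7, z + e + 3 * f 7 - f 0, 5 * e + f 2 + f 3 + f 4 + f 5 + f 6 + 5 * f 7,
     4 * e + f 3 + f 4 + f 5 + f 6 + 4 * f 7, 3 * e + f 4 + f 5 + f 6 + 3 * f 7,
     2 * e + f 5 + f 6 + 2 * f 7, e + f 6 + f 7, z + e + 2 * f 7] ! i" for i
  have c: "c 0 = e + 2 * f 7" "c 1 = z + e + 3 * f 7 - f 0" "c 2 = 5 * e + f 2 + f 3 + f 4 + f 5 + f 6 + 5 * f 7"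
    "c 3 = 4 * e + f 3 + f 4 + f 5 + f 6 + 4 * f 7" "c 4 = 3 * e + f 4 + f 5 + f 6 + 3 * f 7"
    "c 5 = 2 * e + f 5 + f 6 + 2 * f 7" "c 6 = e + f 6 + f 7" "c 7 = z + e + 2 * f 7"
    by (simp_all add: c_def)
  have z': "2 * real_of_int z = real_of_int (4 * e + f 0 + f 1 + f 2 + f 3 + f 4 + f 5 + f 6 + f 7)"
    using arg_cong[OF z, of real_of_int] by (simp add: sum_less_8)
  have "v k = (\<Sum>i<8. real_of_int (c i) * base_E 8 i k)" for k
  proof (cases "k < 8")
    case True
    have "\<forall>k<8. v k = (\<Sum>i<8. real_of_int (c i) * base_E 8 i k)"
      using v z' unfolding all_less_8 sum_base_E8 c by (simp add: field_simps)
    with True show ?thesis by blast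
  next
    case False
    then show ?thesis using supp sum_base_E8(9)[of k] by simp
  qed
  moreover have "real_of_int (c 6) = v 6 + v 7" "real_of_int (c 5) = v 5 + v 6 + 2 * v 7"
    using v unfolding all_less_8 c by (simp_all add: field_simps)
  ultimately show ?thesis using that[of c] by blast
qed

lemma base_E8_comb_in_std:
  fixes c :: "nat \<Rightarrow> int"
  assumes v: "v = (\<lambda>k. \<Sum>i<8. real_of_int (c i) * base_E 8 i k)" and norm: "(\<Sum>k<8. (v k)\<^sup>2) = 2"
  shows "v \<in> std_E8"
proof -
  \<comment> \<open>Only base vector 0 has half-integral coordinates, so the parity of
    \<open>c 0\<close> decides between the two classes.\<close>
  define e where "e = c 0 mod 2"
  define d where "d = c 0 div 2"
  have c0: "c 0 = 2 * d + e" by (simp add: e_def d_def)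
  have e: "e \<in> {0, 1}" unfolding e_def by auto
  define f where "f i = [d - c 1 + c 7, - d - e + c 1 - c 2 + c 7, - d - e + c 2 - c 3, - d - e + c 3 - c 4,
     - d - e + c 4 - c 5, - d - e + c 5 - c 6, - d - e + c 6, d] ! i" for i
  have f: "f 0 = d - c 1 + c 7" "f 1 = - d - e + c 1 - c 2 + c 7" "f 2 = - d - e + c 2 - c 3"
    "f 3 = - d - e + c 3 - c 4" "f 4 = - d - e + c 4 - c 5" "f 5 = - d - e + c 5 - c 6"
    "f 6 = - d - e + c 6" "f 7 = d"
    by (simp_all add: f_def)
  have "\<forall>k<8. v k = real_of_int e / 2 + real_of_int (f k)"
    unfolding all_less_8 v sum_base_E8 c0 f by (simp add: field_simps)
  moreover have "4 * e + (\<Sum>k<8. f k) = 2 * (c 7 - e - 2 * d)"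
    unfolding sum_less_8 f by simp
  moreover have "\<forall>k\<ge>8. v k = 0" using sum_base_E8(9) by (simp add: v)
  ultimately show ?thesis unfolding std_E8_iff using e norm by blast
qed

lemma ip16_ee: "a < 16 \<Longrightarrow> b < 16 \<Longrightarrow> ip16 v (\<lambda>k. ee a k + ee b k) = v a + v b"
    "a < 16 \<Longrightarrow> b < 16 \<Longrightarrow> ip16 v (\<lambda>k. ee a k - ee b k) = v a - v b"
  using sum_ee'[of a v 16] sum_ee'[of b v 16]
  by (simp_all add: ip16_def distrib_left right_diff_distrib sum.distrib sum_subtractf mult.commute)

lemma std_E7_iff: "v \<in> std_E7 \<longleftrightarrow> v \<in> std_E8 \<and> v 6 + v 7 = 0"
  by (simp add: std_E7_def ip16_ee)

lemma std_E6_iff: "v \<in> std_E6 \<longleftrightarrow> v \<in> std_E8 \<and> v 6 + v 7 = 0 \<and> v 5 = v 6"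
  by (simp add: std_E6_def std_E7_iff ip16_ee)

lemma root_model_E8: "root_model 8 8 (base_E 8) (gram_branch 7 2) wt_E8 std_E8"
  unfolding root_model_def
proof (intro conjI)
  show "\<forall>c. (\<forall>k<8. (\<Sum>i<8. c i * base_E 8 i k) = 0) \<longrightarrow> (\<forall>i<8. c i = 0)"
    using base_E8_indep by blast
  show "\<forall>i<8. \<forall>j<8. (\<Sum>k<8. base_E 8 i k * base_E 8 j k) = gram_branch 7 2 i j"
    by (simp add: all_less_8 sum_less_8 base_E_def ee_def gram_branch_def gram_path_def)
  show "(\<Sum>k<8. (\<Sum>i<8. real (wt_E8 i) * base_E 8 i k)\<^sup>2) = 2"
    unfolding sum_less_8[of "\<lambda>k. (_ k)\<^sup>2"] sum_base_E8 by (simp add: wt_E8_def power2_eq_square)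
  show "std_E8 = {v. (\<exists>c. v = (\<lambda>k. \<Sum>i<8. real_of_int (c i) * base_E 8 i k)) \<and> (\<Sum>k<8. (v k)\<^sup>2) = 2}"
    (is "_ = ?S")
  proof (intro equalityI subsetI)
    fix v assume v: "v \<in> std_E8"
    then have "(\<Sum>k<8. (v k)\<^sup>2) = 2" unfolding std_E8_iff by blast
    with std_E8_coeffs[OF v] show "v \<in> ?S" by blast
  next
    fix v assume "v \<in> ?S"
    then show "v \<in> std_E8" using base_E8_comb_in_std by blast
  qed
qed (auto simp: base_E_def ee_def all_less_8 wt_E8_def)

lemma root_model_E7: "root_model 7 8 (base_E 7) (gram_branch 6 2) wt_E7 std_E7"
  unfolding root_model_def
proof (intro conjI)
  show "\<forall>c. (\<forall>k<8. (\<Sum>i<7. c i * base_E 7 i k) = 0) \<longrightarrow> (\<forall>i<7. c i = 0)"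
  proof (intro allI impI)
    fix c :: "nat \<Rightarrow> real" and i :: nat
    assume "\<forall>k<8. (\<Sum>i<7. c i * base_E 7 i k) = 0" "i < 7"
    then have "\<forall>i<8. (c(6 := 0, 7 := c 6)) i = 0"
      unfolding sum_base_E7 using base_E8_indep by blast
    then have "\<forall>i<7. c i = 0" unfolding all_less_8 all_less_7 by simp
    then show "c i = 0" using \<open>i < 7\<close> by blast
  qed
  show "\<forall>i<7. \<forall>j<7. (\<Sum>k<8. base_E 7 i k * base_E 7 j k) = gram_branch 6 2 i j"
    by (simp add: all_less_7 sum_less_8 base_E_def ee_def gram_branch_def gram_path_def)
  show "(\<Sum>k<8. (\<Sum>i<7. real (wt_E7 i) * base_E 7 i k)\<^sup>2) = 2"
    unfolding sum_base_E7 sum_less_8[of "\<lambda>k. (_ k)\<^sup>2"] sum_base_E8 by (simp add: wt_E7_def power2_eq_square)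
  show "std_E7 = {v. (\<exists>c. v = (\<lambda>k. \<Sum>i<7. real_of_int (c i) * base_E 7 i k)) \<and> (\<Sum>k<8. (v k)\<^sup>2) = 2}"
    (is "_ = ?S")
  proof (intro equalityI subsetI)
    fix v assume "v \<in> std_E7"
    then have v: "v \<in> std_E8" "v 6 + v 7 = 0" by (simp_all add: std_E7_iff)
    obtain c where c: "v = (\<lambda>k. \<Sum>i<8. real_of_int (c i) * base_E 8 i k)" "real_of_int (c 6) = v 6 + v 7"
      using std_E8_coeffs[OF v(1)] by blast
    then have "c 6 = 0" using v(2) by simp
    then have "v = (\<lambda>k. \<Sum>i<7. real_of_int ((c(6 := c 7)) i) * base_E 7 i k)"
      by (simp add: c(1) sum_less_8 sum_less_7 base_E_def)
    moreover have "(\<Sum>k<8. (v k)\<^sup>2) = 2" using v(1) unfolding std_E8_iff by blast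
    ultimately show "v \<in> ?S" by blast
  next
    fix v assume "v \<in> ?S"
    then obtain c where c: "v = (\<lambda>k. \<Sum>i<7. real_of_int (c i) * base_E 7 i k)" "(\<Sum>k<8. (v k)\<^sup>2) = 2" by blast
    have v: "v = (\<lambda>k. \<Sum>i<8. real_of_int ((c(6 := 0, 7 := c 6)) i) * base_E 8 i k)"
      by (simp add: c(1) sum_less_8 sum_less_7 base_E_def)
    have "v 6 + v 7 = 0" unfolding v sum_base_E8 by simp
    with base_E8_comb_in_std[OF v c(2)] show "v \<in> std_E7" by (simp add: std_E7_iff)
  qed
qed (auto simp: base_E_def ee_def all_less_7 wt_E7_def)

lemma root_model_E6: "root_model 6 8 (base_E 6) (gram_branch 5 2) wt_E6 std_E6"
  unfolding root_model_def
proof (intro conjI)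
  show "\<forall>c. (\<forall>k<8. (\<Sum>i<6. c i * base_E 6 i k) = 0) \<longrightarrow> (\<forall>i<6. c i = 0)"
  proof (intro allI impI)
    fix c :: "nat \<Rightarrow> real" and i :: nat
    assume "\<forall>k<8. (\<Sum>i<6. c i * base_E 6 i k) = 0" "i < 6"
    then have "\<forall>i<8. (c(5 := 0, 6 := 0, 7 := c 5)) i = 0"
      unfolding sum_base_E6 using base_E8_indep by blast
    then have "\<forall>i<6. c i = 0" unfolding all_less_8 all_less_6 by simp
    then show "c i = 0" using \<open>i < 6\<close> by blast
  qed
  show "\<forall>i<6. \<forall>j<6. (\<Sum>k<8. base_E 6 i k * base_E 6 j k) = gram_branch 5 2 i j"
    by (simp add: all_less_6 sum_less_8 base_E_def ee_def gram_branch_def gram_path_def)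
  show "(\<Sum>k<8. (\<Sum>i<6. real (wt_E6 i) * base_E 6 i k)\<^sup>2) = 2"
    unfolding sum_base_E6 sum_less_8[of "\<lambda>k. (_ k)\<^sup>2"] sum_base_E8 by (simp add: wt_E6_def power2_eq_square)
  show "std_E6 = {v. (\<exists>c. v = (\<lambda>k. \<Sum>i<6. real_of_int (c i) * base_E 6 i k)) \<and> (\<Sum>k<8. (v k)\<^sup>2) = 2}"
    (is "_ = ?S")
  proof (intro equalityI subsetI)
    fix v assume "v \<in> std_E6"
    then have v: "v \<in> std_E8" "v 6 + v 7 = 0" "v 5 = v 6" by (simp_all add: std_E6_iff)
    obtain c where c: "v = (\<lambda>k. \<Sum>i<8. real_of_int (c i) * base_E 8 i k)" "real_of_int (c 6) = v 6 + v 7"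
        "real_of_int (c 5) = v 5 + v 6 + 2 * v 7"
      using std_E8_coeffs[OF v(1)] by blast
    then have "c 6 = 0" "c 5 = 0" using v(2,3) by simp_all
    then have "v = (\<lambda>k. \<Sum>i<6. real_of_int ((c(5 := c 7)) i) * base_E 6 i k)"
      by (simp add: c(1) sum_less_8 sum_less_6 base_E_def)
    moreover have "(\<Sum>k<8. (v k)\<^sup>2) = 2" using v(1) unfolding std_E8_iff by blast
    ultimately show "v \<in> ?S" by blast
  next
    fix v assume "v \<in> ?S"
    then obtain c where c: "v = (\<lambda>k. \<Sum>i<6. real_of_int (c i) * base_E 6 i k)" "(\<Sum>k<8. (v k)\<^sup>2) = 2" by blast
    have v: "v = (\<lambda>k. \<Sum>i<8. real_of_int ((c(5 := 0, 6 := 0, 7 := c 5)) i) * base_E 8 i k)"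
      by (simp add: c(1) sum_less_8 sum_less_6 base_E_def)
    have "v 6 + v 7 = 0" "v 5 = v 6" unfolding v sum_base_E8 by simp_all
    with base_E8_comb_in_std[OF v c(2)] show "v \<in> std_E6" by (simp add: std_E6_iff)
  qed
qed (auto simp: base_E_def ee_def all_less_6 wt_E6_def)

section \<open>Cardinalities\<close>

lemma card_std_A: "card (std_A m) = m * (m + 1)"
proof -
  have "std_A m = (\<lambda>(i, j) k. ee i k - ee j k) ` ({..m} \<times> {..m} - (\<lambda>i. (i, i)) ` {..m})"
    by (auto simp: std_A_def image_iff)
  moreover have "inj_on (\<lambda>(i, j) k. ee i k - ee j k) ({..m} \<times> {..m} - (\<lambda>i. (i, i)) ` {..m})"
  proof (rule inj_onI, clarify)
    fix i j i' j' assume a: "(i, j) \<notin> (\<lambda>i. (i, i)) ` {..m}" "(i', j') \<notin> (\<lambda>i. (i, i)) ` {..m}"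
      "i \<le> m" "j \<le> m" "i' \<le> m" "j' \<le> m" and e: "(\<lambda>k. ee i k - ee j k) = (\<lambda>k. ee i' k - ee j' k)"
    have "i \<noteq> j" "i' \<noteq> j'" using a by auto
    then show "i = i' \<and> j = j'"
      using fun_cong[OF e, of i] fun_cong[OF e, of j] by (auto simp: ee_def split: if_splits)
  qed
  ultimately have "card (std_A m) = card ({..m} \<times> {..m} - (\<lambda>i. (i, i)) ` {..m})" by (simp add: card_image)
  also have "\<dots> = Suc m * Suc m - Suc m"
    by (subst card_Diff_subset) (auto simp: card_image inj_on_def)
  finally show ?thesis by simp
qed

text \<open>\<open>D_vec\<close> and \<open>half_vec\<close> parametrize the roots of \<open>D\<^sub>n\<close> and the half-integral roots of \<open>E\<^sub>8\<close> by
  data on which the defining conditions of \<open>E\<^sub>6\<close> and \<open>E\<^sub>7\<close> can be counted by evaluation.\<close>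
definition D_coord :: "nat \<times> nat \<times> bool \<times> bool \<Rightarrow> nat \<Rightarrow> int" where
  "D_coord = (\<lambda>(j, i, s, t) k. (if k = i then if s then 1 else -1 else 0) + (if k = j then if t then 1 else -1 else 0))"

definition D_vec :: "nat \<times> nat \<times> bool \<times> bool \<Rightarrow> nat \<Rightarrow> real" where
  "D_vec p k = real_of_int (D_coord p k)"

definition D_index :: "nat \<Rightarrow> (nat \<times> nat \<times> bool \<times> bool) set" where
  "D_index n = (SIGMA j:{..<n}. {..<j} \<times> UNIV)"

lemma std_D_eq_image: "std_D n = D_vec ` D_index n"
proof (intro equalityI subsetI)
  fix v assume "v \<in> std_D n"
  then obtain i j s t where v: "v = (\<lambda>k. s * ee i k + t * ee j k)" and ij: "i < j" "j < n"
      and st: "s \<in> {1, -1}" "t \<in> {1, -1}"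
    unfolding std_D_def by blast
  have "v = D_vec (j, i, s = 1, t = 1)"
    using st by (auto simp: v D_vec_def D_coord_def ee_def fun_eq_iff)
  then show "v \<in> D_vec ` D_index n" using ij by (auto simp: D_index_def)
next
  fix v assume "v \<in> D_vec ` D_index n"
  then obtain j i s t where v: "v = D_vec (j, i, s, t)" and ij: "i < j" "j < n" by (auto simp: D_index_def)
  have "v = (\<lambda>k. (if s then 1 else -1) * ee i k + (if t then 1 else -1) * ee j k)"
    by (auto simp: v D_vec_def D_coord_def ee_def fun_eq_iff)
  then show "v \<in> std_D n" using ij unfolding std_D_def
    by (intro CollectI exI[of _ i] exI[of _ j] exI[of _ "if s then 1 else -1"] exI[of _ "if t then 1 else -1"]) auto
qed

lemma inj_on_D_vec: "inj_on D_vec (D_index n)"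
proof (rule inj_onI)
  fix p q assume pq: "p \<in> D_index n" "q \<in> D_index n" and e: "D_vec p = D_vec q"
  obtain j i s t where p: "p = (j, i, s, t)" by (cases p) auto
  obtain j' i' s' t' where q: "q = (j', i', s', t')" by (cases q) auto
  have c: "D_coord p k = D_coord q k" for k using fun_cong[OF e, of k] by (simp add: D_vec_def)
  have "i < j" "i' < j'" using pq by (auto simp: p q D_index_def)
  then show "p = q"
    using c[of i] c[of j] c[of i'] c[of j'] unfolding p q D_coord_def by (auto split: if_splits)
qed

lemma card_std_D: "card (std_D n) = 2 * n * (n - 1)"
proof -
  have "card (std_D n) = card (D_index n)" by (simp add: std_D_eq_image card_image inj_on_D_vec)
  also have "\<dots> = (\<Sum>j<n. j * 4)"
    by (simp add: D_index_def card_cartesian_product card_UNIV_bool flip: UNIV_Times_UNIV)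
  also have "\<dots> = 2 * n * (n - 1)"
  proof (induction n)
    case (Suc n)
    then show ?case by (cases n) simp_all
  qed simp
  finally show ?thesis .
qed

definition D8_list :: "(nat \<times> nat \<times> bool \<times> bool) list" where
  "D8_list = filter (\<lambda>(j, i, _). i < j)
     (List.product [0..<8] (List.product [0..<8] (List.product [True, False] [True, False])))"

lemma D_index_8: "D_index 8 = set D8_list"
  by (auto simp: D_index_def D8_list_def)

lemma distinct_D8_list: "distinct D8_list"
  unfolding D8_list_def by (intro distinct_filter distinct_product) simp_all

definition half_vec :: "bool list \<Rightarrow> nat \<Rightarrow> real" where
  "half_vec l k = (if k < 8 then if l ! k then 1/2 else -1/2 else 0)"

definition half_index :: "bool list set" where
  "half_index = {l. length l = 8 \<and> even (length (filter Not l))}"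

lemma std_E8_eq_union: "std_E8 = D_vec ` D_index 8 \<union> half_vec ` half_index"
proof -
  have "{v. (\<forall>k<8. v k = 1/2 \<or> v k = -1/2) \<and> (\<forall>k\<ge>8. v k = 0) \<and> even (card {k. k < 8 \<and> v k < 0})} =
      half_vec ` half_index"
  proof (intro equalityI subsetI)
    fix v :: "nat \<Rightarrow> real"
    assume "v \<in> {v. (\<forall>k<8. v k = 1/2 \<or> v k = -1/2) \<and> (\<forall>k\<ge>8. v k = 0) \<and> even (card {k. k < 8 \<and> v k < 0})}"
    then have v: "\<forall>k<8. v k = 1/2 \<or> v k = -1/2" "\<forall>k\<ge>8. v k = 0" "even (card {k. k < 8 \<and> v k < 0})" by auto
    define l where "l = map (\<lambda>k. v k > 0) [0..<8]"
    have "half_vec l = v" using v(1,2) by (auto simp: half_vec_def l_def fun_eq_iff)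
    moreover have "{i. i < length l \<and> \<not> l ! i} = {k. k < 8 \<and> v k < 0}" using v(1) by (auto simp: l_def)
    then have "l \<in> half_index" using v(3) by (simp add: half_index_def length_filter_conv_card) (simp add: l_def)
    ultimately show "v \<in> half_vec ` half_index" by blast
  next
    fix v assume "v \<in> half_vec ` half_index"
    then obtain l where l: "v = half_vec l" "length l = 8" "even (length (filter Not l))" by (auto simp: half_index_def)
    have "{i. i < length l \<and> \<not> l ! i} = {k. k < 8 \<and> v k < 0}" using l(2) by (auto simp: l(1) half_vec_def)
    then have "even (card {k. k < 8 \<and> v k < 0})" using l(3) by (simp add: length_filter_conv_card)
    then show "v \<in> {v. (\<forall>k<8. v k = 1/2 \<or> v k = -1/2) \<and> (\<forall>k\<ge>8. v k = 0) \<and> even (card {k. k < 8 \<and> v k < 0})}"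
      by (simp add: l(1) half_vec_def)
  qed
  then show ?thesis by (simp only: std_E8_def std_D_eq_image)
qed

lemma inj_on_half_vec: "inj_on half_vec half_index"
proof (rule inj_onI)
  fix l l' assume a: "l \<in> half_index" "l' \<in> half_index" "half_vec l = half_vec l'"
  show "l = l'"
  proof (rule nth_equalityI)
    fix k assume "k < length l"
    then show "l ! k = l' ! k" using fun_cong[OF a(3), of k] a(1) by (auto simp: half_vec_def half_index_def split: if_splits)
  qed (use a in \<open>simp add: half_index_def\<close>)
qed

lemma half_index_list: "half_index = set (filter (\<lambda>l. even (length (filter Not l))) (List.n_lists 8 [True, False]))"
  by (auto simp: half_index_def set_n_lists)

text \<open>Moves counting from real vectors to lists that can be evaluated: \<open>A\<close> and
  \<open>B\<close> are computable forms of \<open>P\<close> on the integral and half-integral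
  roots.\<close>

lemma card_std_E8_subset:
  assumes "\<And>p. p \<in> D_index 8 \<Longrightarrow> P (D_vec p) \<longleftrightarrow> A p" "\<And>l. l \<in> half_index \<Longrightarrow> P (half_vec l) \<longleftrightarrow> B l"
  shows "card {v \<in> std_E8. P v} =
    length (filter A D8_list) +
    length (filter (\<lambda>l. even (length (filter Not l)) \<and> B l) (List.n_lists 8 [True, False]))"
proof -
  \<comment> \<open>Coordinate 0 is an integer on one side and half an odd integer on the
    other.\<close>
  have "D_vec p \<noteq> half_vec l" for p l
  proof
    assume "D_vec p = half_vec l"
    from fun_cong[OF this, of 0] have "2 * D_coord p 0 \<in> {1, -1}"
      by (auto simp: D_vec_def half_vec_def split: if_splits)
    then show False by auto presburger+
  qed
  then have "{v \<in> std_E8. P v} = D_vec ` {p \<in> D_index 8. A p} \<union> half_vec ` {l \<in> half_index. B l}"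
      "D_vec ` {p \<in> D_index 8. A p} \<inter> half_vec ` {l \<in> half_index. B l} = {}"
    using assms by (auto simp: std_E8_eq_union)
  moreover have "finite (D_index 8)" "finite half_index" by (simp_all only: D_index_8 half_index_list finite_set)
  ultimately have "card {v \<in> std_E8. P v} = card {p \<in> D_index 8. A p} + card {l \<in> half_index. B l}"
    using inj_on_subset[OF inj_on_D_vec[of 8], of "{p \<in> D_index 8. A p}"]
      inj_on_subset[OF inj_on_half_vec, of "{l \<in> half_index. B l}"]
    by (simp add: card_Un_disjoint card_image)
  also have "{p \<in> D_index 8. A p} =
      set (filter A D8_list)"
    by (simp only: D_index_8 set_filter)
  also have "card \<dots> = length (filter A D8_list)"
    by (intro distinct_card distinct_filter distinct_D8_list)
  also have "{l \<in> half_index. B l} = set (filter (\<lambda>l. even (length (filter Not l)) \<and> B l) (List.n_lists 8 [True, False]))"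
    by (auto simp: half_index_list)
  also have "card \<dots> = length (filter (\<lambda>l. even (length (filter Not l)) \<and> B l) (List.n_lists 8 [True, False]))"
    by (intro distinct_card distinct_filter distinct_n_lists) simp
  finally show ?thesis .
qed

lemma card_std_E8: "card std_E8 = 240"
proof -
  have "card {v \<in> std_E8. True} =
    length (filter (\<lambda>_. True) D8_list) +
    length (filter (\<lambda>l. even (length (filter Not l)) \<and> True) (List.n_lists 8 [True, False]))"
    by (rule card_std_E8_subset) auto
  also have "\<dots> = 240" by code_simp
  finally show ?thesis by simp
qed

lemma card_std_E7: "card std_E7 = 126"
proof -
  have "card {v \<in> std_E8. v 6 + v 7 = 0} =
    length (filter (\<lambda>p. D_coord p 6 + D_coord p 7 = 0)
      D8_list) +
    length (filter (\<lambda>l. even (length (filter Not l)) \<and> l ! 6 \<noteq> l ! 7) (List.n_lists 8 [True, False]))"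
    by (rule card_std_E8_subset) (auto simp: D_vec_def half_vec_def simp flip: of_int_add)
  also have "\<dots> = 126" by code_simp
  finally show ?thesis by (simp add: std_E7_iff[symmetric])
qed

lemma card_std_E6: "card std_E6 = 72"
proof -
  have "card {v \<in> std_E8. v 6 + v 7 = 0 \<and> v 5 = v 6} =
    length (filter (\<lambda>p. D_coord p 6 + D_coord p 7 = 0 \<and> D_coord p 5 = D_coord p 6)
      D8_list) +
    length (filter (\<lambda>l. even (length (filter Not l)) \<and> l ! 6 \<noteq> l ! 7 \<and> l ! 5 = l ! 6) (List.n_lists 8 [True, False]))"
    by (rule card_std_E8_subset) (auto simp: D_vec_def half_vec_def simp flip: of_int_add)
  also have "\<dots> = 72" by code_simp
  finally show ?thesis by (simp add: std_E6_iff[symmetric])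
qed

section \<open>The Diophantine equations\<close>

text \<open>In degree 2 the condition compares the second moment 4h with 4|R|/n, which agree by the
  trace formula.\<close>

lemma zonal_sum_2:
  assumes "n > (0::real)"
  shows "(\<Sum>i\<le>1. zonal_coeff n (2 * 1) i * 4 ^ i * (if i = 1 then n * h else 2 * 4 ^ (1 - i) + 4 * h - 8)) = 0"
  using assms by (simp add: field_simps)

text \<open>One factor of the denominators, here n + 4, cancels. The numerator is linear in h, and
  its two coefficient polynomials reappear in the Diophantine lemma of the same degree.\<close>

lemma zonal_sum_4:
  assumes "n > (0::real)"
  shows "(\<Sum>i\<le>2. zonal_coeff n (2 * 2) i * 4 ^ i * (if i = 2 then n * h else 2 * 4 ^ (2 - i) + 4 * h - 8)) =
    4 * ((6 * n + 12) + (n - 10) * h) / (n + 2)"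
proof -
  have "n + 4 \<noteq> 0" "n + 2 \<noteq> 0" using assms by auto
  then show ?thesis by (simp add: numeral_eq_Suc divide_simps) (simp add: algebra_simps)
qed

lemma zonal_sum_6:
  assumes "n > (0::real)"
  shows "(\<Sum>i\<le>3. zonal_coeff n (2 * 3) i * 4 ^ i * (if i = 3 then n * h else 2 * 4 ^ (3 - i) + 4 * h - 8)) =
    4 * ((30 * n ^ 2 - 480) + (n ^ 2 - 48 * n + 272) * h) / ((n + 8) * (n + 4))"
proof -
  have "n + 8 \<noteq> 0" "n + 6 \<noteq> 0" "n + 4 \<noteq> 0" using assms by auto
  then show ?thesis by (simp add: numeral_eq_Suc divide_simps) (simp add: algebra_simps)
qed
lemma zonal_sum_8:
  assumes "n > (0::real)"
  shows "(\<Sum>i\<le>4. zonal_coeff n (2 * 4) i * 4 ^ i * (if i = 4 then n * h else 2 * 4 ^ (4 - i) + 4 * h - 8)) =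
    4 * ((126 * n ^ 3 + 168 * n ^ 2 - 1848 * n + 10080) +
      (n ^ 3 - 84 * n ^ 2 + 1820 * n - 6000) * h) /
    ((n + 12) * (n + 10) * (n + 6))"
proof -
  have "n + 12 \<noteq> 0" "n + 10 \<noteq> 0" "n + 8 \<noteq> 0" "n + 6 \<noteq> 0" using assms by auto
  then show ?thesis by (simp add: numeral_eq_Suc divide_simps) (simp add: algebra_simps)
qed

lemma zonal_sum_10:
  assumes "n > (0::real)"
  shows "(\<Sum>i\<le>5. zonal_coeff n (2 * 5) i * 4 ^ i * (if i = 5 then n * h else 2 * 4 ^ (5 - i) + 4 * h - 8)) =
    4 * ((510 * n ^ 4 + 2820 * n ^ 3 + 480 * n ^ 2 + 64320 * n - 161280) +
      (n ^ 4 - 130 * n ^ 3 + 4880 * n ^ 2 - 60320 * n + 102144) * h) /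
    ((n + 16) * (n + 14) * (n + 12) * (n + 8))"
proof -
  have "n + 16 \<noteq> 0" "n + 14 \<noteq> 0" "n + 12 \<noteq> 0" "n + 10 \<noteq> 0" "n + 8 \<noteq> 0" using assms by auto
  then show ?thesis by (simp add: numeral_eq_Suc divide_simps) (simp add: algebra_simps)
qed

lemma zonal_sum_12:
  assumes "n > (0::real)"
  shows "(\<Sum>i\<le>6. zonal_coeff n (2 * 6) i * 4 ^ i * (if i = 6 then n * h else 2 * 4 ^ (6 - i) + 4 * h - 8)) =
    4 * ((2046 * n ^ 5 + 24948 * n ^ 4 + 103224 * n ^ 3 + 432432 * n ^ 2 - 1510080 * n) +
      (n ^ 5 - 186 * n ^ 4 + 10852 * n ^ 3 - 228504 * n ^ 2 + 1659232 * n - 967680) * h) /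
    ((n + 20) * (n + 18) * (n + 16) * (n + 14) * (n + 10))"
proof -
  have "n + 20 \<noteq> 0" "n + 18 \<noteq> 0" "n + 16 \<noteq> 0" "n + 14 \<noteq> 0" "n + 12 \<noteq> 0" "n + 10 \<noteq> 0" using assms by auto
  then show ?thesis by (simp add: numeral_eq_Suc divide_simps) (simp add: algebra_simps)
qed

text \<open>The alternatives for h are the Coxeter numbers of components of type A, D, E_6, E_7, E_8
  of dimension at most n. From n = 10 on, the coefficient of h is non-negative and the other term
  positive; the finitely many smaller n are decided by integer arithmetic.\<close>

lemma diophantine_4:
  fixes n h :: nat
  assumes "n \<ge> 1" "h \<ge> 2"
    and "h \<le> n + 1 \<or> h + 2 \<le> 2 * n \<or> h = 12 \<and> n \<ge> 6 \<or> h = 18 \<and> n \<ge> 7 \<or> h = 30 \<and> n \<ge> 8"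
    and eq: "(6 * real n + 12) + (real n - 10) * real h = 0"
  shows "(n, h) \<in> {(1, 2), (2, 3), (4, 6), (6, 12), (7, 18), (8, 30)}"
proof -
  have eq': "(6 * int n + 12) + (int n - 10) * int h = 0"
    using eq by (subst of_int_eq_0_iff[where 'a = real, symmetric]) simp
  have "n \<le> 9"
  proof (rule ccontr)
    assume "\<not> n \<le> 9"
    \<comment> \<open>After this shift both polynomials have no negative coefficients in t, so their
      signs are visible.\<close>
    then obtain t where t: "n = 10 + t" using le_Suc_ex[of 10 n] by auto
    have "(6 * int n + 12) > 0" unfolding t by (simp add: algebra_simps power_numeral_reduce add_nonneg_pos)
    moreover have "(int n - 10) \<ge> 0" unfolding t by (simp add: algebra_simps power_numeral_reduce)
    ultimately show False using eq' by (smt (verit) mult_nonneg_nonneg of_nat_0_le_iff)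
  qed
  then have "n \<in> set [1..<10]" using assms(1) by simp
  then show ?thesis using eq' assms(2,3) by (simp add: upt_rec) (elim disjE; simp; presburger)
qed

text \<open>The coefficient of h is negative between its roots, about 6.6 and 41.4; this explains
  the cut at 42.\<close>

lemma diophantine_6:
  fixes n h :: nat
  assumes "n \<ge> 1" "h \<ge> 2"
    and "h \<le> n + 1 \<or> h + 2 \<le> 2 * n \<or> h = 12 \<and> n \<ge> 6 \<or> h = 18 \<and> n \<ge> 7 \<or> h = 30 \<and> n \<ge> 8"
    and eq: "(30 * real n ^ 2 - 480) + (real n ^ 2 - 48 * real n + 272) * real h = 0"
  shows "(n, h) \<in> {(1, 2), (2, 2), (8, 30), (16, 30)}"
proof -
  have eq': "(30 * int n ^ 2 - 480) + (int n ^ 2 - 48 * int n + 272) * int h = 0"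
    using eq by (subst of_int_eq_0_iff[where 'a = real, symmetric]) simp
  have "n \<le> 41"
  proof (rule ccontr)
    assume "\<not> n \<le> 41"
    then obtain t where t: "n = 42 + t" using le_Suc_ex[of 42 n] by auto
    have "(30 * int n ^ 2 - 480) > 0" unfolding t by (simp add: algebra_simps power_numeral_reduce add_nonneg_pos)
    moreover have "(int n ^ 2 - 48 * int n + 272) \<ge> 0" unfolding t by (simp add: algebra_simps power_numeral_reduce)
    ultimately show False using eq' by (smt (verit) mult_nonneg_nonneg of_nat_0_le_iff)
  qed
  then have "n \<in> set [1..<42]" using assms(1) by simp
  then show ?thesis using eq' assms(2,3) by (simp add: upt_rec) (elim disjE; simp; presburger)
qed

text \<open>The coefficient of h vanishes at the cut n = 50, where positivity of the other
  polynomial alone refutes the equation.\<close>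

lemma diophantine_8:
  fixes n h :: nat
  assumes "n \<ge> 1" "h \<ge> 2"
    and "h \<le> n + 1 \<or> h + 2 \<le> 2 * n \<or> h = 12 \<and> n \<ge> 6 \<or> h = 18 \<and> n \<ge> 7 \<or> h = 30 \<and> n \<ge> 8"
    and eq: "(126 * real n ^ 3 + 168 * real n ^ 2 - 1848 * real n + 10080) + (real n ^ 3 - 84 * real n ^ 2 + 1820 * real n - 6000) * real h = 0"
  shows "(n, h) \<in> {(1, 2), (2, 3)}"
proof -
  have eq': "(126 * int n ^ 3 + 168 * int n ^ 2 - 1848 * int n + 10080) + (int n ^ 3 - 84 * int n ^ 2 + 1820 * int n - 6000) * int h = 0"
    using eq by (subst of_int_eq_0_iff[where 'a = real, symmetric]) simp
  have "n \<le> 49"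
  proof (rule ccontr)
    assume "\<not> n \<le> 49"
    then obtain t where t: "n = 50 + t" using le_Suc_ex[of 50 n] by auto
    have "(126 * int n ^ 3 + 168 * int n ^ 2 - 1848 * int n + 10080) > 0" unfolding t by (simp add: algebra_simps power_numeral_reduce add_nonneg_pos)
    moreover have "(int n ^ 3 - 84 * int n ^ 2 + 1820 * int n - 6000) \<ge> 0" unfolding t by (simp add: algebra_simps power_numeral_reduce)
    ultimately show False using eq' by (smt (verit) mult_nonneg_nonneg of_nat_0_le_iff)
  qed
  then have "n \<in> set [1..<50]" using assms(1) by simp
  then show ?thesis using eq' assms(2,3) by (simp add: upt_rec) (elim disjE; simp; presburger)
qed

text \<open>As in degree 8, the coefficient of h vanishes exactly at the cut, here n = 76.\<close>

lemma diophantine_10: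
  fixes n h :: nat
  assumes "n \<ge> 1" "h \<ge> 2"
    and "h \<le> n + 1 \<or> h + 2 \<le> 2 * n \<or> h = 12 \<and> n \<ge> 6 \<or> h = 18 \<and> n \<ge> 7 \<or> h = 30 \<and> n \<ge> 8"
    and eq: "(510 * real n ^ 4 + 2820 * real n ^ 3 + 480 * real n ^ 2 + 64320 * real n - 161280) + (real n ^ 4 - 130 * real n ^ 3 + 4880 * real n ^ 2 - 60320 * real n + 102144) * real h = 0"
  shows "(n, h) \<in> {(1, 2), (2, 2), (2, 3), (4, 6), (8, 30)}"
proof -
  have eq': "(510 * int n ^ 4 + 2820 * int n ^ 3 + 480 * int n ^ 2 + 64320 * int n - 161280) + (int n ^ 4 - 130 * int n ^ 3 + 4880 * int n ^ 2 - 60320 * int n + 102144) * int h = 0"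
    using eq by (subst of_int_eq_0_iff[where 'a = real, symmetric]) simp
  have "n \<le> 75"
  proof (rule ccontr)
    assume "\<not> n \<le> 75"
    then obtain t where t: "n = 76 + t" using le_Suc_ex[of 76 n] by auto
    have "(510 * int n ^ 4 + 2820 * int n ^ 3 + 480 * int n ^ 2 + 64320 * int n - 161280) > 0" unfolding t by (simp add: algebra_simps power_numeral_reduce add_nonneg_pos)
    moreover have "(int n ^ 4 - 130 * int n ^ 3 + 4880 * int n ^ 2 - 60320 * int n + 102144) \<ge> 0" unfolding t by (simp add: algebra_simps power_numeral_reduce)
    ultimately show False using eq' by (smt (verit) mult_nonneg_nonneg of_nat_0_le_iff)
  qed
  then have "n \<in> set [1..<76]" using assms(1) by simp
  then show ?thesis using eq' assms(2,3) by (simp add: upt_rec) (elim disjE; simp; presburger)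
qed

lemma diophantine_12:
  fixes n h :: nat
  assumes "n \<ge> 1" "h \<ge> 2"
    and "h \<le> n + 1 \<or> h + 2 \<le> 2 * n \<or> h = 12 \<and> n \<ge> 6 \<or> h = 18 \<and> n \<ge> 7 \<or> h = 30 \<and> n \<ge> 8"
    and eq: "(2046 * real n ^ 5 + 24948 * real n ^ 4 + 103224 * real n ^ 3 + 432432 * real n ^ 2 - 1510080 * real n) + (real n ^ 5 - 186 * real n ^ 4 + 10852 * real n ^ 3 - 228504 * real n ^ 2 + 1659232 * real n - 967680) * real h = 0"
  shows "(n, h) \<in> {(1, 2)}"
proof -
  have eq': "(2046 * int n ^ 5 + 24948 * int n ^ 4 + 103224 * int n ^ 3 + 432432 * int n ^ 2 - 1510080 * int n) + (int n ^ 5 - 186 * int n ^ 4 + 10852 * int n ^ 3 - 228504 * int n ^ 2 + 1659232 * int n - 967680) * int h = 0"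
    using eq by (subst of_int_eq_0_iff[where 'a = real, symmetric]) simp
  have "n \<le> 95"
  proof (rule ccontr)
    assume "\<not> n \<le> 95"
    then obtain t where t: "n = 96 + t" using le_Suc_ex[of 96 n] by auto
    have "(2046 * int n ^ 5 + 24948 * int n ^ 4 + 103224 * int n ^ 3 + 432432 * int n ^ 2 - 1510080 * int n) > 0" unfolding t by (simp add: algebra_simps power_numeral_reduce add_nonneg_pos)
    moreover have "(int n ^ 5 - 186 * int n ^ 4 + 10852 * int n ^ 3 - 228504 * int n ^ 2 + 1659232 * int n - 967680) \<ge> 0" unfolding t by (simp add: algebra_simps power_numeral_reduce)
    ultimately show False using eq' by (smt (verit) mult_nonneg_nonneg of_nat_0_le_iff)
  qed
  then have "n \<in> set [1..<96]" using assms(1) by simp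
  then show ?thesis using eq' assms(2,3) by (simp add: upt_rec) (elim disjE; simp; presburger)
qed

section \<open>Isometries onto the standard root systems\<close>

lemma bij_Rep_16: "bij_betw (\<lambda>i::16. nat (Rep_bit0 i)) UNIV {..<16}"
proof -
  have td: "type_definition (Rep_bit0 :: 16 \<Rightarrow> int) Abs_bit0 {0..<2 * int CARD(8)}"
    by (rule type_definition_bit0)
  have range: "Rep_bit0 i \<in> {0..<16}" for i :: 16
    using type_definition.Rep[OF td, of i] by simp
  have "inj (\<lambda>i::16. nat (Rep_bit0 i))"
  proof (rule injI)
    fix i j :: 16 assume "nat (Rep_bit0 i) = nat (Rep_bit0 j)"
    then have "Rep_bit0 i = Rep_bit0 j" using range[of i] range[of j] by (simp add: eq_nat_nat_iff)
    then show "i = j" using type_definition.Rep_inject[OF td] by blast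
  qed
  moreover have "(\<lambda>i::16. nat (Rep_bit0 i)) ` UNIV \<subseteq> {..<16}"
    using range by (auto simp: nat_less_iff)
  ultimately show ?thesis
    unfolding bij_betw_def using card_subset_eq[of "{..<16}" "range (\<lambda>i::16. nat (Rep_bit0 i))"]
    by (simp add: card_image)
qed

lemma inner_emb16: "emb16 v \<bullet> emb16 w = ip16 v w"
proof -
  have "emb16 v \<bullet> emb16 w = (\<Sum>i::16\<in>UNIV. v (nat (Rep_bit0 i)) * w (nat (Rep_bit0 i)))"
    by (simp add: emb16_def inner_vec_def)
  also have "\<dots> = (\<Sum>k<16. v k * w k)"
    by (rule sum.reindex_bij_betw[OF bij_Rep_16, of "\<lambda>k. v k * w k"])
  finally show ?thesis by (simp add: ip16_def)
qed

lemma emb16_eq_iff: "emb16 v = emb16 w \<longleftrightarrow> (\<forall>k<16. v k = w k)"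
proof -
  have "emb16 v = emb16 w \<longleftrightarrow> (\<forall>i::16. v (nat (Rep_bit0 i)) = w (nat (Rep_bit0 i)))"
    by (simp add: emb16_def vec_eq_iff)
  also have "\<dots> \<longleftrightarrow> (\<forall>k\<in>(\<lambda>i::16. nat (Rep_bit0 i)) ` UNIV. v k = w k)" by simp
  also have "(\<lambda>i::16. nat (Rep_bit0 i)) ` UNIV = {..<16}" using bij_Rep_16 by (simp add: bij_betw_def)
  finally show ?thesis by auto
qed

lemma emb16_sum: "emb16 (\<lambda>k. \<Sum>i<m. c i * B i k) = (\<Sum>i<m. c i *\<^sub>R emb16 (B i))"
  by (simp add: emb16_def vec_eq_iff)

text \<open>T is fixed on a basis chosen inside R and preserves all inner products, first against
  images of roots, then in general. For a root outside the basis, \<open>T x - \<psi> x\<close>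
  therefore has norm 0.\<close>

lemma equiv_stdI:
  fixes R :: "(real^'n) set"
  assumes span: "span R = UNIV" and ip: "\<And>x y. x \<in> R \<Longrightarrow> y \<in> R \<Longrightarrow> x \<bullet> y = ip16 (\<phi> x) (\<phi> y)"
    and S: "\<phi> ` R = S"
  shows "equiv_std R S"
proof -
  define \<psi> where "\<psi> x = emb16 (\<phi> x)" for x
  have ip': "\<psi> x \<bullet> \<psi> y = x \<bullet> y" if "x \<in> R" "y \<in> R" for x y
    using ip[OF that] by (simp add: \<psi>_def inner_emb16)
  obtain B where B: "B \<subseteq> R" "independent B" "R \<subseteq> span B"
    using maximal_independent_subset[of R] by blast
  then have "span B = UNIV" using span by (metis span_mono span_span top.extremum_uniqueI)
  then have inB: "x \<in> span B" for x by simp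
  obtain T where T: "linear T" "\<And>b. b \<in> B \<Longrightarrow> T b = \<psi> b"
    using linear_independent_extend[OF B(2), of \<psi>] by blast
  have c1: "T x \<bullet> \<psi> r = x \<bullet> r" if r: "r \<in> R" for x r
    using inB[of x]
  proof (induction rule: span_induct)
    case base
    show ?case using T(1)
      by (auto simp: subspace_def linear_0 linear_add linear_cmul inner_add_left)
  next
    case (step b)
    then show ?case using T(2) ip' B(1) r by auto
  qed
  have c2: "T x \<bullet> T y = x \<bullet> y" for x y
    using inB[of y]
  proof (induction rule: span_induct)
    case base
    show ?case using T(1)
      by (auto simp: subspace_def linear_0 linear_add linear_cmul inner_add_right)
  next
    case (step b)
    then show ?case using T(2) c1[of b x] B(1) by auto
  qed
  have "T x = \<psi> x" if "x \<in> R" for x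
  proof -
    have "(T x - \<psi> x) \<bullet> (T x - \<psi> x) = 0"
      using c2[of x x] c1[OF that, of x] ip'[OF that that] by (simp add: inner_diff inner_commute)
    then show ?thesis by simp
  qed
  then have "T ` R = emb16 ` S" using S by (force simp: \<psi>_def)
  moreover have "norm (T x) = norm x" for x using c2[of x x] by (simp add: norm_eq_sqrt_inner)
  ultimately show ?thesis using T(1) by (auto simp: equiv_std_def)
qed

lemma sum_supported:
  fixes N :: nat
  assumes "\<And>k. k \<ge> N \<Longrightarrow> v k = (0::real)" "N \<le> M"
  shows "(\<Sum>k<M. v k * w k) = (\<Sum>k<N. v k * w k)"
  using assms by (intro sum.mono_neutral_right) auto

lemma equiv_std_if_isometric:
  fixes R :: "(real^'n) set"
  assumes "span R = UNIV" "isometric N R S" "N \<le> 16"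
  shows "equiv_std R S"
proof -
  obtain \<phi> where p: "bij_betw \<phi> R S" "\<And>x y. x \<in> R \<Longrightarrow> y \<in> R \<Longrightarrow> x \<bullet> y = (\<Sum>k<N. \<phi> x k * \<phi> y k)"
    and supp: "\<And>v k. v \<in> S \<Longrightarrow> k \<ge> N \<Longrightarrow> v k = 0"
    using assms(2) by (auto simp: isometric_def)
  show ?thesis
  proof (rule equiv_stdI[OF assms(1)])
    show "\<phi> ` R = S" using p(1) by (simp add: bij_betw_def)
    show "x \<bullet> y = ip16 (\<phi> x) (\<phi> y)" if "x \<in> R" "y \<in> R" for x y
      unfolding ip16_def p(2)[OF that] using p(1) that supp assms(3)
      by (intro sum_supported[symmetric]) (auto simp: bij_betw_def)
  qed
qed

section \<open>Two orthogonal copies\<close>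

lemma ip16_shift_orth:
  assumes "\<And>k. k \<ge> s \<Longrightarrow> v k = 0" shows "ip16 v (shift s w) = 0"
  unfolding ip16_def shift_def using assms by (intro sum.neutral) auto

lemma ip16_shift:
  assumes "\<And>k. k \<ge> N \<Longrightarrow> v k = 0" "N + s \<le> 16" shows "ip16 (shift s v) (shift s w) = (\<Sum>k<N. v k * w k)"
proof -
  have "ip16 (shift s v) (shift s w) = (\<Sum>k\<in>{s..<s + N}. shift s v k * shift s w k)"
    unfolding ip16_def using assms by (intro sum.mono_neutral_right) (auto simp: shift_def)
  also have "\<dots> = (\<Sum>k<N. v k * w k)"
    by (rule sum.reindex_bij_witness[of _ "\<lambda>k. k + s" "\<lambda>k. k - s"]) (auto simp: shift_def)
  finally show ?thesis .
qed

text \<open>\<open>N \<le> s\<close> gives the copies disjoint coordinates, and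
  \<open>N + s \<le> 16\<close> keeps the second one inside the target space.\<close>

lemma equiv_std_union:
  fixes R :: "(real^'n) set"
  assumes "span R = UNIV" "R = C \<union> D" "isometric N C S" "isometric N D S" "N \<le> s" "N + s \<le> 16"
    and orth: "\<And>x y. x \<in> C \<Longrightarrow> y \<in> D \<Longrightarrow> x \<bullet> y = 0" and disj: "C \<inter> D = {}"
  shows "equiv_std R (S \<union> shift s ` S)"
proof -
  obtain \<phi> where p: "bij_betw \<phi> C S" "\<And>x y. x \<in> C \<Longrightarrow> y \<in> C \<Longrightarrow> x \<bullet> y = (\<Sum>k<N. \<phi> x k * \<phi> y k)"
    and supp: "\<And>v k. v \<in> S \<Longrightarrow> k \<ge> N \<Longrightarrow> v k = 0"
    using assms(3) by (auto simp: isometric_def)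
  obtain \<eta> where q: "bij_betw \<eta> D S" "\<And>x y. x \<in> D \<Longrightarrow> y \<in> D \<Longrightarrow> x \<bullet> y = (\<Sum>k<N. \<eta> x k * \<eta> y k)"
    using assms(4) by (auto simp: isometric_def)
  define f where "f x = (if x \<in> C then \<phi> x else shift s (\<eta> x))" for x
  have pS: "\<phi> x \<in> S" if "x \<in> C" for x using p(1) that by (auto simp: bij_betw_def)
  have qS: "\<eta> x \<in> S" if "x \<in> D" for x using q(1) that by (auto simp: bij_betw_def)
  have CC: "x \<bullet> y = ip16 (f x) (f y)" if "x \<in> C" "y \<in> C" for x y
    using p(2)[OF that] sum_supported[of N "\<phi> x" 16 "\<phi> y"] supp[OF pS[OF that(1)]] assms(6) that
    by (simp add: f_def ip16_def)
  have nC: "x \<notin> C" if "x \<in> D" for x using that disj by blast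
  have DD: "x \<bullet> y = ip16 (f x) (f y)" if "x \<in> D" "y \<in> D" for x y
    using q(2)[OF that] ip16_shift[of N "\<eta> x" s "\<eta> y"] supp[OF qS[OF that(1)]] assms(6) nC that
    by (simp add: f_def)
  have CD: "x \<bullet> y = ip16 (f x) (f y)" if "x \<in> C" "y \<in> D" for x y
    using orth[OF that] ip16_shift_orth[of s "\<phi> x" "\<eta> y"] supp[OF pS[OF that(1)]] assms(5) nC that
    by (simp add: f_def)
  have comm: "ip16 v w = ip16 w v" for v w by (simp add: ip16_def mult.commute)
  show ?thesis
  proof (rule equiv_stdI[OF assms(1)])
    show "x \<bullet> y = ip16 (f x) (f y)" if "x \<in> R" "y \<in> R" for x y
      using that CC DD CD CD[of y x] comm unfolding assms(2) by (metis Un_iff inner_commute)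
    have "f ` C = \<phi> ` C" "f ` D = shift s ` \<eta> ` D"
      using nC by (auto simp: f_def image_iff)
    then show "f ` R = S \<union> shift s ` S"
      using p(1) q(1) by (simp add: assms(2) image_Un bij_betw_def)
  qed
qed

section \<open>Invariants recovered from an equivalence\<close>

lemma equiv_std_card_dim:
  fixes R :: "(real^'n) set"
  assumes "equiv_std R S" "span R = UNIV" and supp: "\<forall>v\<in>S. \<forall>k\<ge>16. v k = 0"
  shows "card R = card S" "CARD('n) = dim (emb16 ` S)"
proof -
  obtain T :: "real^'n \<Rightarrow> real^16" where T: "linear T" "\<And>x. norm (T x) = norm x" "T ` R = emb16 ` S"
    using assms(1) by (auto simp: equiv_std_def)
  have inj: "inj T"
    using T(1) unfolding linear_injective_0[OF T(1)] by (metis T(2) norm_eq_zero)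
  \<comment> \<open>This rests on \<open>supp\<close>, since \<open>emb16\<close> ignores all
    coordinates from 16 on.\<close>
  have "inj_on emb16 S"
  proof (rule inj_onI)
    fix v w assume "v \<in> S" "w \<in> S" "emb16 v = emb16 w"
    then show "v = w" using supp by (metis emb16_eq_iff ext not_le)
  qed
  then have "card (emb16 ` S) = card S" by (rule card_image)
  moreover have "card (T ` R) = card R" using inj by (metis card_image inj_on_subset top_greatest)
  ultimately show "card R = card S" using T(3) by simp
  have "dim (T ` R) = dim R" using inj by (intro dim_image_eq[OF T(1)]) (rule inj_on_subset[OF inj], simp)
  moreover have "dim R = CARD('n)" using assms(2) by (metis dim_span dim_UNIV DIM_cart DIM_real mult_1_right)
  ultimately show "CARD('n) = dim (emb16 ` S)" using T(3) by simp
qed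

text \<open>The embedded standard system realizes its own base, so \<open>model_dim\<close> applies
  to it. The shift covers the second summand of a double; s = 0 is the plain case.\<close>

lemma dim_emb16_model:
  assumes M: "root_model m N B G w S" and N: "N + s \<le> 16" and G: "\<And>i. i < m \<Longrightarrow> G i i = 2"
  shows "dim (emb16 ` shift s ` S) = m"
proof (rule model_dim[OF M, where b = "\<lambda>i. emb16 (shift s (B i))"])
  have S: "S = {v. (\<exists>c :: nat \<Rightarrow> int. v = (\<lambda>k. \<Sum>i<m. of_int (c i) * B i k)) \<and> (\<Sum>k<N. (v k)\<^sup>2) = 2}"
    and supp: "\<And>i k. i < m \<Longrightarrow> k \<ge> N \<Longrightarrow> B i k = 0"
    and gram: "\<And>i j. i < m \<Longrightarrow> j < m \<Longrightarrow> (\<Sum>k<N. B i k * B j k) = G i j"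
    using M by (simp_all add: root_model_def)
  have BS: "B i \<in> S" if "i < m" for i
  proof -
    define c :: "nat \<Rightarrow> int" where "c j = (if j = i then 1 else 0)" for j
    have "B i = (\<lambda>k. \<Sum>j<m. of_int (c j) * B j k)"
      using that by (simp add: c_def if_distrib[of of_int] if_distrib[of "\<lambda>t. t * _"] cong: if_cong)
    moreover have "(\<Sum>k<N. (B i k)\<^sup>2) = 2" using gram[OF that that] G[OF that] by (simp add: power2_eq_square)
    ultimately show ?thesis unfolding S by blast
  qed
  have "emb16 (shift s (B i)) \<bullet> emb16 (shift s (B j)) = G i j" if "i < m" "j < m" for i j
    using ip16_shift[of N "B i" s "B j"] supp N gram that by (simp add: inner_emb16)
  then show "realizes (emb16 ` shift s ` S) m (\<lambda>i. emb16 (shift s (B i))) G"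
    using BS by (auto simp: realizes_def)
  show "emb16 ` shift s ` S \<subseteq> lat m (\<lambda>i. emb16 (shift s (B i)))"
  proof clarify
    fix v assume "v \<in> S"
    then obtain c :: "nat \<Rightarrow> int" where c: "v = (\<lambda>k. \<Sum>i<m. of_int (c i) * B i k)" unfolding S by blast
    have "shift s v = (\<lambda>k. \<Sum>i<m. of_int (c i) * shift s (B i) k)" by (auto simp: c shift_def fun_eq_iff)
    then show "emb16 (shift s v) \<in> lat m (\<lambda>i. emb16 (shift s (B i)))"
      by (auto simp: emb16_sum lat_def)
  qed
qed

lemma shift_0: "shift 0 v = v" by (simp add: shift_def)

lemma root_model_supp: "root_model m N B G w S \<Longrightarrow> v \<in> S \<Longrightarrow> k \<ge> N \<Longrightarrow> v k = 0"
  by (auto simp: root_model_def)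

context
  fixes R :: "(real^'n) set" and m N B G w S
  assumes M: "root_model m N B G w S" and G: "\<And>i. i < m \<Longrightarrow> G i i = 2" and span: "span R = UNIV"
begin

lemma equiv_std_model:
  assumes "equiv_std R S" "N \<le> 16"
  shows "card R = card S" "CARD('n) = m"
  using equiv_std_card_dim[OF assms(1) span] root_model_supp[OF M] assms(2) dim_emb16_model[OF M _ G, of 0]
  by (simp_all add: shift_0)

lemma equiv_std_model_double:
  assumes e: "equiv_std R (S \<union> shift s ` S)" and s: "N \<le> s" "N + s \<le> 16" and "finite S"
  shows "card R = 2 * card S" "CARD('n) = 2 * m"
proof -
  have supp: "v k = 0" if "v \<in> S" "k \<ge> N" for v k using root_model_supp[OF M] that by blast
  have supp16: "\<forall>v\<in>S \<union> shift s ` S. \<forall>k\<ge>16. v k = 0"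
    using s supp by (auto simp: shift_def)
  have orth: "emb16 v \<bullet> emb16 (shift s w) = 0" if "v \<in> S" for v w
    using supp[OF that] s(1) by (simp add: inner_emb16 ip16_shift_orth)
  have "dim (emb16 ` S \<union> emb16 ` shift s ` S) = dim (emb16 ` S) + dim (emb16 ` shift s ` S)"
    by (rule dim_orthogonal_sum) (use orth in auto)
  then have "dim (emb16 ` (S \<union> shift s ` S)) = 2 * m"
    using dim_emb16_model[OF M _ G, of 0] dim_emb16_model[OF M _ G, of s] s by (simp add: image_Un shift_0)
  then show "CARD('n) = 2 * m" using equiv_std_card_dim(2)[OF e span supp16] by simp
  have "inj (shift s)"
    by (rule injI) (auto simp: shift_def fun_eq_iff dest: spec[of _ "_ + s"])
  then have "card (shift s ` S) = card S" by (metis card_image inj_on_subset top_greatest)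
  moreover have "S \<inter> shift s ` S = {}"
  proof -
    have False if "v \<in> S" "v = shift s w" for v w
    proof -
      \<comment> \<open>A vector in both copies would be orthogonal to itself although its norm is
        2.\<close>
      have "ip16 v v = 0" using ip16_shift_orth[of s v w] supp[OF that(1)] s(1) that(2) by simp
      moreover have "ip16 v v = (\<Sum>k<N. (v k)\<^sup>2)"
        unfolding ip16_def using sum_supported[of N v 16 v] supp[OF that(1)] s by (simp add: power2_eq_square)
      moreover have "(\<Sum>k<N. (v k)\<^sup>2) = 2" using M that(1) by (auto simp: root_model_def)
      ultimately show False by simp
    qed
    then show ?thesis by blast
  qed
  ultimately show "card R = 2 * card S"
    using equiv_std_card_dim(1)[OF e span supp16] card_Un_disjoint[of S "shift s ` S"] assms(4) by simp
qed

end

lemma gram_diag: "gram_path i i = 2" "gram_branch k p i i = 2"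
  by (simp_all add: gram_path_def gram_branch_def)

section \<open>The main theorem\<close>

lemma quotient_eq_0: "d \<noteq> 0 \<Longrightarrow> 4 * x / d = 0 \<longleftrightarrow> x = 0" for x d :: real
  by simp

context eutactic
begin

section \<open>The conditions as equations in n and h\<close>

lemma n_pos: "real CARD('n) > 0" by simp

lemma cond_C_2: "cond_C R 2"
  using cond_C_iff_moments[of 1] zonal_sum_2[OF n_pos, of h] by simp

lemma card_add_numeral_neq_0: "real CARD('n) + numeral d \<noteq> 0"
  by (simp add: add_nonneg_eq_0_iff)

lemma cond_C_4: "cond_C R 4 \<longleftrightarrow> (6 * real CARD('n) + 12) +
     (real CARD('n) - 10) * h = 0"
proof -
  have "cond_C R (2 * 2) \<longleftrightarrow> (6 * real CARD('n) + 12) +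
     (real CARD('n) - 10) * h = 0"
    unfolding cond_C_iff_moments zonal_sum_4[OF n_pos]
    by (rule quotient_eq_0) (simp add: card_add_numeral_neq_0)
  then show ?thesis by simp
qed

lemma cond_C_6: "cond_C R 6 \<longleftrightarrow> (30 * real CARD('n) ^ 2 - 480) +
     (real CARD('n) ^ 2 - 48 * real CARD('n) + 272) * h = 0"
proof -
  have "cond_C R (2 * 3) \<longleftrightarrow> (30 * real CARD('n) ^ 2 - 480) +
     (real CARD('n) ^ 2 - 48 * real CARD('n) + 272) * h = 0"
    unfolding cond_C_iff_moments zonal_sum_6[OF n_pos]
    by (rule quotient_eq_0) (simp add: card_add_numeral_neq_0)
  then show ?thesis by simp
qed

lemma cond_C_8: "cond_C R 8 \<longleftrightarrow> (126 * real CARD('n) ^ 3 + 168 * real CARD('n) ^ 2 - 1848 * real CARD('n) + 10080) +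
     (real CARD('n) ^ 3 - 84 * real CARD('n) ^ 2 + 1820 * real CARD('n) - 6000) * h = 0"
proof -
  have "cond_C R (2 * 4) \<longleftrightarrow> (126 * real CARD('n) ^ 3 + 168 * real CARD('n) ^ 2 - 1848 * real CARD('n) + 10080) +
     (real CARD('n) ^ 3 - 84 * real CARD('n) ^ 2 + 1820 * real CARD('n) - 6000) * h = 0"
    unfolding cond_C_iff_moments zonal_sum_8[OF n_pos]
    by (rule quotient_eq_0) (simp add: card_add_numeral_neq_0)
  then show ?thesis by simp
qed

lemma cond_C_10: "cond_C R 10 \<longleftrightarrow> (510 * real CARD('n) ^ 4 + 2820 * real CARD('n) ^ 3 + 480 * real CARD('n) ^ 2 + 64320 * real CARD('n) - 161280) +
     (real CARD('n) ^ 4 - 130 * real CARD('n) ^ 3 + 4880 * real CARD('n) ^ 2 - 60320 * real CARD('n) + 102144) * h = 0"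
proof -
  have "cond_C R (2 * 5) \<longleftrightarrow> (510 * real CARD('n) ^ 4 + 2820 * real CARD('n) ^ 3 + 480 * real CARD('n) ^ 2 + 64320 * real CARD('n) - 161280) +
     (real CARD('n) ^ 4 - 130 * real CARD('n) ^ 3 + 4880 * real CARD('n) ^ 2 - 60320 * real CARD('n) + 102144) * h = 0"
    unfolding cond_C_iff_moments zonal_sum_10[OF n_pos]
    by (rule quotient_eq_0) (simp add: card_add_numeral_neq_0)
  then show ?thesis by simp
qed

lemma cond_C_12: "cond_C R 12 \<longleftrightarrow> (2046 * real CARD('n) ^ 5 + 24948 * real CARD('n) ^ 4 + 103224 * real CARD('n) ^ 3 + 432432 * real CARD('n) ^ 2 - 1510080 * real CARD('n)) +
     (real CARD('n) ^ 5 - 186 * real CARD('n) ^ 4 + 10852 * real CARD('n) ^ 3 - 228504 * real CARD('n) ^ 2 + 1659232 * real CARD('n) - 967680) * h = 0"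
proof -
  have "cond_C R (2 * 6) \<longleftrightarrow> (2046 * real CARD('n) ^ 5 + 24948 * real CARD('n) ^ 4 + 103224 * real CARD('n) ^ 3 + 432432 * real CARD('n) ^ 2 - 1510080 * real CARD('n)) +
     (real CARD('n) ^ 5 - 186 * real CARD('n) ^ 4 + 10852 * real CARD('n) ^ 3 - 228504 * real CARD('n) ^ 2 + 1659232 * real CARD('n) - 967680) * h = 0"
    unfolding cond_C_iff_moments zonal_sum_12[OF n_pos]
    by (rule quotient_eq_0) (simp add: card_add_numeral_neq_0)
  then show ?thesis by simp
qed

section \<open>From n and h to the root system\<close>

lemma component_type:
  assumes C: "C \<in> components R"
  shows "(\<exists>k\<ge>1. isometric (Suc k) C (std_A k) \<and> dim C = k \<and> h = real (k + 1)) \<or>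
    (\<exists>k\<ge>4. isometric k C (std_D k) \<and> dim C = k \<and> h = real (2 * (k - 1))) \<or>
    isometric 8 C std_E6 \<and> dim C = 6 \<and> h = 12 \<or> isometric 8 C std_E7 \<and> dim C = 7 \<and> h = 18 \<or>
    isometric 8 C std_E8 \<and> dim C = 8 \<and> h = 30"
proof -
  interpret irreducible C
    using component_simply_laced[OF simply_laced C] component_irreducible[OF simply_laced C]
      component_nonempty[OF simply_laced C] by unfold_locales
  have card: "card C = card S" if "isometric N C S" for N S
    using that by (auto simp: isometric_def dest: bij_betw_same_card)
  have h: "h = real (card C) / real (dim C)"
    using coxeter_number_component[OF C] by (simp add: coxeter_number_def)
  note cl = classification[OF root_model_A root_model_D root_model_E6 root_model_E7 root_model_E8]
  from cl consider (A) k where "k \<ge> 1" "isometric (Suc k) C (std_A k)" "dim C = k"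
    | (D) k where "k \<ge> 4" "isometric k C (std_D k)" "dim C = k"
    | (E6) "isometric 8 C std_E6" "dim C = 6" | (E7) "isometric 8 C std_E7" "dim C = 7"
    | (E8) "isometric 8 C std_E8" "dim C = 8"
    by blast
  then show ?thesis
  proof cases
    case A
    then have "h = real (k + 1)" using card[OF A(2)] by (simp add: h card_std_A field_simps)
    with A show ?thesis by blast
  next
    case D
    then have "h = real (2 * (k - 1))" using card[OF D(2)] by (simp add: h card_std_D field_simps)
    with D show ?thesis by blast
  next
    case E6
    then have "h = 12" using card[OF E6(1)] by (simp add: h card_std_E6)
    with E6 show ?thesis by blast
  next
    case E7
    then have "h = 18" using card[OF E7(1)] by (simp add: h card_std_E7)
    with E7 show ?thesis by blast
  next
    case E8
    then have "h = 30" using card[OF E8(1)] by (simp add: h card_std_E8)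
    with E8 show ?thesis by blast
  qed
qed

lemma component_dim_ge: "C \<in> components R \<Longrightarrow> dim C \<ge> 1"
  by (drule component_type) (elim disjE exE conjE; simp)

lemma component_dim_le: "dim C \<le> CARD('n)" for C :: "(real^'n) set"
  using dim_subset_UNIV[of C] by simp

lemma component_card: "C \<in> components R \<Longrightarrow> real (card C) = h * real (dim C)"
proof -
  assume C: "C \<in> components R"
  have "dim C \<noteq> 0" using component_dim_ge[OF C] by linarith
  then show ?thesis using coxeter_number_component[OF C] by (simp add: coxeter_number_def field_simps)
qed

text \<open>Both C and R have h times their dimension many roots, so equal dimension forces equal
  cardinality.\<close>

lemma component_full:
  assumes "C \<in> components R" "dim C = CARD('n)" shows "C = R"
proof -
  have "real (card C) = real (card R)" using component_card[OF assms(1)] assms(2) card_R by simp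
  then show ?thesis
    using component_subset[OF simply_laced assms(1)] simply_laced_finite[OF simply_laced]
    by (intro card_subset_eq) auto
qed

text \<open>A single component suffices: its type determines h, and its dimension is at most
  n.\<close>

lemma h_bounds:
  obtains h' :: nat where "h = real h'" "h' \<ge> 2"
    "h' \<le> CARD('n) + 1 \<or> h' + 2 \<le> 2 * CARD('n) \<or> h' = 12 \<and> CARD('n) \<ge> 6 \<or> h' = 18 \<and> CARD('n) \<ge> 7 \<or> h' = 30 \<and> CARD('n) \<ge> 8"
proof -
  obtain C where C: "C \<in> components R" using nonempty component_exists by blast
  have d: "dim C \<le> CARD('n)" by (rule component_dim_le)
  from component_type[OF C] show ?thesis
  proof (elim disjE exE conjE)
    fix k assume "1 \<le> k" "dim C = k" "h = real (k + 1)"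
    then show ?thesis using d by (intro that[of "k + 1"]) auto
  next
    fix k assume "4 \<le> k" "dim C = k" "h = real (2 * (k - 1))"
    then show ?thesis using d by (intro that[of "2 * (k - 1)"]) auto
  qed (use d in \<open>auto intro: that[of 12] that[of 18] that[of 30]\<close>)
qed

text \<open>A second component D has the dimension of C, so C and D together already have h n = |R|
  roots, and no third component is left.\<close>

lemma two_components:
  assumes C: "C \<in> components R" "isometric N C S" and ne: "C \<noteq> R" and d: "2 * dim C = CARD('n)"
    and others: "\<And>D. D \<in> components R \<Longrightarrow> D \<noteq> R \<Longrightarrow> isometric N D S \<and> dim D = dim C"
    and s: "N \<le> s" "N + s \<le> 16"
  shows "equiv_std R (S \<union> shift s ` S)"
proof -
  obtain x where x: "x \<in> R" "x \<notin> C" using ne component_subset[OF simply_laced C(1)] by blast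
  then obtain D where D: "D \<in> components R" "x \<in> D" using component_exists by blast
  have disj: "C \<inter> D = {}" using components_disjoint[OF C(1) D(1)] x D(2) by blast
  have "D \<noteq> R" using disj component_subset[OF simply_laced C(1)] component_nonempty[OF simply_laced C(1)] by blast
  then have D': "isometric N D S" "dim D = dim C" using others[OF D(1)] by auto
  have fin: "finite C" "finite D" "finite R"
    using simply_laced_finite[OF simply_laced] component_subset[OF simply_laced] C(1) D(1) finite_subset by blast+
  have "real (card (C \<union> D)) = real (card R)"
    using component_card[OF C(1)] component_card[OF D(1)] D'(2) d card_R disj fin
    by (simp add: card_Un_disjoint flip: d)
  then have R: "R = C \<union> D"
    using component_subset[OF simply_laced C(1)] component_subset[OF simply_laced D(1)] fin
    by (intro card_subset_eq[symmetric]) auto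
  have "u \<bullet> v = 0" if "u \<in> C" "v \<in> D" for u v
    using component_closed[OF simply_laced C(1) that(1), of v] that(2) disj R by blast
  then show ?thesis using equiv_std_union[OF spanning R C(2) D'(1) s] disj by blast
qed

text \<open>For each pair, h and \<open>dim C \<le> n\<close> leave one type for a component, except
  for (16, 30), where two remain. A component of full dimension is all of R; otherwise two equal
  components fill the space. For n = 1 the dimension alone decides.\<close>

lemma type_n1: "CARD('n) = 1 \<Longrightarrow> equiv_std R (std_A 1)"
  and type_2_3: "CARD('n) = 2 \<Longrightarrow> h = 3 \<Longrightarrow> equiv_std R (std_A 2)"
  and type_4_6: "CARD('n) = 4 \<Longrightarrow> h = 6 \<Longrightarrow> equiv_std R (std_D 4)"
  and type_6_12: "CARD('n) = 6 \<Longrightarrow> h = 12 \<Longrightarrow> equiv_std R std_E6"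
  and type_7_18: "CARD('n) = 7 \<Longrightarrow> h = 18 \<Longrightarrow> equiv_std R std_E7"
  and type_8_30: "CARD('n) = 8 \<Longrightarrow> h = 30 \<Longrightarrow> equiv_std R std_E8"
  and type_2_2: "CARD('n) = 2 \<Longrightarrow> h = 2 \<Longrightarrow> equiv_std R std_2A1"
  and type_16_30: "CARD('n) = 16 \<Longrightarrow> h = 30 \<Longrightarrow> equiv_std R (std_D 16) \<or> equiv_std R std_2E8"
proof -
  obtain C where C: "C \<in> components R" using nonempty component_exists by blast
  have d: "dim C \<le> CARD('n)" by (rule component_dim_le)
  have full: "equiv_std R S" if "isometric N C S" "dim C = CARD('n)" "N \<le> 16" for N S
    using equiv_std_if_isometric[OF spanning _ that(3)] component_full[OF C that(2)] that(1) by simp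
  note t = component_type[OF C]
  show "equiv_std R (std_A 1)" if "CARD('n) = 1"
  proof -
    have "dim C = 1" using component_dim_ge[OF C] d that by simp
    then have "isometric 2 C (std_A 1)" using t by (auto simp: numeral_2_eq_2)
    then show ?thesis using full[of 2 "std_A 1"] \<open>dim C = 1\<close> that by simp
  qed
  show "equiv_std R (std_A 2)" if "CARD('n) = 2" "h = 3"
  proof -
    have "isometric 3 C (std_A 2) \<and> dim C = 2" using t d that by (auto simp: numeral_3_eq_3)
    then show ?thesis using full[of 3 "std_A 2"] that by simp
  qed
  show "equiv_std R (std_D 4)" if "CARD('n) = 4" "h = 6"
  proof -
    have "isometric 4 C (std_D 4) \<and> dim C = 4" using t d that by auto
    then show ?thesis using full[of 4 "std_D 4"] that by simp
  qed
  show "equiv_std R std_E6" if "CARD('n) = 6" "h = 12"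
    using t d that full[of 8 std_E6] by auto
  show "equiv_std R std_E7" if "CARD('n) = 7" "h = 18"
    using t d that full[of 8 std_E7] by auto
  show "equiv_std R std_E8" if "CARD('n) = 8" "h = 30"
    using t d that full[of 8 std_E8] by auto
  show "equiv_std R std_2A1" if n2: "CARD('n) = 2" "h = 2"
  proof -
    have D: "isometric 2 D (std_A 1) \<and> dim D = 1" if "D \<in> components R" for D
      using component_type[OF that] component_dim_le[of D] n2 by (auto simp: numeral_2_eq_2)
    have "C \<noteq> R"
    proof
      assume "C = R"
      then have "real (card R) = 2" using component_card[OF C] D[OF C] n2 by simp
      then show False using card_R n2 by simp
    qed
    then show ?thesis unfolding std_2A1_def
      using D C n2 by (intro two_components[of C 2]) auto
  qed
  show "equiv_std R (std_D 16) \<or> equiv_std R std_2E8" if n16: "CARD('n) = 16" "h = 30"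
  proof -
    \<comment> \<open>The Coxeter number 30 belongs to A_29, D_16 and E_8, and A_29 exceeds the
      dimension.\<close>
    have D: "isometric 16 D (std_D 16) \<and> dim D = 16 \<or> isometric 8 D std_E8 \<and> dim D = 8"
      if "D \<in> components R" for D
      using component_type[OF that]
    proof (elim disjE exE conjE)
      fix k assume k: "4 \<le> k" "isometric k D (std_D k)" "dim D = k" "h = real (2 * (k - 1))"
      then have "real (2 * (k - 1)) = real 30" using n16 by simp
      then have "k = 16" unfolding of_nat_eq_iff by linarith
      then show ?thesis using k by simp
    qed (use component_dim_le[of D] n16 in auto)
    show ?thesis
    proof (cases "isometric 16 C (std_D 16) \<and> dim C = 16")
      case True
      then show ?thesis using full[of 16 "std_D 16"] n16 by auto
    next
      case False
      then have C8: "isometric 8 C std_E8" "dim C = 8" using D[OF C] by auto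
      have "C \<noteq> R"
      proof
        assume "C = R"
        then have "real (card R) = 240" using component_card[OF C] C8 n16 by simp
        then show False using card_R n16 by simp
      qed
      moreover have "isometric 8 D std_E8 \<and> dim D = dim C" if "D \<in> components R" "D \<noteq> R" for D
        using D[OF that(1)] component_full[OF that(1)] that(2) n16 C8 by auto
      ultimately have "equiv_std R std_2E8" unfolding std_2E8_def
        using C C8 n16 by (intro two_components[of C 8]) auto
      then show ?thesis by blast
    qed
  qed
qed

section \<open>From the root system back to n and h\<close>

lemma data_A: "equiv_std R (std_A k) \<Longrightarrow> 1 \<le> k \<Longrightarrow> k < 16 \<Longrightarrow> CARD('n) = k \<and> h = real k + 1"
  using equiv_std_model[OF root_model_A[of k] gram_diag(1) spanning]
  by (auto simp: h_def card_std_A field_simps)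

lemma data_D: "equiv_std R (std_D k) \<Longrightarrow> 4 \<le> k \<Longrightarrow> k \<le> 16 \<Longrightarrow> CARD('n) = k \<and> h = 2 * (real k - 1)"
  using equiv_std_model[OF root_model_D[of k] gram_diag(2) spanning]
  by (auto simp: h_def card_std_D field_simps of_nat_diff)

lemma data_E6: "equiv_std R std_E6 \<Longrightarrow> CARD('n) = 6 \<and> h = 12"
  using equiv_std_model[OF root_model_E6 gram_diag(2) spanning] by (simp add: h_def card_std_E6)

lemma data_E7: "equiv_std R std_E7 \<Longrightarrow> CARD('n) = 7 \<and> h = 18"
  using equiv_std_model[OF root_model_E7 gram_diag(2) spanning] by (simp add: h_def card_std_E7)

lemma data_E8: "equiv_std R std_E8 \<Longrightarrow> CARD('n) = 8 \<and> h = 30"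
  using equiv_std_model[OF root_model_E8 gram_diag(2) spanning] by (simp add: h_def card_std_E8)

lemma data_2A1: "equiv_std R std_2A1 \<Longrightarrow> CARD('n) = 2 \<and> h = 2"
  using equiv_std_model_double[OF root_model_A[of 1] gram_diag(1) spanning, of 2] card_std_A[of 1]
  by (simp add: h_def std_2A1_def card_ge_0_finite)

lemma data_2E8: "equiv_std R std_2E8 \<Longrightarrow> CARD('n) = 16 \<and> h = 30"
  using equiv_std_model_double[OF root_model_E8 gram_diag(2) spanning, of 8] card_std_E8
  by (simp add: h_def std_2E8_def card_ge_0_finite)

end

theorem proposition8p5:
  fixes R :: "(real^'n) set"
  assumes "root_system R" and "R \<noteq> {}" and "norm_two R"
    and "strongly_eutactic R" and "span R = UNIV"
  shows "cond_C R 2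
    \<and> (cond_C R 4 \<longleftrightarrow> equiv_std R (std_A 1) \<or> equiv_std R (std_A 2) \<or> equiv_std R (std_D 4)
         \<or> equiv_std R std_E6 \<or> equiv_std R std_E7 \<or> equiv_std R std_E8)
    \<and> (cond_C R 6 \<longleftrightarrow> equiv_std R (std_A 1) \<or> equiv_std R std_2A1 \<or> equiv_std R std_E8
         \<or> equiv_std R std_2E8 \<or> equiv_std R (std_D 16))
    \<and> (cond_C R 8 \<longleftrightarrow> equiv_std R (std_A 1) \<or> equiv_std R (std_A 2))
    \<and> (cond_C R 10 \<longleftrightarrow> equiv_std R (std_A 1) \<or> equiv_std R std_2A1 \<or> equiv_std R (std_A 2)
         \<or> equiv_std R (std_D 4) \<or> equiv_std R std_E8)
    \<and> (cond_C R 12 \<longleftrightarrow> equiv_std R (std_A 1))"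
proof -
  interpret eutactic R using assms by unfold_locales
  obtain h' :: nat where h: "h = real h'" and b: "h' \<ge> 2"
    "h' \<le> CARD('n) + 1 \<or> h' + 2 \<le> 2 * CARD('n) \<or> h' = 12 \<and> CARD('n) \<ge> 6 \<or> h' = 18 \<and> CARD('n) \<ge> 7 \<or>
      h' = 30 \<and> CARD('n) \<ge> 8"
    by (rule h_bounds)
  have n1: "CARD('n) \<ge> 1" by (simp add: Suc_leI)
  \<comment> \<open>Stated with \<open>Suc 0\<close>, the form into which simplification turns the
    index of \<open>std_A 1\<close>, so that it matches as a destruction rule.\<close>
  have A1: "equiv_std R (std_A (Suc 0)) \<Longrightarrow> CARD('n) = 1 \<and> h = 2" using data_A[of 1] by simp
  have A2: "equiv_std R (std_A 2) \<Longrightarrow> CARD('n) = 2 \<and> h = 3" using data_A[of 2] by simp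
  have D4: "equiv_std R (std_D 4) \<Longrightarrow> CARD('n) = 4 \<and> h = 6" using data_D[of 4] by simp
  have D16: "equiv_std R (std_D 16) \<Longrightarrow> CARD('n) = 16 \<and> h = 30" using data_D[of 16] by simp
  have "cond_C R 4 \<longleftrightarrow> equiv_std R (std_A 1) \<or> equiv_std R (std_A 2) \<or> equiv_std R (std_D 4)
         \<or> equiv_std R std_E6 \<or> equiv_std R std_E7 \<or> equiv_std R std_E8" (is "_ \<longleftrightarrow> ?E")
  proof
    assume "cond_C R 4"
    then have "(CARD('n), h') \<in> {(1, 2), (2, 3), (4, 6), (6, 12), (7, 18), (8, 30)}"
      unfolding cond_C_4 h by (rule diophantine_4[OF n1 b])
    then show ?E using h type_n1 type_2_3 type_4_6 type_6_12 type_7_18 type_8_30 by auto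
  next
    assume ?E
    then show "cond_C R 4"
      unfolding cond_C_4 by (elim disjE) (auto dest!: A1 A2 D4 data_E6 data_E7 data_E8)
  qed
  moreover have "cond_C R 6 \<longleftrightarrow> equiv_std R (std_A 1) \<or> equiv_std R std_2A1 \<or> equiv_std R std_E8
         \<or> equiv_std R std_2E8 \<or> equiv_std R (std_D 16)" (is "_ \<longleftrightarrow> ?E")
  proof
    assume "cond_C R 6"
    then have "(CARD('n), h') \<in> {(1, 2), (2, 2), (8, 30), (16, 30)}"
      unfolding cond_C_6 h by (rule diophantine_6[OF n1 b])
    then show ?E using h type_n1 type_2_2 type_8_30 type_16_30 by auto
  next
    assume ?E
    then show "cond_C R 6"
      unfolding cond_C_6 by (elim disjE) (auto dest!: A1 D16 data_2A1 data_E8 data_2E8)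
  qed
  moreover have "cond_C R 8 \<longleftrightarrow> equiv_std R (std_A 1) \<or> equiv_std R (std_A 2)" (is "_ \<longleftrightarrow> ?E")
  proof
    assume "cond_C R 8"
    then have "(CARD('n), h') \<in> {(1, 2), (2, 3)}"
      unfolding cond_C_8 h by (rule diophantine_8[OF n1 b])
    then show ?E using h type_n1 type_2_3 by auto
  next
    assume ?E
    then show "cond_C R 8"
      unfolding cond_C_8 by (elim disjE) (auto dest!: A1 A2)
  qed
  moreover have "cond_C R 10 \<longleftrightarrow> equiv_std R (std_A 1) \<or> equiv_std R std_2A1 \<or> equiv_std R (std_A 2)
         \<or> equiv_std R (std_D 4) \<or> equiv_std R std_E8" (is "_ \<longleftrightarrow> ?E")
  proof
    assume "cond_C R 10"
    then have "(CARD('n), h') \<in> {(1, 2), (2, 2), (2, 3), (4, 6), (8, 30)}"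
      unfolding cond_C_10 h by (rule diophantine_10[OF n1 b])
    then show ?E using h type_n1 type_2_2 type_2_3 type_4_6 type_8_30 by auto
  next
    assume ?E
    then show "cond_C R 10"
      unfolding cond_C_10 by (elim disjE) (auto dest!: A1 A2 D4 data_2A1 data_E8)
  qed
  moreover have "cond_C R 12 \<longleftrightarrow> equiv_std R (std_A 1)" (is "_ \<longleftrightarrow> ?E")
  proof
    assume "cond_C R 12"
    then have "(CARD('n), h') \<in> {(1, 2)}"
      unfolding cond_C_12 h by (rule diophantine_12[OF n1 b])
    then show ?E using type_n1 by auto
  next
    assume ?E
    then show "cond_C R 12"
      unfolding cond_C_12 by (auto dest!: A1)
  qed
  ultimately show ?thesis using cond_C_2 by blast
qed

end
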